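(* Let $n\ge1$, $v_i=(i,1)\in N=\mathbb{Z}^2$ for $0\le i\le n$, and let $C$ be the cone with rays through $v_0$ and $v_n$. The pairing between the solution space of $bbGKZ(C,0)$ and the solution space of $bbGKZ(C^\circ,0)$ given by $$\langle\Phi,\Psi\rangle=\Phi_{(0,0)}\sum_{0\le i<j\le n}(j-i)^2x_ix_j\Psi_{v_i+v_j}-\sum_{0\le i<j\le n}n(j-i)x_ix_j\sum_{\substack{c+d=v_i+v_j\\ c,d\in\sigma_{ij},\ \deg c=1}}\delta_{ij}^c\,\Phi_c\Psi_d$$ (whose value is a constant for every pair of solutions) is non-degenerate.
   Context: $bbGKZ(C,0)$ is the system for collections $(\Phi_c)$ of functions of $(x_0,\dots,x_n)$ indexed by lattice points $c\in C$: $\partial_i\Phi_c=\Phi_{c+v_i}$ for $0\le i\le n$, and $\sum_{i=0}^n\mu(v_i)x_i\partial_i\Phi_c+\mu(c)\Phi_c=0$ for all linear functions $\mu\in N^\vee$. $bbGKZ(C^\circ,0)$ is the same system for collections $(\Psi_d)$ indexed by lattice points $d$ in the interior $C^\circ$ of $C$. Solutions are holomorphic on a simply connected open subset of the nondegenerate locus, i.e. the set of $(x_0,\dots,x_n)\in\mathbb{C}^{n+1}$ such that $x_0\ne0$, $x_n\ne0$ and $f(z)=x_0+x_1z+\dots+x_nz^n$ has $n$ distinct roots. Both solution spaces are known to have dimension $n$. For $i<j$, $\sigma_{ij}$ is the cone generated by $v_i$ and $v_j$. The degree of a lattice point $(k,l)$ is $l$. In the inner sum, $c,d$ are lattice points and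 only terms with $d\in C^\circ$ are taken. $\delta_{ij}^c=1$ if $c$ lies in the interior of $\sigma_{ij}$ and $\delta_{ij}^c=\frac12$ otherwise. *)

theory Defs
  imports "HOL-Analysis.Analysis" "HOL-Library.Function_Algebras"
begin

section \<open>Lattice points and cones\<close>

definition gen :: "nat \<Rightarrow> int \<times> int" where
  "gen i = (int i, 1)"

definition to_plane :: "int \<times> int \<Rightarrow> real \<times> real" where
  "to_plane c = (real_of_int (fst c), real_of_int (snd c))"

definition lattice_points :: "(real \<times> real) set \<Rightarrow> (int \<times> int) set" where
  "lattice_points S = {c. to_plane c \<in> S}"

text \<open>The cone \<open>C\<close> is \<open>sigma_cone 0 n\<close>, and \<open>C\<^sup>\<circ>\<close> is its topological interior in the plane.\<close>

definition sigma_cone :: "nat \<Rightarrow> nat \<Rightarrow> (real \<times> real) set" where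
  "sigma_cone i j = convex_cone hull {to_plane (gen i), to_plane (gen j)}"

definition deg :: "int \<times> int \<Rightarrow> int" where
  "deg c = snd c"


section \<open>Functions of \<open>x\<^sub>0, \<dots>, x\<^sub>n\<close>\<close>

text \<open>
  Points of complex \<open>(n+1)\<close>-space are vectors \<open>x :: complex ^ 'm\<close>, where a bijection \<open>e\<close> from
  \<open>{0..n}\<close> onto the index type \<open>'m\<close> says which coordinate is which: \<open>x\<^sub>i\<close> is \<open>x $ e i\<close>.
\<close>

definition nondegenerate_locus :: "nat \<Rightarrow> (nat \<Rightarrow> 'm) \<Rightarrow> (complex ^ 'm::finite) set" where
  "nondegenerate_locus n e =
     {x. x $ e 0 \<noteq> 0 \<and> x $ e n \<noteq> 0 \<and> card {z. (\<Sum>i=0..n. x $ e i * z ^ i) = 0} = n}"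

text \<open>Holomorphy in several variables: the real Frechet derivative exists and is complex linear.\<close>

definition holomorphic_several_on :: "(complex ^ 'm::finite \<Rightarrow> complex) \<Rightarrow> (complex ^ 'm) set \<Rightarrow> bool" where
  "holomorphic_several_on F U \<longleftrightarrow>
     (\<forall>x\<in>U. \<exists>D. (F has_derivative D) (at x) \<and> (\<forall>a w. D (a *s w) = a * D w))"

definition partial_deriv ::
    "'m::finite \<Rightarrow> (complex ^ 'm \<Rightarrow> complex) \<Rightarrow> complex ^ 'm \<Rightarrow> complex" where
  "partial_deriv k F x = deriv (\<lambda>t. F (x + t *s axis k 1)) 0"


section \<open>The systems \<open>bbGKZ(C, 0)\<close> and \<open>bbGKZ(C\<^sup>\<circ>, 0)\<close>\<close>

text \<open>
  Solutions on the open set \<open>U\<close> for the system with index set \<open>K\<close>; the two systems are the cases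
  where \<open>K\<close> consists of the lattice points of \<open>C\<close> and of \<open>C\<^sup>\<circ>\<close>. A collection is a total function
  of the lattice point and of \<open>x\<close>, so it is normalised to be \<open>0\<close> outside \<open>K\<close> and outside \<open>U\<close>.
  This way two solutions are equal iff they agree on \<open>K\<close> and \<open>U\<close>.
\<close>

definition bbGKZ_solutions ::
    "nat \<Rightarrow> (nat \<Rightarrow> 'm) \<Rightarrow> (complex ^ 'm::finite) set \<Rightarrow> (int \<times> int) set \<Rightarrow>
       (int \<times> int \<Rightarrow> complex ^ 'm \<Rightarrow> complex) set" where
  "bbGKZ_solutions n e U K =
     {\<Phi>. (\<forall>c x. c \<notin> K \<or> x \<notin> U \<longrightarrow> \<Phi> c x = 0) \<and>
          (\<forall>c\<in>K. holomorphic_several_on (\<Phi> c) U) \<and>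
          (\<forall>c\<in>K. \<forall>i\<le>n. \<forall>x\<in>U. partial_deriv (e i) (\<Phi> c) x = \<Phi> (c + gen i) x) \<and>
          (\<forall>c\<in>K. \<forall>\<mu> :: int \<times> int \<Rightarrow> int. Modules.additive \<mu> \<longrightarrow>
             (\<forall>x\<in>U. (\<Sum>i=0..n. of_int (\<mu> (gen i)) * x $ e i * partial_deriv (e i) (\<Phi> c) x)
                      + of_int (\<mu> c) * \<Phi> c x = 0))}"


section \<open>The pairing\<close>

definition delta :: "nat \<Rightarrow> nat \<Rightarrow> int \<times> int \<Rightarrow> complex" where
  "delta i j c = (if to_plane c \<in> interior (sigma_cone i j) then 1 else 1 / 2)"

definition splittings :: "nat \<Rightarrow> nat \<Rightarrow> nat \<Rightarrow> ((int \<times> int) \<times> (int \<times> int)) set" where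
  "splittings n i j =
     {(c, d). c + d = gen i + gen j \<and>
              c \<in> lattice_points (sigma_cone i j) \<and> d \<in> lattice_points (sigma_cone i j) \<and>
              deg c = 1 \<and> d \<in> lattice_points (interior (sigma_cone 0 n))}"

definition pairing ::
    "nat \<Rightarrow> (nat \<Rightarrow> 'm) \<Rightarrow> (int \<times> int \<Rightarrow> complex ^ 'm::finite \<Rightarrow> complex) \<Rightarrow>
       (int \<times> int \<Rightarrow> complex ^ 'm \<Rightarrow> complex) \<Rightarrow> complex ^ 'm \<Rightarrow> complex" where
  "pairing n e \<Phi> \<Psi> x =
     \<Phi> (0, 0) x *
       (\<Sum>(i, j) | i < j \<and> j \<le> n. (of_nat (j - i))\<^sup>2 * x $ e i * x $ e j * \<Psi> (gen i + gen j) x)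
     - (\<Sum>(i, j) | i < j \<and> j \<le> n. of_nat n * of_nat (j - i) * x $ e i * x $ e j *
          (\<Sum>(c, d)\<in>splittings n i j. delta i j c * \<Phi> c x * \<Psi> d x))"

definition nondegenerate_pairing ::
    "'a::zero set \<Rightarrow> 'b::zero set \<Rightarrow> ('a \<Rightarrow> 'b \<Rightarrow> complex) \<Rightarrow> bool" where
  "nondegenerate_pairing V W b \<longleftrightarrow>
     (\<forall>x\<in>V. (\<forall>y\<in>W. b x y = 0) \<longrightarrow> x = 0) \<and>
     (\<forall>y\<in>W. (\<forall>x\<in>V. b x y = 0) \<longrightarrow> y = 0)"


section \<open>The sums in the pairing are finite\<close>

lemma finite_index_pairs: "finite {(i, j). i < j \<and> j \<le> (n::nat)}"
  by (rule finite_subset[of _ "{..n} \<times> {..n}"]) auto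

lemma sigma_cone_bounds:
  assumes "i \<le> j" and "p \<in> sigma_cone i j"
  shows "real i * snd p \<le> fst p \<and> fst p \<le> real j * snd p"
proof -
  let ?S = "{p :: real \<times> real. 0 \<le> snd p \<and> real i * snd p \<le> fst p \<and> fst p \<le> real j * snd p}"
  have "convex_cone ?S"
    unfolding convex_cone_iff
    by (auto simp: distrib_left mult.left_commute mult_left_mono)
  moreover have "{to_plane (gen i), to_plane (gen j)} \<subseteq> ?S"
    using assms(1) by (auto simp: to_plane_def gen_def)
  ultimately have "sigma_cone i j \<subseteq> ?S"
    unfolding sigma_cone_def by (simp add: hull_minimal)
  then show ?thesis
    using assms(2) by auto
qed

lemma finite_splittings:
  assumes "i < j"
  shows "finite (splittings n i j)"
proof (rule finite_subset)
  let ?A = "{int i..int j} \<times> {1::int}"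
  show "splittings n i j \<subseteq> (\<lambda>c. (c, gen i + gen j - c)) ` ?A"
  proof
    fix q assume "q \<in> splittings n i j"
    then obtain c d where q: "q = (c, d)" "c + d = gen i + gen j"
        "to_plane c \<in> sigma_cone i j" "snd c = 1"
      by (auto simp: splittings_def lattice_points_def deg_def)
    have "c \<in> ?A"
      using sigma_cone_bounds[of i j "to_plane c"] assms q(3,4)
      by (cases c) (auto simp: to_plane_def)
    moreover have "d = gen i + gen j - c"
      using q(2) by (simp add: algebra_simps)
    ultimately show "q \<in> (\<lambda>c. (c, gen i + gen j - c)) ` ?A"
      using q(1) by blast
  qed
qed simp

end

theory Submission
  imports Defs
begin

text \<open>
  Let \<open>f = x\<^sub>0 + x\<^sub>1 z + \<dots> + x\<^sub>n z\<^sup>n\<close> and \<open>\<theta> = z d/dz\<close>. For fixed \<open>x\<close>, the degree \<open>l\<close> part of a solution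
  is read as a linear functional \<open>\<Phi>\<^sub>l\<close> on polynomials, sending \<open>z\<^sup>k\<close> to the function with index
  \<open>(k, l)\<close>. The differential system then says that \<open>\<partial>\<^sub>i\<close> turns \<open>\<Phi>\<^sub>l(u)\<close> into \<open>\<Phi>\<^sub>l\<^sub>+\<^sub>1(z\<^sup>i u)\<close>, and that
  \<open>\<Phi>\<^sub>l\<^sub>+\<^sub>1(f u) = - l \<Phi>\<^sub>l(u)\<close> and \<open>\<Phi>\<^sub>l\<^sub>+\<^sub>1(\<theta>f \<cdot> u) = - \<Phi>\<^sub>l(\<theta>u)\<close>. For \<open>l \<ge> 1\<close> these are the rules satisfied by
  \<open>(-1)\<^sup>l (l - 1)! \<integral> u / f\<^sup>l dz/z\<close>, and every step below is the algebraic shadow of an integration by parts.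

  Over the simply connected \<open>U\<close> the roots \<open>r\<^sub>s\<close> of \<open>f\<close> and their logarithms are global holomorphic
  functions. Put \<open>l\<^sub>s = f / (z - r\<^sub>s)\<close>. The inner sum of the pairing, with its weights \<open>1/2\<close> at the two ends,
  is a trapezoidal sum; it has the kernel \<open>(z + w) (\<theta>f(z) f(w) - f(z) \<theta>f(w)) / (2 (z - w))\<close>. Since \<open>\<Phi>\<^sub>1\<close>
  kills \<open>f\<close>, it is a combination of evaluations at the roots, and at \<open>z = r\<^sub>s\<close> the kernel is a combination of
  \<open>f\<close> and \<open>l\<^sub>s\<close>. This gives (\<open>pairing_eq\<close>)
    \<open>\<langle>\<Phi>, \<Psi>\<rangle> = \<Phi>\<^sub>(\<^sub>0\<^sub>,\<^sub>0\<^sub>) E - n \<Sum>\<^sub>s a\<^sub>s B\<^sub>s\<close>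
  with \<open>a\<^sub>s = - \<Phi>\<^sub>1(r\<^sub>s l\<^sub>s)\<close> (\<open>weight\<close>), \<open>B\<^sub>s = \<Psi>\<^sub>1(r\<^sub>s l\<^sub>s)\<close> (\<open>period\<close>) and
  \<open>E = \<Psi>\<^sub>2(f \<theta>\<^sup>2f - (\<theta>f)\<^sup>2)\<close> (\<open>log_part\<close>), where \<open>\<Sum>\<^sub>s a\<^sub>s = 0\<close>.

  The pairing is constant because the \<open>a\<^sub>s\<close> and \<open>E\<close> are constant, the derivative of \<open>B\<^sub>s\<close> is that of
  \<open>(E/n) log r\<^sub>s\<close> up to a summand independent of \<open>s\<close>, and the derivative of \<open>\<Phi>\<^sub>(\<^sub>0\<^sub>,\<^sub>0\<^sub>)\<close> is that of
  \<open>\<Sum>\<^sub>s a\<^sub>s log r\<^sub>s\<close> (\<open>weight_line\<close>, \<open>log_part_line\<close>, \<open>period_line\<close>, \<open>level_one_weights\<close>).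

  For non-degeneracy one tests against explicit solutions. From functions \<open>H\<^sub>k\<close> with
  \<open>\<partial>\<^sub>i H\<^sub>k = \<partial>\<^sub>0 H\<^sub>k\<^sub>+\<^sub>i\<close>, such as \<open>log r\<^sub>s\<close>, \<open>r\<^sub>s\<^sup>k / k\<close>, one gets a solution
  \<open>\<partial>\<^sub>0\<^sup>l H\<^sub>k\<close> (\<open>tower_solution\<close>). Those built from \<open>r\<^sub>s\<close> have prescribed \<open>a\<^sub>s\<close> on \<open>C\<close>, and on \<open>C\<^sup>\<circ>\<close>
  they have \<open>E = 0\<close> and prescribed differences of the \<open>B\<^sub>s\<close>; a solution built from \<open>log r\<^sub>s \<cdot> r\<^sub>s\<^sup>k\<close> has \<open>E = - n\<close>. So an
  element \<open>\<Phi>\<close> of the left kernel has all \<open>a\<^sub>s = 0\<close> and then \<open>\<Phi>\<^sub>(\<^sub>0\<^sub>,\<^sub>0\<^sub>) = 0\<close>, while for \<open>\<Psi>\<close> in the right kernel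
  \<open>E = 0\<close> and all \<open>B\<^sub>s\<close> agree, which forces \<open>\<Psi>\<^sub>1 = 0\<close> and \<open>\<Psi>\<^sub>2 = 0\<close> (\<open>left_kernel_trivial\<close>,
  \<open>right_kernel_trivial\<close>). Since the pairing is constant, vanishing at one point is vanishing on \<open>U\<close>, so these
  conclusions hold at all points of \<open>U\<close> and all other \<open>\<Phi>\<^sub>c\<close>, \<open>\<Psi>\<^sub>d\<close> vanish, being derivatives.
\<close>

section \<open>The cones in coordinates\<close>

text \<open>
  Solving \<open>p = a v\<^sub>i + b v\<^sub>j\<close> gives coefficients \<open>a\<close>, \<open>b\<close> whose signs are the two inequalities. Nonnegativity
  of the degree is implied by them because \<open>i < j\<close>.
\<close>

lemma sigma_cone_eq:
  assumes "i < j"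
  shows "sigma_cone i j = {p. real i * snd p \<le> fst p \<and> fst p \<le> real j * snd p}"
proof (intro equalityI subsetI)
  fix p assume "p \<in> sigma_cone i j"
  then show "p \<in> {p. real i * snd p \<le> fst p \<and> fst p \<le> real j * snd p}"
    using sigma_cone_bounds[of i j p] assms by auto
next
  fix p :: "real \<times> real"
  assume "p \<in> {p. real i * snd p \<le> fst p \<and> fst p \<le> real j * snd p}"
  then obtain k l where p: "p = (k, l)" and kl: "real i * l \<le> k" "k \<le> real j * l"
    by (cases p) auto
  have ji: "real j - real i > 0" using assms by simp
  let ?H = "convex_cone hull {to_plane (gen i), to_plane (gen j)}"
  define a where "a = (real j * l - k) / (real j - real i)"
  define b where "b = (k - real i * l) / (real j - real i)"
  have "a \<ge> 0" "b \<ge> 0" using ji kl by (auto simp: a_def b_def)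
  moreover have "to_plane (gen i) \<in> ?H" "to_plane (gen j) \<in> ?H"
    by (auto intro: hull_inc)
  ultimately have "a *\<^sub>R to_plane (gen i) + b *\<^sub>R to_plane (gen j) \<in> ?H"
    by (intro convex_cone_hull_add convex_cone_hull_mul)
  moreover have "a *\<^sub>R to_plane (gen i) + b *\<^sub>R to_plane (gen j) = p"
  proof -
    have "a * real i + b * real j = k"
      using ji unfolding a_def b_def by (simp add: divide_simps) (simp add: algebra_simps)
    moreover have "a + b = l"
      using ji unfolding a_def b_def by (simp add: divide_simps) (simp add: algebra_simps)
    ultimately show ?thesis using ji by (simp add: p to_plane_def gen_def)
  qed
  ultimately show "p \<in> sigma_cone i j" by (simp add: sigma_cone_def)
qed

lemma interior_sigma_cone:
  assumes "i < j"
  shows "interior (sigma_cone i j) = {p. real i * snd p < fst p \<and> fst p < real j * snd p}"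
proof -
  have "sigma_cone i j = {p. (-1, real i) \<bullet> p \<le> 0} \<inter> {p. (1, - real j) \<bullet> p \<le> 0}"
    by (auto simp: sigma_cone_eq[OF assms] inner_prod_def)
  moreover have "(-1::real, real i) \<noteq> 0" "(1::real, - real j) \<noteq> 0" by (simp_all add: zero_prod_def)
  ultimately have "interior (sigma_cone i j) = {p. (-1, real i) \<bullet> p
      < 0} \<inter> {p. (1, - real j) \<bullet> p < 0}"
    by (simp add: interior_halfspace_le)
  then show ?thesis by (auto simp: inner_prod_def)
qed

lemma cone_point_iff:
  assumes "n \<ge> 1"
  shows "(k, l) \<in> lattice_points (sigma_cone 0 n) \<longleftrightarrow> 0 \<le> k \<and> k \<le> int n * l"
proof -
  have "real_of_int k \<le> real n * real_of_int l \<longleftrightarrow> k \<le> int n * l"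
    by (metis of_int_le_iff of_int_mult of_int_of_nat_eq)
  then show ?thesis
    using assms by (simp add: lattice_points_def sigma_cone_eq to_plane_def)
qed

lemma interior_point_iff:
  assumes "n \<ge> 1"
  shows "(k, l) \<in> lattice_points (interior (sigma_cone 0 n)) \<longleftrightarrow> 0 < k \<and> k < int n * l"
proof -
  have "real_of_int k < real n * real_of_int l \<longleftrightarrow> k < int n * l"
    by (metis of_int_less_iff of_int_mult of_int_of_nat_eq)
  then show ?thesis
    using assms by (simp add: lattice_points_def interior_sigma_cone to_plane_def)
qed

lemma delta_degree_one:
  assumes "i < j"
  shows "delta i j (k, 1) = (if int i < k \<and> k < int j then 1 else 1 / 2)"
  using assms by (simp add: delta_def interior_sigma_cone to_plane_def)

text \<open>
  A splitting \<open>v\<^sub>i + v\<^sub>j = c + d\<close> is \<open>c = (k, 1)\<close>, \<open>d = (i + j - k, 1)\<close>. The condition on \<open>d\<close> only drops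
  the terms where the degree 1 point \<open>d\<close> is \<open>v\<^sub>0\<close> or \<open>v\<^sub>n\<close>, so it can later be replaced by the convention that
  interior solutions are \<open>0\<close> there.
\<close>

lemma splittings_eq:
  assumes "n \<ge> 1" "i < j" "j \<le> n"
  shows "splittings n i j =
    (\<lambda>k. ((int k, 1), (int (i + j - k), 1))) ` {k\<in>{i..j}. 0 < i + j - k \<and> i + j - k < n}"
proof (intro equalityI subsetI)
  fix q assume q: "q \<in> splittings n i j"
  obtain a b c d where [simp]: "q = ((a, b), (c, d))" by (metis surj_pair)
  from q have *: "a + c = int i + int j" "b + d = 2" "(a, b) \<in> lattice_points (sigma_cone i j)"
     "b = 1" "(c, d) \<in> lattice_points (interior (sigma_cone 0 n))"
    by (auto simp: splittings_def gen_def deg_def)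
  then have "0 < c" "c < int n" "d = 1"
    using assms by (auto simp: interior_point_iff)
  moreover have "int i \<le> a" "a \<le> int j"
    using * assms(2) by (auto simp: lattice_points_def sigma_cone_eq to_plane_def)
  ultimately have "q = ((int (nat a), 1), (int (i + j - nat a), 1))" "nat a \<in> {i..j}"
      "0 < i + j - nat a" "i + j - nat a < n"
    using * by auto
  then show "q \<in> (\<lambda>k. ((int k, 1), (int (i + j - k), 1))) ` {k\<in>{i..j}. 0
      < i + j - k \<and> i + j - k < n}"
    by blast
next
  fix q :: "(int \<times> int) \<times> (int \<times> int)"
  assume "q \<in> (\<lambda>k. ((int k, 1), (int (i + j - k), 1))) ` {k\<in>{i..j}. 0
      < i + j - k \<and> i + j - k < n}"
  then obtain k where "i \<le> k" "k \<le> j" "0 < i + j - k" "i + j - k < n"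
      "q = ((int k, 1), (int (i + j - k), 1))" by auto
  moreover from this have "(int (i + j - k), 1) \<in> lattice_points (interior (sigma_cone 0 n))"
    using assms by (subst interior_point_iff) auto
  ultimately show "q \<in> splittings n i j"
    using assms by (auto simp: splittings_def gen_def deg_def lattice_points_def
        sigma_cone_eq to_plane_def of_nat_diff simp del: of_nat_add)
qed

section \<open>Polynomials, the Euler operator and functionals\<close>

definition theta :: "complex poly \<Rightarrow> complex poly" where
  "theta g = pCons 0 (pderiv g)"

lemma coeff_theta [simp]: "coeff (theta g) k = of_nat k * coeff g k"
  by (cases k) (simp_all add: theta_def coeff_pderiv)

lemma theta_add: "theta (g + h) = theta g + theta h"
  by (rule poly_eqI) (simp add: algebra_simps)

lemma theta_diff: "theta (g - h) = theta g - theta h"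
  by (rule poly_eqI) (simp add: algebra_simps)

lemma theta_smult: "theta (smult c g) = smult c (theta g)"
  by (rule poly_eqI) simp

lemma theta_monom: "theta (monom c k) = smult (of_nat k) (monom c k)"
  by (rule poly_eqI) simp

lemma theta_mult: "theta (g * h) = theta g * h + g * theta h"
  by (simp add: theta_def pderiv_mult algebra_simps)

lemma degree_theta: "degree (theta g) \<le> degree g"
  by (rule degree_le) (simp add: coeff_eq_0)

lemma poly_theta: "poly (theta g) z = z * poly (pderiv g) z"
  by (simp add: theta_def)

text \<open>
  Linear on all polynomials: coefficients beyond the degree vanish, so the summation bound can be enlarged
  (\<open>lin_bound\<close>).
\<close>

definition lin :: "(nat \<Rightarrow> complex) \<Rightarrow> complex poly \<Rightarrow> complex" where
  "lin A g = (\<Sum>k\<le>degree g. coeff g k * A k)"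

lemma lin_bound: "degree g \<le> N \<Longrightarrow> lin A g = (\<Sum>k\<le>N. coeff g k * A k)"
  unfolding lin_def by (rule sum.mono_neutral_left) (auto simp: coeff_eq_0)

lemma lin_add: "lin A (g + h) = lin A g + lin A h"
proof -
  have "degree (g + h) \<le> max (degree g) (degree h)" by (rule degree_add_le_max)
  then show ?thesis
    by (simp add: lin_bound[of _ "max (degree g) (degree h)"] sum.distrib algebra_simps)
qed

lemma lin_0 [simp]: "lin A 0 = 0" by (simp add: lin_def)

lemma lin_smult: "lin A (smult c g) = c * lin A g"
  by (simp add: lin_bound[of _ "degree g"] degree_smult_le sum_distrib_left mult.assoc)

lemma lin_minus: "lin A (- g) = - lin A g"
  using lin_smult[of A "-1" g] by simp

lemma lin_diff: "lin A (g - h) = lin A g - lin A h"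
  using lin_add[of A g "-h"] by (simp add: lin_minus)

lemma lin_sum: "lin A (\<Sum>i\<in>I. g i) = (\<Sum>i\<in>I. lin A (g i))"
  by (induction I rule: infinite_finite_induct) (auto simp: lin_add)

lemma lin_monom: "lin A (monom c k) = c * A k"
proof -
  have "lin A (monom c k) = (\<Sum>j\<le>k. coeff (monom c k) j * A j)"
    by (intro lin_bound degree_monom_le)
  also have "\<dots> = (\<Sum>j\<le>k. if k = j then c * A j else 0)" by (rule sum.cong) auto
  also have "\<dots> = c * A k" by simp
  finally show ?thesis .
qed

lemma lin_cong: "(\<And>k. coeff g k \<noteq> 0 \<Longrightarrow> A k = B k) \<Longrightarrow> lin A g = lin B g"
  unfolding lin_def by (rule sum.cong) auto

lemma lin_sum_left: "lin (\<lambda>k. \<Sum>s\<in>S. c s * A s k) g = (\<Sum>s\<in>S. c s * lin (A s) g)"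
  unfolding lin_def sum_distrib_left by (subst sum.swap) (simp add: mult.left_commute)

lemma lin_power: "lin (\<lambda>k. z ^ k) g = poly g z"
  by (simp add: lin_def poly_altdef)

lemma poly_expand: "degree g \<le> N \<Longrightarrow> g = (\<Sum>k\<le>N. monom (coeff g k) k)"
  by (rule poly_eqI) (auto simp: coeff_sum coeff_eq_0)

lemma lin_mult_expand: "degree g \<le> N \<Longrightarrow>
    lin A (h * g) = (\<Sum>k\<le>N. coeff g k * lin A (h * monom 1 k))"
proof -
  assume "degree g \<le> N"
  then have "h * g = h * (\<Sum>k\<le>N. monom (coeff g k) k)" using poly_expand by metis
  also have "\<dots> = (\<Sum>k\<le>N. smult (coeff g k) (h * monom 1 k))"
    by (simp add: sum_distrib_left smult_monom flip: mult_smult_right)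
  finally show ?thesis by (simp add: lin_sum lin_smult)
qed

lemma lin_mult_monom:
  "degree g \<le> N \<Longrightarrow> lin A (g * monom 1 k) = (\<Sum>i\<le>N. coeff g i * A (k + i))"
proof -
  assume "degree g \<le> N"
  then have "lin A (monom 1 k * g) = (\<Sum>i\<le>N. coeff g i * lin A (monom 1 k * monom 1 i))"
    by (rule lin_mult_expand)
  then show ?thesis by (simp add: mult_monom lin_monom mult.commute add.commute)
qed


lemma coeff_mult_top:
  assumes "degree p \<le> n" "degree q \<le> n"
  shows "coeff (p * q) (2 * n) = coeff p n * coeff q n"
proof -
  have "coeff (p * q) (2 * n) = (\<Sum>i\<le>2 * n. if i = n then coeff p n * coeff q n else 0)"
    unfolding coeff_mult
  proof (rule sum.cong[OF refl])
    fix i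
    show "coeff p i * coeff q (2 * n - i) = (if i = n then coeff p n * coeff q n else 0)"
      using assms by (cases i n rule: linorder_cases) (auto simp: coeff_eq_0)
  qed
  then show ?thesis by simp
qed

text \<open>
  The lowest and the highest coefficient cancel: \<open>f \<theta>\<^sup>2f - (\<theta>f)\<^sup>2 = f\<^sup>2 \<theta>(\<theta>f / f)\<close>, and \<open>\<theta>f / f\<close> takes the
  finite values \<open>0\<close> and \<open>n\<close> at \<open>0\<close> and \<open>\<infinity>\<close>. Hence only interior points of degree 2 occur.
\<close>

lemma theta_square_support:
  assumes "degree f \<le> n" "coeff (f * theta (theta f) - theta f * theta f) k \<noteq> 0"
  shows "0 < k" "k < 2 * n"
proof -
  let ?h = "f * theta (theta f) - theta f * theta f"
  have deg: "degree (theta f) \<le> n" "degree (theta (theta f)) \<le> n"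
    using assms(1) degree_theta[of f] degree_theta[of "theta f"] by auto
  then have "degree ?h \<le> 2 * n"
    using assms(1) by (intro degree_diff_le order_trans[OF degree_mult_le]) auto
  then have "k \<le> 2 * n" using le_degree[OF assms(2)] by simp
  moreover have "coeff ?h (2 * n) = 0" using assms(1) deg by (simp add: coeff_mult_top)
  moreover have "coeff ?h 0 = 0" by (simp add: coeff_mult)
  ultimately show "0 < k" "k < 2 * n"
    using assms(2) by (metis gr0I, metis le_neq_implies_less)
qed


section \<open>Interpolation at simple roots\<close>

locale simple_roots =
  fixes n :: nat and f :: "complex poly" and r :: "nat \<Rightarrow> complex"
  assumes n_pos: "n \<ge> 1" and degree_f: "degree f = n" and f_0: "coeff f 0 \<noteq> 0"
    and root: "s < n \<Longrightarrow> poly f (r s) = 0" and inj_r: "inj_on r {..<n}"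
begin

definition cofactor :: "nat \<Rightarrow> complex poly" where
  "cofactor s = synthetic_div f (r s)"

definition slope :: "nat \<Rightarrow> complex" where
  "slope s = poly (pderiv f) (r s)"

lemma root_nonzero: "s < n \<Longrightarrow> r s \<noteq> 0"
  using root[of s] f_0 by (auto simp: poly_0_coeff_0)

lemma cofactor: "s < n \<Longrightarrow> [:- r s, 1:] * cofactor s = f"
  using synthetic_div_correct'[of "r s" f] root[of s] by (simp add: cofactor_def)

lemma degree_cofactor: "degree (cofactor s) = n - 1"
  by (simp add: cofactor_def degree_synthetic_div degree_f)

lemma poly_cofactor: "s < n \<Longrightarrow> (z - r s) * poly (cofactor s) z = poly f z"
proof -
  assume "s < n"
  then have "poly ([:- r s, 1:] * cofactor s) z = poly f z" by (simp only: cofactor)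
  then show ?thesis by (simp add: algebra_simps)
qed

lemma poly_cofactor_other: "s < n \<Longrightarrow> t < n \<Longrightarrow> t \<noteq> s \<Longrightarrow>
    poly (cofactor s) (r t) = 0"
  using poly_cofactor[of s "r t"] root[of t] inj_r by (auto simp: inj_on_def)

lemma poly_cofactor_self: "s < n \<Longrightarrow> poly (cofactor s) (r s) = slope s"
proof -
  assume s: "s < n"
  have "pderiv f = pderiv ([:- r s, 1:] * cofactor s)" by (simp only: cofactor[OF s])
  also have "\<dots> = [:- r s, 1:] * pderiv (cofactor s) + cofactor s"
    by (simp only: pderiv_mult) (simp add: pderiv_pCons)
  finally show ?thesis by (simp add: slope_def)
qed

lemma eq_if_agree_on_roots:
  assumes "degree g < n" "degree h < n" "\<And>s. s < n \<Longrightarrow> poly g (r s) = poly h (r s)"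
  shows "g = h"
proof (rule poly_eqI_degree[of "r ` {..<n}"])
  show "card (r ` {..<n}) > degree g" "card (r ` {..<n}) > degree h"
    using assms by (simp_all add: card_image[OF inj_r])
qed (use assms in auto)

lemma slope_nonzero: "s < n \<Longrightarrow> slope s \<noteq> 0"
proof
  assume s: "s < n" and "slope s = 0"
  then have "cofactor s = 0"
    using n_pos poly_cofactor_self[OF s] poly_cofactor_other[OF s]
    by (intro eq_if_agree_on_roots) (simp_all add: degree_cofactor, metis)
  then have "f = 0" using cofactor[OF s] by simp
  then show False using f_0 by simp
qed

lemma interpolation:
  assumes "degree g < n"
  shows "g = (\<Sum>s<n. smult (poly g (r s) / slope s) (cofactor s))"
proof (rule eq_if_agree_on_roots[OF assms])
  show "degree (\<Sum>s<n. smult (poly g (r s) / slope s) (cofactor s)) < n"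
    using n_pos degree_sum_le[of "{..<n}" "\<lambda>s. smult (poly g (r s) / slope s) (cofactor s)" "n - 1"]
    by (fastforce intro: order.trans[OF degree_smult_le] simp: degree_cofactor)
  fix t assume t: "t < n"
  have "poly (\<Sum>s<n. smult (poly g (r s) / slope s) (cofactor s)) (r t)
      = (\<Sum>s<n. if s = t then poly g (r t) else 0)"
    unfolding poly_sum
    by (rule sum.cong) (use t in \<open>auto simp: poly_cofactor_other poly_cofactor_self slope_nonzero\<close>)
  then show "poly g (r t) = poly (\<Sum>s<n. smult (poly g (r s) / slope s) (cofactor s)) (r t)"
    using t by simp
qed

lemma coeff_cofactor_top:
  assumes s: "s < n"
  shows "coeff (cofactor s) (n - 1) = coeff f n"
proof -
  have "coeff f n = coeff ([:- r s, 1:] * cofactor s) n" by (simp only: cofactor[OF s])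
  moreover have "coeff (cofactor s) n = 0"
    using n_pos by (intro coeff_eq_0) (simp add: degree_cofactor)
  ultimately show ?thesis using n_pos by (cases n) simp_all
qed

lemma coeff_cofactor_0: "s < n \<Longrightarrow> coeff (cofactor s) 0 = - coeff f 0 / r s"
proof -
  assume s: "s < n"
  have "- (r s * coeff (cofactor s) 0) = coeff f 0"
    using poly_cofactor[OF s, of 0] by (simp add: poly_0_coeff_0)
  then show ?thesis
    using root_nonzero[OF s] by (metis minus_mult_right mult.commute nonzero_eq_divide_eq minus_minus)
qed

lemma leading_nonzero: "coeff f n \<noteq> 0"
  using degree_f n_pos by (metis leading_coeff_0_iff degree_0 not_one_le_zero)

lemma sum_over_slopes:
  assumes "degree g < n"
  shows "(\<Sum>s<n. poly g (r s) / slope s) = coeff g (n - 1) / coeff f n"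
proof -
  have "coeff g (n - 1) = (\<Sum>s<n. coeff (smult (poly g (r s) / slope s) (cofactor s)) (n - 1))"
    using arg_cong[OF interpolation[OF assms], of "\<lambda>p. coeff p (n - 1)"] by (simp only: coeff_sum)
  also have "\<dots> = (\<Sum>s<n. poly g (r s) / slope s) * coeff f n"
    unfolding sum_distrib_right
    by (rule sum.cong) (simp_all only: coeff_smult coeff_cofactor_top lessThan_iff)
  finally show ?thesis using leading_nonzero by simp
qed

text \<open>
  The top coefficient of the Lagrange interpolation of a power.
\<close>

lemma power_sum_over_slopes:
  assumes "k < n"
  shows "(\<Sum>s<n. r s ^ k / slope s) = (if k = n - 1 then 1 / coeff f n else 0)"
  using sum_over_slopes[of "monom 1 k"] assms by (auto simp: degree_monom_eq poly_monom)

text \<open>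
  The constant term of the Lagrange interpolation of the polynomial \<open>1\<close>.
\<close>

lemma inverse_sum_over_slopes: "(\<Sum>s<n. 1 / (r s * slope s)) = - 1 / coeff f 0"
proof -
  have "1 = (\<Sum>s<n. coeff (smult (poly 1 (r s) / slope s) (cofactor s)) 0)"
    using arg_cong[OF interpolation[of 1], of "\<lambda>p. coeff p 0"] n_pos by (simp add: coeff_sum)
  also have "\<dots> = - coeff f 0 * (\<Sum>s<n. 1 / (r s * slope s))"
    by (simp add: coeff_cofactor_0 sum_distrib_left mult.commute)
  finally have "coeff f 0 * (\<Sum>s<n. 1 / (r s * slope s)) = - 1"
    by (metis minus_minus mult_minus_left)
  then show ?thesis using f_0 by (metis mult.commute nonzero_eq_divide_eq)
qed

text \<open>
  Modulo \<open>f\<close>, polynomials are determined by their values at the roots.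
\<close>

lemma functional_at_roots:
  assumes "lin A f = 0" "degree g \<le> n"
  shows "lin A g = (\<Sum>s<n. lin A (cofactor s) / slope s * poly g (r s))"
proof -
  \<comment> \<open>Subtracting a multiple of \<open>f\<close> brings the degree below \<open>n\<close>, where interpolation applies.\<close>
  define c where "c = coeff g n / coeff f n"
  have "degree (g - smult c f) < n"
  proof (rule degree_lessI)
    show "g - smult c f \<noteq> 0 \<or> n > 0" using n_pos by simp
    show "\<forall>k\<ge>n. coeff (g - smult c f) k = 0"
      using assms(2) degree_f leading_nonzero by (auto simp: c_def coeff_eq_0 le_less)
  qed
  note int = interpolation[OF this]
  have "lin A g = lin A (g - smult c f)" by (simp add: lin_diff lin_smult assms(1))
  also have "\<dots> = (\<Sum>s<n. poly (g - smult c f) (r s) / slope s * lin A (cofactor s))"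
    by (subst int) (simp only: lin_sum lin_smult)
  also have "\<dots> = (\<Sum>s<n. lin A (cofactor s) / slope s * poly g (r s))"
    by (rule sum.cong) (auto simp: root)
  finally show ?thesis .
qed

lemma theta_cofactor: "s < n \<Longrightarrow> theta f = pCons 0 (cofactor s) + [:- r s, 1:] * theta (cofactor s)"
proof -
  assume s: "s < n"
  have "theta f = theta ([:- r s, 1:] * cofactor s)" by (simp only: cofactor[OF s])
  also have "\<dots> = pCons 0 (cofactor s) + [:- r s, 1:] * theta (cofactor s)"
    by (simp only: theta_mult) (simp add: theta_def pderiv_pCons)
  finally show ?thesis .
qed

text \<open>
  The hypothesis says that the functional kills the exact forms \<open>f\<^sup>2 \<theta>(g / f)\<close> with \<open>g\<close> of degree
  \<open>1, \<dots>, n - 1\<close>. Both sides of the claim come from such forms: \<open>f \<theta>\<^sup>2f - (\<theta>f)\<^sup>2\<close> is the one with \<open>g = \<theta>f\<close>, and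
  with \<open>l = f / (z - r)\<close> the polynomial \<open>- z l\<^sup>2\<close> is the one with \<open>g = l\<close>. Neither \<open>g\<close> is admissible, but the
  combination \<open>\<theta>f - n r l - n f\<close> is, as its lowest and highest coefficients cancel, and adding a
  multiple of \<open>f\<close> to \<open>g\<close> changes nothing.
\<close>

lemma quadratic_residue:
  assumes s: "s < n"
    and exact: "\<And>g. degree g < n \<Longrightarrow> coeff g 0 = 0 \<Longrightarrow>
        lin A (f * theta g - g * theta f) = 0"
  shows "of_nat n * r s * lin A (pCons 0 (cofactor s * cofactor s))
         = - lin A (f * theta (theta f) - theta f * theta f)"
proof -
  let ?l = "cofactor s" and ?N = "of_nat n :: complex"
  define g where "g = theta f - smult (?N * r s) ?l - smult ?N f"
  have "degree g < n"
  proof (rule degree_lessI)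
    show "g \<noteq> 0 \<or> n > 0" using n_pos by simp
    show "\<forall>k\<ge>n. coeff g k = 0"
    proof (intro allI impI)
      fix k assume "n \<le> k"
      then have "coeff ?l k = 0" using n_pos by (intro coeff_eq_0) (simp add: degree_cofactor)
      moreover have "k = n \<or> coeff f k = 0" using \<open>n \<le> k\<close> degree_f
          by (auto simp: coeff_eq_0 le_less)
      ultimately show "coeff g k = 0" by (auto simp: g_def)
    qed
  qed
  moreover have "coeff g 0 = 0"
    using root_nonzero[OF s] by (simp add: g_def coeff_cofactor_0[OF s])
  ultimately have "lin A (f * theta g - g * theta f) = 0" by (rule exact)
  moreover have "f * theta g - g * theta f
      = (f * theta (theta f) - theta f * theta f) + smult (?N * r s) (pCons 0 (?l * ?l))"
  proof -
    have "f * theta ?l - ?l * theta f = - pCons 0 (?l * ?l)"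
    proof -
      have "f * theta ?l - ?l * theta f
          = ([:- r s, 1:] * ?l) * theta ?l - ?l * (pCons 0 ?l + [:- r s, 1:] * theta ?l)"
        using cofactor[OF s] theta_cofactor[OF s] by simp
      also have "\<dots> = - pCons 0 (?l * ?l)" by (simp add: algebra_simps)
      finally show ?thesis .
    qed
    then have "smult (?N * r s) (f * theta ?l - ?l * theta f) = - smult (?N * r s) (pCons 0 (?l * ?l))"
      by simp
    moreover have "f * theta g - g * theta f
       = (f * theta (theta f) - theta f * theta f) - smult (?N * r s) (f * theta ?l - ?l * theta f)"
      by (simp add: g_def theta_add theta_diff theta_smult algebra_simps smult_diff_right)
    ultimately show ?thesis by simp
  qed
  ultimately have "lin A ((f * theta (theta f) - theta f * theta f)
      + smult (?N * r s) (pCons 0 (?l * ?l))) = 0" by simp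
  then show ?thesis
    by (simp add: lin_add lin_smult eq_neg_iff_add_eq_0 add.commute del: smult_pCons)
qed

end

section \<open>The kernel of the pairing\<close>

lemma sum_pairs_symmetric:
  fixes g :: "nat \<Rightarrow> nat \<Rightarrow> 'a::ab_group_add"
  shows "(\<Sum>(i, j) | i < j \<and> j \<le> n. g i j + g j i)
      = (\<Sum>i\<le>n. \<Sum>j\<le>n. g i j) - (\<Sum>i\<le>n. g i i)"
proof -
  let ?L = "{(i, j). i < j \<and> j \<le> n}" and ?D = "(\<lambda>i. (i, i)) ` {..n}" and ?G = "{(i, j). j
      < i \<and> i \<le> n}"
  have fin: "finite ?L" "finite ?G" "finite ?D"
    using finite_index_pairs[of n] by (auto intro: finite_subset[of _ "{..n} \<times> {..n}"])
  have "(\<Sum>i\<le>n. \<Sum>j\<le>n. g i j) = (\<Sum>(i, j)\<in>{..n} \<times> {..n}. g i j)"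
      by (simp add: sum.cartesian_product)
  also have "{..n} \<times> {..n} = (?L \<union> ?G) \<union> ?D" by auto
  also have "(\<Sum>(i, j)\<in>(?L \<union> ?G) \<union> ?D. g i j)
      = (\<Sum>(i, j)\<in>?L. g i j) + (\<Sum>(i, j)\<in>?G. g i j) + (\<Sum>(i, j)\<in>?D. g i j)"
    by (subst sum.union_disjoint, use fin in auto)+
  also have "(\<Sum>(i, j)\<in>?D. g i j) = (\<Sum>i\<le>n. g i i)"
    by (subst sum.reindex) (auto simp: inj_on_def)
  also have "(\<Sum>(i, j)\<in>?G. g i j) = (\<Sum>(i, j)\<in>?L. g j i)"
    by (rule sum.reindex_bij_witness[of _ prod.swap prod.swap]) auto
  finally show ?thesis by (simp add: sum.distrib case_prod_unfold)
qed

abbreviation trapezoid_weight :: "nat \<Rightarrow> nat \<Rightarrow> nat \<Rightarrow> complex" where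
  "trapezoid_weight i j k \<equiv> if i < k \<and> k < j then 1 else 1 / 2"

text \<open>
  Weights \<open>1/2\<close> at the ends turn a sum over points into a sum over steps.
\<close>

lemma trapezoid_sum:
  fixes h :: "nat \<Rightarrow> complex"
  assumes "i < j"
  shows "(\<Sum>k=i..j. trapezoid_weight i j k * h k) = (\<Sum>k=i..<j. (h k + h (Suc k)) / 2)"
  using assms
proof (induction j)
  case (Suc j)
  show ?case
  proof (cases "i = j")
    case True
    then show ?thesis by (simp add: add_divide_distrib)
  next
    case False
    with Suc.prems have ij: "i < j" by simp
    have "(\<Sum>k=i..j. trapezoid_weight i (Suc j) k * h k)
        = (\<Sum>k=i..j. trapezoid_weight i j k * h k + (if k = j then h j / 2 else 0))"
      by (rule sum.cong) (use ij in auto)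
    then show ?thesis using Suc.IH[OF ij] ij
      by (simp add: sum.distrib add_divide_distrib)
  qed
qed simp

text \<open>
  By \<open>trapezoid_sum\<close> each step contributes
  \<open>(z + w) / 2\<close> times a monomial; multiplied by \<open>z - w\<close> these monomials telescope. This is the point where the
  weights \<open>\<delta>\<close> of the pairing matter.
\<close>

lemma trapezoid_kernel:
  fixes z w :: complex
  assumes "i < j"
  shows "2 * (z - w) * (\<Sum>k=i..j. trapezoid_weight i j k * (z ^ k * w ^ (i + j - k)))
       = (z + w) * (z ^ j * w ^ i - z ^ i * w ^ j)"
proof -
  have "(\<Sum>k=i..j. trapezoid_weight i j k * (z ^ k * w ^ (i + j - k)))
     = (\<Sum>k=i..<j. (z ^ k * w ^ (i + j - k) + z ^ Suc k * w ^ (i + j - Suc k)) / 2)"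
    by (rule trapezoid_sum[OF assms])
  also have "2 * (z - w) * \<dots> = (\<Sum>k=i..<j. (z + w) * (z ^ Suc k * w ^ (i + j - Suc k) - z ^ k * w ^ (i
      + j - k)))"
    unfolding sum_distrib_left
  proof (rule sum.cong)
    fix k assume "k \<in> {i..<j}"
    then have "i + j - k = Suc (i + j - Suc k)" by auto
    then show "2 * (z - w) * ((z ^ k * w ^ (i + j - k) + z ^ Suc k * w ^ (i + j - Suc k)) / 2) =
         (z + w) * (z ^ Suc k * w ^ (i + j - Suc k) - z ^ k * w ^ (i + j - k))"
      by (simp add: field_simps)
  qed simp
  also have "\<dots> = (z + w) * (z ^ j * w ^ i - z ^ i * w ^ j)"
    using sum_Suc_diff'[of i j "\<lambda>k. z ^ k * w ^ (i + j - k)"] assms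
    by (simp add: sum_distrib_left[symmetric])
  finally show ?thesis .
qed

context
  fixes n :: nat and f :: "complex poly"
  assumes degree_f_le: "degree f \<le> n"
begin

text \<open>
  Symmetrising, \<open>(j - i)\<^sup>2\<close> becomes \<open>j\<^sup>2 - i j\<close> summed over all \<open>i\<close> and \<open>j\<close>.
\<close>

lemma sum_squared_differences:
  "(\<Sum>(i, j) | i < j \<and> j \<le> n. (of_nat (j - i))\<^sup>2 * coeff f i * coeff f j * A (i + j))
     = lin A (f * theta (theta f) - theta f * theta f)"
proof -
  let ?h = "\<lambda>i j. of_nat j * (of_nat j - of_nat i) * coeff f i * coeff f j * A (i + j)"
  have "(\<Sum>(i, j) | i < j \<and> j \<le> n. (of_nat (j - i))\<^sup>2 * coeff f i * coeff f j * A (i + j))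
     = (\<Sum>(i, j) | i < j \<and> j \<le> n. ?h i j + ?h j i)"
    by (rule sum.cong) (auto simp: of_nat_diff power2_eq_square algebra_simps)
  also have "\<dots> = (\<Sum>i\<le>n. \<Sum>j\<le>n. ?h i j)" by (simp add: sum_pairs_symmetric)
  also have "\<dots> = (\<Sum>i\<le>n. coeff f i * (\<Sum>j\<le>n. of_nat j * (of_nat j * coeff f j) * A (i + j)))
       - (\<Sum>i\<le>n. of_nat i * coeff f i * (\<Sum>j\<le>n. of_nat j * coeff f j * A (i + j)))"
    by (simp add: sum_distrib_left sum_subtractf[symmetric] algebra_simps)
  also have "\<dots> = lin A (theta (theta f) * f) - lin A (theta f * theta f)"
    using degree_f_le degree_theta[of f] degree_theta[of "theta f"]
    by (simp add: lin_mult_expand[of f n] lin_mult_expand[of "theta f" n] lin_mult_monom[of _ n])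
  finally show ?thesis by (simp add: lin_diff mult.commute)
qed

text \<open>
  The generating polynomial of the double sum in the pairing, with the variable of \<open>\<Phi>\<close> set to \<open>z\<close> and the
  variable of \<open>\<Psi>\<close> left free.
\<close>

definition kernel_poly :: "complex \<Rightarrow> complex poly" where
  "kernel_poly z = (\<Sum>(i, j) | i < j \<and> j \<le> n. smult (of_nat (j - i) * coeff f i * coeff f j)
     (\<Sum>k=i..j. smult (trapezoid_weight i j k * z ^ k) (monom 1 (i + j - k))))"

lemma lin_kernel_poly: "lin B (kernel_poly z) = (\<Sum>(i, j) | i < j \<and> j
    \<le> n. of_nat (j - i) * coeff f i * coeff f j *
     (\<Sum>k=i..j. trapezoid_weight i j k * z ^ k * B (i + j - k)))"
  by (simp add: kernel_poly_def lin_sum lin_smult lin_monom case_prod_beta)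

lemma poly_kernel_poly:
  "2 * (z - w) * poly (kernel_poly z) w
   = (z + w) * (poly (theta f) z * poly f w - poly f z * poly (theta f) w)"
proof -
  let ?h = "\<lambda>i j. (of_nat j - of_nat i) * coeff f i * coeff f j * (z ^ j * w ^ i)"
  have "2 * (z - w) * poly (kernel_poly z) w
      = (\<Sum>(i, j) | i < j \<and> j \<le> n. of_nat (j - i) * coeff f i * coeff f j *
        (2 * (z - w) * (\<Sum>k=i..j. trapezoid_weight i j k * (z ^ k * w ^ (i + j - k)))))"
    by (simp add: kernel_poly_def poly_sum case_prod_beta poly_monom sum_distrib_left algebra_simps)
  also have "\<dots> = (\<Sum>(i, j) | i < j \<and> j \<le> n. of_nat (j - i) * coeff f i * coeff f j *
        ((z + w) * (z ^ j * w ^ i - z ^ i * w ^ j)))"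
    by (rule sum.cong[OF refl], clarify, simp only: trapezoid_kernel)
  also have "\<dots> = (z + w) * (\<Sum>(i, j) | i < j \<and> j \<le> n. ?h i j + ?h j i)"
    unfolding sum_distrib_left
    by (rule sum.cong) (auto simp: of_nat_diff algebra_simps)
  also have "(\<Sum>(i, j) | i < j \<and> j \<le> n. ?h i j + ?h j i) = (\<Sum>i\<le>n. \<Sum>j\<le>n. ?h i j)"
    by (simp add: sum_pairs_symmetric)
  also have "\<dots> = (\<Sum>i\<le>n. coeff f i * w ^ i) * (\<Sum>j\<le>n. of_nat j * coeff f j * z ^ j)
       - (\<Sum>i\<le>n. of_nat i * coeff f i * w ^ i) * (\<Sum>j\<le>n. coeff f j * z ^ j)"
    by (simp only: sum_product sum_subtractf[symmetric], intro sum.cong refl)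
      (simp add: algebra_simps)
  also have "\<dots> = poly f w * poly (theta f) z - poly (theta f) w * poly f z"
    using degree_f_le degree_theta[of f]
    by (simp add: lin_bound[of _ n] flip: lin_power)
  finally show ?thesis by (simp add: mult.commute)
qed

end

context simple_roots
begin

text \<open>
  At a root the second term of \<open>poly_kernel_poly\<close> vanishes and \<open>f\<close> is divisible by \<open>w - r\<close>, so the
  denominator \<open>z - w\<close> cancels.
\<close>

lemma kernel_poly_at_root:
  assumes s: "s < n"
  shows "kernel_poly n f (r s) = smult (- poly (theta f) (r s) / 2) (f + smult (2 * r s) (cofactor s))"
proof -
  let ?P = "kernel_poly n f (r s)" and ?Q = "smult (poly (theta f) (r s)) ([:r s, 1:] * cofactor s)"
  have "[:r s, -1:] * (smult 2 ?P + ?Q) = 0"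
  proof (subst poly_eq_poly_eq_iff[symmetric], rule ext)
    fix w
    have "2 * (r s - w) * poly ?P w = (r s + w) * (poly (theta f) (r s) * ((w - r s) * poly (cofactor s) w))"
      using poly_kernel_poly[of f n "r s" w] degree_f root[OF s] poly_cofactor[OF s, of w] by simp
    then show "poly ([:r s, -1:] * (smult 2 ?P + ?Q)) w = poly 0 w"
      by (simp add: algebra_simps)
  qed
  moreover have "[:r s, -1:] \<noteq> 0" by simp
  ultimately have "smult 2 ?P + ?Q = 0" using mult_eq_0_iff by blast
  then have "?P = smult (-1/2) ?Q"
    by (simp add: poly_eq_iff field_simps eq_neg_iff_add_eq_0)
  moreover have "[:r s, 1:] * cofactor s = f + smult (2 * r s) (cofactor s)"
  proof -
    have "[:r s, 1:] * cofactor s = [:- r s, 1:] * cofactor s + smult (2 * r s) (cofactor s)"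
      by (rule poly_eqI) (simp add: coeff_pCons algebra_simps split: nat.split)
    then show ?thesis by (simp only: cofactor[OF s])
  qed
  ultimately show ?thesis by simp
qed

text \<open>
  As \<open>A\<close> kills \<open>f\<close>, it is a combination of evaluations at the roots and \<open>kernel_poly_at_root\<close> applies. The
  multiples of \<open>f\<close> that occur there add up to \<open>0\<close> because \<open>A\<close> also kills \<open>\<theta>f\<close>; this matters since \<open>B\<close> need
  not kill \<open>f\<close>.
\<close>

theorem pairing_sum_at_roots:
  assumes A: "lin A f = 0" "lin A (theta f) = 0"
  shows "(\<Sum>(i, j) | i < j \<and> j \<le> n. of_nat (j - i) * coeff f i * coeff f j *
     (\<Sum>k=i..j. trapezoid_weight i j k * A k * B (i + j - k)))
     = (\<Sum>s<n. - r s * lin A (cofactor s) * lin B (smult (r s) (cofactor s)))" (is "?S = _")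
proof -
  define \<alpha> where "\<alpha> s = lin A (cofactor s) / slope s" for s
  have Ak: "A k = (\<Sum>s<n. \<alpha> s * r s ^ k)" if "k \<le> n" for k
    using functional_at_roots[OF A(1), of "monom 1 k"] that
    by (simp add: lin_monom degree_monom_eq poly_monom \<alpha>_def)
  have "?S = (\<Sum>(i, j) | i < j \<and> j \<le> n. of_nat (j - i) * coeff f i * coeff f j *
     (\<Sum>k=i..j. trapezoid_weight i j k * (\<Sum>s<n. \<alpha> s * r s ^ k) * B (i + j - k)))"
    by (intro sum.cong refl, clarify, intro arg_cong2[of _ _ _ _ "(*)"] refl sum.cong) (auto simp: Ak)
  also have "\<dots> = (\<Sum>(i, j) | i < j \<and> j
      \<le> n. \<Sum>s<n. \<alpha> s * (of_nat (j - i) * coeff f i * coeff f j *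
     (\<Sum>k=i..j. trapezoid_weight i j k * r s ^ k * B (i + j - k))))"
  proof (intro sum.cong refl, clarify)
    fix i j :: nat
    have "(\<Sum>k=i..j. trapezoid_weight i j k * (\<Sum>s<n. \<alpha> s * r s ^ k) * B (i + j - k))
       = (\<Sum>s<n. \<alpha> s * (\<Sum>k=i..j. trapezoid_weight i j k * r s ^ k * B (i + j - k)))"
      unfolding sum_distrib_left sum_distrib_right by (subst sum.swap) (simp add: mult_ac)
    then show "of_nat (j - i) * coeff f i * coeff f j *
       (\<Sum>k=i..j. trapezoid_weight i j k * (\<Sum>s<n. \<alpha> s * r s ^ k) * B (i + j - k))
       = (\<Sum>s<n. \<alpha> s * (of_nat (j - i) * coeff f i * coeff f j *
     (\<Sum>k=i..j. trapezoid_weight i j k * r s ^ k * B (i + j - k))))"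
      by (simp add: sum_distrib_left mult_ac)
  qed
  also have "\<dots> = (\<Sum>s<n. \<alpha> s * lin B (kernel_poly n f (r s)))"
    unfolding lin_kernel_poly[OF degree_f[THEN eq_refl]] case_prod_beta sum_distrib_left[of "\<alpha> _"]
    by (rule sum.swap)
  also have "\<dots> = (\<Sum>s<n. - \<alpha> s * poly (theta f) (r s) * (lin B f / 2) - \<alpha> s * poly
      (theta f) (r s) * lin B (smult (r s) (cofactor s)))"
    by (rule sum.cong) (simp_all add: kernel_poly_at_root lin_smult lin_add lin_minus algebra_simps)
  also have "\<dots> = - (\<Sum>s<n. \<alpha> s * poly (theta f) (r s)) * (lin B f / 2) + (\<Sum>s<n.
      - \<alpha> s * poly (theta f) (r s) * lin B (smult (r s) (cofactor s)))"
    by (simp add: sum_subtractf sum_negf sum_distrib_right)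
  also have "(\<Sum>s<n. \<alpha> s * poly (theta f) (r s)) = 0"
    using functional_at_roots[OF A(1), of "theta f"] A(2) degree_theta[of f] degree_f by (simp add: \<alpha>_def)
  also have "(\<Sum>s<n. - \<alpha> s * poly (theta f) (r s) * lin B (smult (r s) (cofactor s)))
     = (\<Sum>s<n. - r s * lin A (cofactor s) * lin B (smult (r s) (cofactor s)))"
    by (rule sum.cong) (auto simp: \<alpha>_def poly_theta slope_def[symmetric] slope_nonzero)
  finally show ?thesis by simp
qed

end

section \<open>Holomorphic functions of several variables\<close>

lemma smult_axis: "t *s axis k (1::complex) = axis k t"
  by (simp add: vec_eq_iff axis_def)

lemma axis_zero_complex [simp]: "axis k (0::complex) = 0"
  by (simp add: vec_eq_iff axis_def)

lemma norm_axis_complex: "norm (axis k (t::complex)) = norm t"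
  by (simp add: norm_vec_def L2_set_def axis_def if_distrib[of norm] if_distrib[of
      "\<lambda>x. x ^ 2"] cong: if_cong)

lemma partial_deriv_axis: "partial_deriv k F x = deriv (\<lambda>t. F (x + axis k t)) 0"
  by (simp add: partial_deriv_def smult_axis)

lemma bounded_linear_axis: "bounded_linear (axis k :: complex \<Rightarrow> complex ^ 'm::finite)"
  by (intro linear_conv_bounded_linear[THEN iffD1] linearI) (auto simp: vec_eq_iff axis_def)

lemma has_field_derivative_line:
  assumes "(F has_derivative D) (at (x + axis k t))" "\<And>a w. D (a *s w) = a * D w"
  shows "((\<lambda>t. F (x + axis k t)) has_field_derivative D (axis k (1::complex))) (at t)"
proof -
  have "((\<lambda>t. x + axis k t) has_derivative (\<lambda>t. axis k t)) (at t)"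
    using has_derivative_add[OF has_derivative_const[of x] bounded_linear_imp_has_derivative[OF
        bounded_linear_axis]]
    by simp
  from has_derivative_compose[OF this, of F D] assms(1)
  have "((\<lambda>t. F (x + axis k t)) has_derivative (\<lambda>t. D (axis k t))) (at t)" by simp
  moreover have "(\<lambda>t. D (axis k t)) = (*) (D (axis k 1))"
  proof
    fix t show "D (axis k t) = D (axis k 1) * t"
      using assms(2)[of t "axis k 1"] by (simp only: smult_axis mult.commute)
  qed
  ultimately show ?thesis by (simp only: has_field_derivative_def)
qed

lemma partial_derivI:
  "((\<lambda>t. F (x + axis k t)) has_field_derivative d) (at 0) \<Longrightarrow> partial_deriv k F x = d"
  by (simp add: partial_deriv_axis DERIV_imp_deriv)

lemma frechet_axis:
  assumes "(F has_derivative D) (at x)" "\<And>a w. D (a *s w) = a * D w"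
  shows "D (axis k 1) = partial_deriv k F x"
  using partial_derivI[OF has_field_derivative_line[of F D x k 0]] assms by simp

lemma holomorphic_several_derivative:
  fixes F :: "complex ^ 'm::finite \<Rightarrow> complex"
  assumes "holomorphic_several_on F U" "x \<in> U"
  shows "(F has_derivative (\<lambda>w. \<Sum>k\<in>UNIV. w $ k * partial_deriv k F x)) (at x)"
proof -
  obtain D where D: "(F has_derivative D) (at x)" "\<And>a w. D (a *s w) = a * D w"
    using assms unfolding holomorphic_several_on_def by blast
  interpret D: bounded_linear D using D(1) by (rule has_derivative_bounded_linear)
  have "D w = (\<Sum>k\<in>UNIV. w $ k * partial_deriv k F x)" for w
  proof -
    have "w = (\<Sum>k\<in>UNIV. (w $ k) *s axis k 1)"
      by (simp add: vec_eq_iff axis_def if_distrib cong: if_cong)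
    then have "D w = (\<Sum>k\<in>UNIV. D ((w $ k) *s axis k 1))" by (metis D.sum)
    then show ?thesis by (simp add: D(2) frechet_axis[OF D])
  qed
  then have "D = (\<lambda>w. \<Sum>k\<in>UNIV. w $ k * partial_deriv k F x)" by (rule ext)
  then show ?thesis using D(1) by (simp only:)
qed

lemma partial_line:
  assumes "holomorphic_several_on F U" "x + axis k t \<in> U"
  shows "((\<lambda>t. F (x + axis k t)) has_field_derivative partial_deriv k F (x + axis k t)) (at t)"
proof -
  obtain D where D: "(F has_derivative D) (at (x + axis k t))" "\<And>a w. D (a *s w) = a * D w"
    using assms unfolding holomorphic_several_on_def by blast
  show ?thesis
    using has_field_derivative_line[OF D] frechet_axis[OF D] by simp
qed

lemma partial_at:
  assumes "holomorphic_several_on F U" "x \<in> U"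
  shows "((\<lambda>t. F (x + axis k t)) has_field_derivative partial_deriv k F x) (at 0)"
  using partial_line[of F U x k 0] assms by simp

lemma eventually_line:
  assumes "open U" "x \<in> U"
  shows "\<forall>\<^sub>F t in nhds 0. x + axis k (t::complex) \<in> U"
proof -
  have "((\<lambda>t. x + axis k t) \<longlongrightarrow> x + axis k 0) (nhds (0::complex))"
    by (intro tendsto_intros bounded_linear.tendsto[OF bounded_linear_axis] filterlim_ident)
  from topological_tendstoD[OF this assms(1)] show ?thesis using assms(2) by simp
qed

lemma partial_deriv_cong:
  assumes "open U" "x \<in> U" "\<And>y. y \<in> U \<Longrightarrow> F y = G y"
  shows "partial_deriv k F x = partial_deriv k G x"
  unfolding partial_deriv_axis
  by (rule deriv_cong_ev[OF _ refl]) (rule eventually_mono[OF eventually_line[OF assms(1,2)]], rule assms(3))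

lemma holomorphic_several_cong:
  assumes "open U" "\<And>y. y \<in> U \<Longrightarrow> F y = G y" "holomorphic_several_on F U"
  shows "holomorphic_several_on G U"
  unfolding holomorphic_several_on_def
proof
  fix x assume x: "x \<in> U"
  then obtain D where "(F has_derivative D) (at x)" "\<forall>a w. D (a *s w) = a * D w"
    using assms(3) unfolding holomorphic_several_on_def by blast
  then show "\<exists>D. (G has_derivative D) (at x) \<and> (\<forall>a w. D (a *s w) = a * D w)"
    using has_derivative_transform_within_open[of F _ x UNIV U G, OF _ assms(1) x assms(2)] by blast
qed

lemma holomorphic_several_const [intro]: "holomorphic_several_on (\<lambda>x. c) U"
  unfolding holomorphic_several_on_def by (auto intro!: exI[of _ "\<lambda>_. 0"])

lemma holomorphic_several_coord [intro]: "holomorphic_several_on (\<lambda>x. x $ k) U"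
  unfolding holomorphic_several_on_def
  by (auto intro!: exI[of _ "\<lambda>w. w $ k"] bounded_linear_imp_has_derivative bounded_linear_vec_nth)

lemma holomorphic_several_add [intro]:
  assumes "holomorphic_several_on F U" "holomorphic_several_on G U"
  shows "holomorphic_several_on (\<lambda>x. F x + G x) U"
  unfolding holomorphic_several_on_def
proof
  fix x assume x: "x \<in> U"
  obtain D D' where D: "(F has_derivative D) (at x)" "\<forall>a w. D (a *s w) = a * D w"
     "(G has_derivative D') (at x)" "\<forall>a w. D' (a *s w) = a * D' w"
    using assms x unfolding holomorphic_several_on_def by meson
  then show "\<exists>D. ((\<lambda>x. F x + G x) has_derivative D) (at x) \<and> (\<forall>a w. D (a *s w)
      = a * D w)"
    by (intro exI[of _ "\<lambda>w. D w + D' w"] conjI has_derivative_add) (auto simp: algebra_simps)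
qed

lemma holomorphic_several_mult [intro]:
  assumes "holomorphic_several_on F U" "holomorphic_several_on G U"
  shows "holomorphic_several_on (\<lambda>x. F x * G x) U"
  unfolding holomorphic_several_on_def
proof
  fix x assume x: "x \<in> U"
  obtain D D' where D: "(F has_derivative D) (at x)" "\<forall>a w. D (a *s w) = a * D w"
     "(G has_derivative D') (at x)" "\<forall>a w. D' (a *s w) = a * D' w"
    using assms x unfolding holomorphic_several_on_def by meson
  then show "\<exists>D. ((\<lambda>x. F x * G x) has_derivative D) (at x) \<and> (\<forall>a w. D (a *s w)
      = a * D w)"
    by (intro exI[of _ "\<lambda>w. F x * D' w + D w * G x"] conjI has_derivative_mult) (auto simp: algebra_simps)
qed

lemma holomorphic_several_sum [intro]:
  "(\<And>i. i \<in> I \<Longrightarrow> holomorphic_several_on (F i) U) \<Longrightarrow>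
      holomorphic_several_on (\<lambda>x. \<Sum>i\<in>I. F i x) U"
  by (induction I rule: infinite_finite_induct) auto

lemma holomorphic_several_compose:
  assumes "holomorphic_several_on F U" "\<And>x. x \<in> U \<Longrightarrow>
      (g has_field_derivative g' (F x)) (at (F x))"
  shows "holomorphic_several_on (\<lambda>x. g (F x)) U"
  unfolding holomorphic_several_on_def
proof
  fix x assume x: "x \<in> U"
  obtain D where D: "(F has_derivative D) (at x)" "\<forall>a w. D (a *s w) = a * D w"
    using assms(1) x unfolding holomorphic_several_on_def by meson
  from has_derivative_compose[OF D(1), of g "\<lambda>h. g' (F x) * h"] assms(2)[OF x]
  have "((\<lambda>x. g (F x)) has_derivative (\<lambda>w. g' (F x) * D w)) (at x)"
    by (simp add: has_field_derivative_def)
  then show "\<exists>D. ((\<lambda>x. g (F x)) has_derivative D) (at x) \<and> (\<forall>a w. D (a *s w)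
      = a * D w)"
    using D(2) by (intro exI[of _ "\<lambda>w. g' (F x) * D w"]) auto
qed

lemma holomorphic_several_inverse [intro]:
  assumes "holomorphic_several_on F U" "\<And>x. x \<in> U \<Longrightarrow> F x \<noteq> 0"
  shows "holomorphic_several_on (\<lambda>x. inverse (F x)) U"
  by (rule holomorphic_several_compose[OF assms(1) DERIV_inverse]) (rule assms(2))

lemma constant_if_partials_zero:
  fixes F :: "complex ^ 'm::finite \<Rightarrow> complex"
  assumes "open U" "connected U" "holomorphic_several_on F U"
    and "\<And>x k. x \<in> U \<Longrightarrow> partial_deriv k F x = 0"
  shows "F constant_on U"
proof -
  have "(F has_derivative (\<lambda>w. 0)) (at x)" if "x \<in> U" for x
    using holomorphic_several_derivative[OF assms(3) that] assms(4)[OF that] by simp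
  then show ?thesis
    using has_derivative_zero_unique_connected[OF assms(1,2)] unfolding constant_on_def by metis
qed

subsection \<open>Symmetry of second derivatives\<close>

text \<open>
  The mixed second difference of \<open>F\<close> is the increment of \<open>u \<mapsto> F(x + u e\<^sub>i + t e\<^sub>j) - F(x + u e\<^sub>i)\<close>. Its
  derivative is an increment of \<open>\<partial>\<^sub>i F\<close>, which is differentiable at \<open>x\<close>, so the mean value inequality
  bounds the error.
\<close>

lemma second_difference_bound:
  fixes F :: "complex ^ 'm::finite \<Rightarrow> complex"
  assumes U: "open U" "x \<in> U" and F: "holomorphic_several_on F U"
    and Fi: "holomorphic_several_on (partial_deriv i F) U" and "\<epsilon> > 0"
  shows "\<forall>\<^sub>F t in at_right 0. norm (F (x + axis i (of_real t) + axis j (of_real t)) - F (x + axis i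
      (of_real t))
      - F (x + axis j (of_real t)) + F x - of_real (t ^ 2) * partial_deriv j (partial_deriv i F) x)
          \<le> \<epsilon> * t ^ 2"
proof -
  let ?G = "partial_deriv i F"
  obtain D where D: "(?G has_derivative D) (at x)" "\<And>a w. D (a *s w) = a * D w"
    using Fi U(2) unfolding holomorphic_several_on_def by blast
  interpret D: bounded_linear D using D(1) by (rule has_derivative_bounded_linear)
  have Dj: "D (axis j t) = t * partial_deriv j ?G x" for t
    using frechet_axis[OF D, of j] D(2)[of t "axis j 1"] by (simp add: smult_axis)
  obtain d1 where d1: "d1 > 0" "\<And>y. norm (y - x) < d1 \<Longrightarrow>
      norm (?G y - ?G x - D (y - x)) \<le> \<epsilon> / 3 * norm (y - x)"
    using D(1) \<open>\<epsilon> > 0\<close> unfolding has_derivative_at_alt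
        by (meson divide_pos_pos zero_less_numeral)
  obtain d2 where d2: "d2 > 0" "ball x d2 \<subseteq> U" using U open_contains_ball by blast
  define d where "d = min d1 d2 / 2"
  have "norm (F (x + axis i (of_real t) + axis j (of_real t)) - F (x + axis i (of_real t))
      - F (x + axis j (of_real t)) + F x - of_real (t ^ 2) * partial_deriv j ?G x) \<le> \<epsilon> * t ^ 2"
    if t: "0 < t" "t < d" for t
  proof -
    let ?y = "x + axis j (of_real t :: complex)"
    define g where "g u = F (?y + axis i u) - F (x + axis i u) - u * D (axis j (of_real t))" for u
    define g' where "g' u = ?G (?y + axis i u) - ?G (x + axis i u) - D (axis j (of_real t))" for u
    have small: "norm (axis j (of_real t :: complex) + axis i u :: complex ^ 'm) \<le> 2 * t"
        "norm (axis i u :: complex ^ 'm) \<le> t" if "u \<in> cball 0 t" for u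
      using that t(1) norm_triangle_ineq[of "axis j (of_real t)" "axis i u"]
      by (auto simp: norm_axis_complex)
    have inU: "?y + axis i u \<in> U" "x + axis i u \<in> U" if "u \<in> cball 0 t" for u
    proof -
      have "norm (axis j (of_real t :: complex) + axis i u :: complex ^ 'm) < d2"
          "norm (axis i u :: complex ^ 'm) < d2"
        using small[OF that] t by (auto simp: d_def)
      moreover have "x - (?y + axis i u) = - (axis j (of_real t) + axis i u)" "x - (x + axis i u) = - axis i u"
        by simp_all
      ultimately have "?y + axis i u \<in> ball x d2" "x + axis i u \<in> ball x d2"
        by (simp_all only: mem_ball dist_norm norm_minus_cancel)
      then show "?y + axis i u \<in> U" "x + axis i u \<in> U" using d2(2) by auto
    qed
    have "norm (g (of_real t) - g 0) \<le> (\<epsilon> * t) * norm (complex_of_real t - 0)"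
    proof (rule field_differentiable_bound[of "cball 0 t" g g'])
      fix u assume u: "u \<in> cball (0::complex) t"
      show "(g has_field_derivative g' u) (at u within cball 0 t)"
        unfolding g_def g'_def
        by (rule derivative_eq_intros DERIV_subset[OF partial_line[OF F]] inU[OF u] subset_UNIV refl)+ simp
      have "norm (?G (?y + axis i u) - ?G x - D (axis j (of_real t) + axis i u))
          \<le> \<epsilon> / 3 * norm (axis j (of_real t :: complex) + axis i u :: complex ^ 'm)"
        using d1(2)[of "?y + axis i u"] small[OF u] t by (simp add: d_def add.assoc)
      also have "\<dots> \<le> \<epsilon> / 3 * (2 * t)" using small[OF u] \<open>\<epsilon> > 0\<close>
          by (intro mult_left_mono) auto
      finally have 1: "norm (?G (?y + axis i u) - ?G x - D (axis j (of_real t) + axis i u))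
          \<le> \<epsilon> / 3 * (2 * t)" .
      have "norm (?G (x + axis i u) - ?G x - D (axis i u)) \<le> \<epsilon> / 3 * norm (axis i u :: complex ^ 'm)"
        using d1(2)[of "x + axis i u"] small[OF u] t by (simp add: d_def)
      also have "\<dots> \<le> \<epsilon> / 3 * t" using small[OF u] \<open>\<epsilon> > 0\<close>
          by (intro mult_left_mono) auto
      finally have 2: "norm (?G (x + axis i u) - ?G x - D (axis i u)) \<le> \<epsilon> / 3 * t" .
      have "g' u = (?G (?y + axis i u) - ?G x - D (axis j (of_real t) + axis i u)) - (?G (x + axis i u) - ?G x - D
          (axis i u))"
        by (simp add: g'_def D.add)
      then have "norm (g' u) \<le> norm (?G (?y + axis i u) - ?G x - D (axis j (of_real t) + axis i u))
          + norm (?G (x + axis i u) - ?G x - D (axis i u))"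
        by (simp only: norm_triangle_ineq4)
      also have "\<dots> \<le> \<epsilon> / 3 * (2 * t) + \<epsilon> / 3 * t" by (rule add_mono[OF 1 2])
      finally show "norm (g' u) \<le> \<epsilon> * t" by simp
    qed (use t in auto)
    then show ?thesis
      using t by (simp add: g_def Dj power2_eq_square algebra_simps)
  qed
  moreover have "d > 0" using d1 d2 by (simp add: d_def)
  ultimately show ?thesis unfolding eventually_at_right_field by blast
qed

text \<open>
  The second difference is symmetric in \<open>i\<close> and \<open>j\<close>, and divided by \<open>t\<^sup>2\<close> it approximates both mixed
  derivatives.
\<close>

lemma partial_deriv_commute:
  fixes F :: "complex ^ 'm::finite \<Rightarrow> complex"
  assumes U: "open U" "x \<in> U" and F: "holomorphic_several_on F U"
    and Fi: "holomorphic_several_on (partial_deriv i F) U" and Fj: "holomorphic_several_on (partial_deriv j F) U"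
  shows "partial_deriv i (partial_deriv j F) x = partial_deriv j (partial_deriv i F) x" (is "?a = ?b")
proof (rule ccontr)
  assume "?a \<noteq> ?b"
  \<comment> \<open>With \<open>\<epsilon>\<close> a third of the difference, two errors of size \<open>\<epsilon>\<close> cannot make up for it.\<close>
  define \<epsilon> where "\<epsilon> = norm (?a - ?b) / 3"
  have "\<epsilon> > 0" using \<open>?a \<noteq> ?b\<close> by (simp add: \<epsilon>_def)
  let ?\<Delta> = "\<lambda>t. F (x + axis i (of_real t) + axis j (of_real t)) - F (x + axis i (of_real t))
      - F (x + axis j (of_real t)) + F x"
  have "\<forall>\<^sub>F t in at_right 0. norm (?\<Delta> t - of_real (t ^ 2) * ?b) \<le> \<epsilon> * t ^ 2"
    by (rule second_difference_bound[OF U F Fi \<open>\<epsilon> > 0\<close>])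
  moreover have "\<forall>\<^sub>F t in at_right 0. norm (?\<Delta> t - of_real (t ^ 2) * ?a)
      \<le> \<epsilon> * t ^ 2"
    using second_difference_bound[OF U F Fj \<open>\<epsilon> > 0\<close>, of i] by (simp add: add_ac diff_diff_eq)
  moreover have "\<forall>\<^sub>F t::real in at_right 0. t > 0" by (simp add: eventually_at_right_less)
  ultimately have "\<forall>\<^sub>F t::real in at_right 0. False"
  proof eventually_elim
    case (elim t)
    have "of_real (t ^ 2) * (?a - ?b) = (?\<Delta> t - of_real (t ^ 2) * ?b) - (?\<Delta> t - of_real (t ^ 2) * ?a)"
      by (simp add: algebra_simps)
    then have "norm (of_real (t ^ 2) * (?a - ?b)) \<le> 2 * \<epsilon> * t ^ 2"
      using norm_triangle_ineq4[of "?\<Delta> t - of_real (t ^ 2) * ?b"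
          "?\<Delta> t - of_real (t ^ 2) * ?a"] elim by simp
    moreover have "norm (of_real (t ^ 2) * (?a - ?b)) = 3 * \<epsilon> * t ^ 2"
      by (simp add: norm_mult \<epsilon>_def norm_power)
    moreover have "\<epsilon> * t ^ 2 > 0" using \<open>\<epsilon> > 0\<close> elim by simp
    ultimately show False by simp
  qed
  then show False by simp
qed

subsection \<open>Infinitely differentiable functions\<close>

text \<open>
  Differentiability of all orders is needed for the solutions \<open>\<partial>\<^sub>0\<^sup>l H\<^sub>k\<close>. Counting the orders makes the closure
  properties provable by induction, also for implicitly defined functions such as roots.
\<close>

primrec smooth_upto :: "nat \<Rightarrow> (complex ^ 'm::finite) set \<Rightarrow>
    (complex ^ 'm \<Rightarrow> complex) \<Rightarrow> bool" where
  "smooth_upto 0 U F \<longleftrightarrow> holomorphic_several_on F U"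
| "smooth_upto (Suc m) U F \<longleftrightarrow> holomorphic_several_on F U \<and> (\<forall>k. smooth_upto m U
    (partial_deriv k F))"

lemma smooth_upto_holomorphic: "smooth_upto m U F \<Longrightarrow> holomorphic_several_on F U"
  by (cases m) auto

lemma smooth_upto_mono: "smooth_upto (Suc m) U F \<Longrightarrow> smooth_upto m U F"
  by (induction m arbitrary: F) auto

lemma smooth_upto_cong:
  assumes "open U"
  shows "smooth_upto m U F \<Longrightarrow> (\<And>x. x \<in> U \<Longrightarrow> F x = G x) \<Longrightarrow>
      smooth_upto m U G"
proof (induction m arbitrary: F G)
  case 0
  then show ?case using holomorphic_several_cong[OF assms] by auto
next
  case (Suc m)
  have "smooth_upto m U (partial_deriv k G)" for k
  proof (rule Suc.IH)
    show "smooth_upto m U (partial_deriv k F)" using Suc.prems(1) by simp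
    show "partial_deriv k F x = partial_deriv k G x" if "x \<in> U" for x
      by (rule partial_deriv_cong[OF assms that Suc.prems(2)])
  qed
  then show ?case using holomorphic_several_cong[OF assms Suc.prems(2)] Suc.prems(1) by auto
qed

lemma smooth_uptoI:
  assumes "open U" "holomorphic_several_on F U"
    and "\<And>k. \<exists>G. smooth_upto m U G \<and> (\<forall>x\<in>U. partial_deriv k F x = G x)"
  shows "smooth_upto (Suc m) U F"
  using assms by (auto, metis smooth_upto_cong)

definition smooth_on :: "(complex ^ 'm::finite) set \<Rightarrow>
    (complex ^ 'm \<Rightarrow> complex) \<Rightarrow> bool" where
  "smooth_on U F \<longleftrightarrow> (\<forall>m. smooth_upto m U F)"

lemma smooth_holomorphic: "smooth_on U F \<Longrightarrow> holomorphic_several_on F U"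
  unfolding smooth_on_def using smooth_upto_holomorphic by blast

lemma smooth_partial: "smooth_on U F \<Longrightarrow> smooth_on U (partial_deriv k F)"
  unfolding smooth_on_def by (metis smooth_upto.simps(2))

lemma partial_deriv_const: "partial_deriv k (\<lambda>x. c) = (\<lambda>x. 0)"
  by (auto simp: partial_deriv_axis)

lemma partial_deriv_coord: "partial_deriv k (\<lambda>x. x $ j) = (\<lambda>x. if j = k then 1 else 0)"
proof
  fix x
  show "partial_deriv k (\<lambda>x. x $ j) x = (if j = k then 1 else 0)"
    by (rule partial_derivI) (auto simp: axis_def intro!: derivative_eq_intros)
qed

lemma partial_deriv_add:
  assumes "holomorphic_several_on F U" "holomorphic_several_on G U" "x \<in> U"
  shows "partial_deriv k (\<lambda>x. F x + G x) x = partial_deriv k F x + partial_deriv k G x"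
  by (rule partial_derivI) (intro derivative_intros partial_at[of _ U] assms)

lemma partial_deriv_mult:
  assumes "holomorphic_several_on F U" "holomorphic_several_on G U" "x \<in> U"
  shows "partial_deriv k (\<lambda>x. F x * G x) x = partial_deriv k F x * G x + F x * partial_deriv k G x"
  using DERIV_mult[OF partial_at[OF assms(1,3)] partial_at[OF assms(2,3)]]
  by (intro partial_derivI) (simp add: mult.commute add.commute)

lemma partial_deriv_compose:
  assumes "holomorphic_several_on F U" "(g has_field_derivative g') (at (F x))" "x \<in> U"
  shows "partial_deriv k (\<lambda>x. g (F x)) x = g' * partial_deriv k F x"
  using DERIV_chain2[OF _ partial_at[OF assms(1,3)], of g g'] assms(2)
  by (intro partial_derivI) simp

lemma partial_deriv_sum:
  assumes "\<And>i. i \<in> I \<Longrightarrow> holomorphic_several_on (F i) U" "x \<in> U"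
  shows "partial_deriv k (\<lambda>x. \<Sum>i\<in>I. F i x) x = (\<Sum>i\<in>I. partial_deriv k (F i) x)"
  by (rule partial_derivI) (intro DERIV_sum partial_at[of _ U] assms)

lemma partial_deriv_inverse:
  assumes "holomorphic_several_on F U" "F x \<noteq> 0" "x \<in> U"
  shows "partial_deriv k (\<lambda>x. inverse (F x)) x = - (partial_deriv k F x * (inverse (F x) * inverse (F x)))"
  using partial_deriv_compose[OF assms(1) DERIV_inverse[OF assms(2)] assms(3)]
  by (simp add: numeral_2_eq_2)

lemma smooth_upto_const: "open U \<Longrightarrow> smooth_upto m U (\<lambda>x. c)"
  by (induction m arbitrary: c) (auto simp: partial_deriv_const)

lemma smooth_upto_coord: "open U \<Longrightarrow> smooth_upto m U (\<lambda>x. x $ j)"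
  by (cases m) (auto simp: partial_deriv_coord smooth_upto_const)

lemma smooth_upto_add:
  assumes "open U"
  shows "smooth_upto m U F \<Longrightarrow> smooth_upto m U G \<Longrightarrow>
      smooth_upto m U (\<lambda>x. F x + G x)"
proof (induction m arbitrary: F G)
  case (Suc m)
  show ?case
  proof (rule smooth_uptoI[OF assms])
    fix k show "\<exists>H. smooth_upto m U H \<and> (\<forall>x\<in>U. partial_deriv k (\<lambda>x. F x + G x) x
        = H x)"
      by (rule exI[of _ "\<lambda>x. partial_deriv k F x + partial_deriv k G x"])
        (use Suc partial_deriv_add[of F U G] in auto)
  qed (use Suc in auto)
qed auto

lemma smooth_upto_mult:
  assumes "open U"
  shows "smooth_upto m U F \<Longrightarrow> smooth_upto m U G \<Longrightarrow>
      smooth_upto m U (\<lambda>x. F x * G x)"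
proof (induction m arbitrary: F G)
  case (Suc m)
  show ?case
  proof (rule smooth_uptoI[OF assms])
    fix k show "\<exists>H. smooth_upto m U H \<and> (\<forall>x\<in>U. partial_deriv k (\<lambda>x. F x * G x) x
        = H x)"
      by (rule exI[of _ "\<lambda>x. partial_deriv k F x * G x + F x * partial_deriv k G x"], intro conjI
          smooth_upto_add[OF assms] Suc.IH)
        (use Suc.prems smooth_upto_mono partial_deriv_mult[of F U G] in auto)
  qed (use Suc in auto)
qed auto

lemma smooth_upto_inverse:
  assumes "open U"
  shows "smooth_upto m U F \<Longrightarrow> (\<And>x. x \<in> U \<Longrightarrow>
      F x \<noteq> 0) \<Longrightarrow> smooth_upto m U (\<lambda>x. inverse (F x))"
proof (induction m)
  case (Suc m)
  have inv: "smooth_upto m U (\<lambda>x. inverse (F x))"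
    using Suc smooth_upto_mono by auto
  show ?case
  proof (rule smooth_uptoI[OF assms])
    fix k
    have "smooth_upto m U (\<lambda>x. (-1) * (partial_deriv k F x * (inverse (F x) * inverse (F x))))"
      using Suc.prems(1) by (intro smooth_upto_mult[OF assms] smooth_upto_const[OF assms] inv) auto
    moreover have "partial_deriv k (\<lambda>x. inverse (F x)) x
        = (-1) * (partial_deriv k F x * (inverse (F x) * inverse (F x)))"
      if "x \<in> U" for x
      using partial_deriv_inverse[of F U x k] Suc.prems that by auto
    ultimately show "\<exists>H. smooth_upto m U H \<and> (\<forall>x\<in>U. partial_deriv k (\<lambda>x. inverse
        (F x)) x = H x)"
      by blast
  qed (use Suc in auto)
qed auto

lemma smooth_upto_sum:
  assumes "open U"
  shows "(\<And>i. i \<in> I \<Longrightarrow> smooth_upto m U (F i)) \<Longrightarrow>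
      smooth_upto m U (\<lambda>x. \<Sum>i\<in>I. F i x)"
  by (induction I rule: infinite_finite_induct) (auto intro: smooth_upto_const smooth_upto_add assms)

lemma smooth_upto_power:
  assumes "open U"
  shows "smooth_upto m U F \<Longrightarrow> smooth_upto m U (\<lambda>x. F x ^ k)"
  by (induction k) (auto intro: smooth_upto_const smooth_upto_mult assms)

lemma smooth_on_add: "open U \<Longrightarrow> smooth_on U F \<Longrightarrow> smooth_on U G \<Longrightarrow>
    smooth_on U (\<lambda>x. F x + G x)"
  by (simp add: smooth_on_def smooth_upto_add)

lemma smooth_on_mult: "open U \<Longrightarrow> smooth_on U F \<Longrightarrow> smooth_on U G \<Longrightarrow>
    smooth_on U (\<lambda>x. F x * G x)"
  by (simp add: smooth_on_def smooth_upto_mult)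

lemma smooth_on_sum: "open U \<Longrightarrow> (\<And>i. i \<in> I \<Longrightarrow>
    smooth_on U (F i)) \<Longrightarrow> smooth_on U (\<lambda>x. \<Sum>i\<in>I. F i x)"
  by (simp add: smooth_on_def smooth_upto_sum)

lemma smooth_on_power: "open U \<Longrightarrow> smooth_on U F \<Longrightarrow> smooth_on U (\<lambda>x. F x ^ k)"
  by (simp add: smooth_on_def smooth_upto_power)

lemma smooth_on_const: "open U \<Longrightarrow> smooth_on U (\<lambda>x. c)"
  by (simp add: smooth_on_def smooth_upto_const)

section \<open>Global root functions\<close>

lemma distinct_roots_factorization:
  fixes p :: "complex poly"
  assumes "degree p = n" "card {z. poly p z = 0} = n" "p \<noteq> 0"
  shows "p = smult (lead_coeff p) (\<Prod>a | poly p a = 0. [:- a, 1:])"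
proof -
  let ?R = "{z. poly p z = 0}" and ?q = "\<Prod>a | poly p a = 0. [:- a, 1:]"
  have fin: "finite ?R" using assms(3) poly_roots_finite by blast
  have deg: "degree ?q = n" using assms(2) by (subst degree_prod_eq_sum_degree) auto
  have lead: "coeff ?q n = 1" using lead_coeff_prod[of "\<lambda>a. [:- a, 1:]" ?R] deg by simp
  show ?thesis
  proof (rule poly_eqI_degree_lead_coeff[where A = ?R and n = n])
    show "poly p z = poly (smult (lead_coeff p) ?q) z" if "z \<in> ?R" for z
      using that fin by (auto simp: poly_prod)
    show "degree (smult (lead_coeff p) ?q) \<le> n" using degree_smult_le deg by metis
  qed (use assms lead in simp_all)
qed

locale gkz_locus =
  fixes n :: nat and e :: "nat \<Rightarrow> 'm::finite" and U :: "(complex ^ 'm) set"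
  assumes n_pos: "n \<ge> 1" and bij_e: "bij_betw e {0..n} UNIV"
    and open_U: "open U" and U_nondeg: "U \<subseteq> nondegenerate_locus n e"
begin

definition fpoly :: "complex ^ 'm \<Rightarrow> complex poly" where
  "fpoly x = (\<Sum>i\<le>n. monom (x $ e i) i)"

lemma coeff_fpoly: "coeff (fpoly x) i = (if i \<le> n then x $ e i else 0)"
  by (simp add: fpoly_def coeff_sum)

lemma poly_fpoly: "poly (fpoly x) z = (\<Sum>i\<le>n. x $ e i * z ^ i)"
  by (simp add: fpoly_def poly_sum poly_monom)

lemma e_surj: obtains i where "i \<le> n" "k = e i"
  using bij_e unfolding bij_betw_def by (metis UNIV_I atLeastAtMost_iff imageE)

lemma e_eq_iff: "i \<le> n \<Longrightarrow> j \<le> n \<Longrightarrow> e i = e j \<longleftrightarrow> i = j"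
  using bij_e unfolding bij_betw_def inj_on_def by auto

lemma coordinates_nonzero: "x \<in> U \<Longrightarrow> x $ e 0 \<noteq> 0" "x \<in> U \<Longrightarrow>
    x $ e n \<noteq> 0"
  using U_nondeg by (auto simp: nondegenerate_locus_def)

lemma card_roots: "x \<in> U \<Longrightarrow> card {z. poly (fpoly x) z = 0} = n"
  using U_nondeg by (auto simp: nondegenerate_locus_def poly_fpoly atLeast0AtMost)

lemma degree_fpoly: "x \<in> U \<Longrightarrow> degree (fpoly x) = n"
  using coordinates_nonzero(2)[of x]
  by (intro antisym degree_le le_degree) (auto simp: coeff_fpoly)

lemma fpoly_nonzero: "x \<in> U \<Longrightarrow> fpoly x \<noteq> 0"
  using degree_fpoly[of x] n_pos by auto

lemma finite_roots: "x \<in> U \<Longrightarrow> finite {z. poly (fpoly x) z = 0}"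
  using fpoly_nonzero poly_roots_finite by blast

lemma norm_fpoly: "x \<in> U \<Longrightarrow> norm (poly (fpoly x) w)
    = norm (x $ e n) * (\<Prod>a | poly (fpoly x) a = 0. norm (w - a))"
proof -
  assume x: "x \<in> U"
  have "poly (fpoly x) w = poly (smult (lead_coeff (fpoly x)) (\<Prod>a | poly (fpoly x) a = 0. [:- a, 1:])) w"
    using distinct_roots_factorization[OF degree_fpoly[OF x] card_roots[OF x] fpoly_nonzero[OF x]] by simp
  also have "\<dots> = x $ e n * (\<Prod>a | poly (fpoly x) a = 0. w - a)"
    by (simp add: poly_prod degree_fpoly[OF x] coeff_fpoly)
  finally show ?thesis by (simp add: norm_mult prod_norm)
qed

text \<open>
  If no root were within \<open>\<epsilon>\<close> of \<open>a\<close>, the factorisation of \<open>f\<close> would give \<open>\<bar>f(a)\<bar> \<ge> \<bar>x\<^sub>n\<bar> \<epsilon>\<^sup>n\<close>, whereas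
  \<open>f(a)\<close> tends to \<open>0\<close>.
\<close>

lemma root_nearby:
  assumes x0: "x0 \<in> U" and a: "poly (fpoly x0) a = 0" and "\<epsilon> > 0"
  shows "\<forall>\<^sub>F x in nhds x0. \<exists>z\<in>ball a \<epsilon>. poly (fpoly x) z = 0"
proof -
  define g where "g x = norm (x $ e n) * \<epsilon> ^ n - norm (poly (fpoly x) a)" for x
  have "g x0 > 0" using a \<open>\<epsilon> > 0\<close> coordinates_nonzero(2)[OF x0] by (simp add: g_def)
  moreover have "isCont g x0"
    unfolding g_def poly_fpoly by (intro continuous_intros)
  ultimately have "\<forall>\<^sub>F x in nhds x0. g x > 0"
    using order_tendstoD(1)[of g "g x0" "nhds x0" 0] by (simp add: continuous_at tendsto_at_iff_tendsto_nhds)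
  moreover have "\<forall>\<^sub>F x in nhds x0. x \<in> U" using open_U x0 by (rule eventually_nhds_in_open)
  ultimately show ?thesis
  proof eventually_elim
    case (elim x)
    show ?case
    proof (rule ccontr)
      assume "\<not> (\<exists>z\<in>ball a \<epsilon>. poly (fpoly x) z = 0)"
      then have "norm (a - b) \<ge> \<epsilon>" if "poly (fpoly x) b = 0" for b
        using that by (force simp: dist_norm)
      then have "(\<Prod>b | poly (fpoly x) b = 0. norm (a - b)) \<ge> (\<Prod>b | poly (fpoly x) b
          = 0. \<epsilon>)"
        using \<open>\<epsilon> > 0\<close> by (intro prod_mono) auto
      then have "norm (poly (fpoly x) a) \<ge> norm (x $ e n) * \<epsilon> ^ n"
        unfolding norm_fpoly[OF elim(2)] by (intro mult_left_mono) (auto simp: card_roots[OF elim(2)])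
      then show False using elim(1) by (simp add: g_def)
    qed
  qed
qed

text \<open>
  Choose disjoint discs around the \<open>n\<close> roots at \<open>x0\<close>. By \<open>root_nearby\<close> each disc contains a root for all
  \<open>x\<close> near \<open>x0\<close>; as there are only \<open>n\<close> roots, each disc contains exactly one.
\<close>

lemma isolated_root_branches:
  assumes x0: "x0 \<in> U"
  obtains T \<epsilon> \<rho> where "open T" "x0 \<in> T" "T \<subseteq> U" "\<epsilon> > 0"
    and "\<And>a. poly (fpoly x0) a = 0 \<Longrightarrow> continuous_on T (\<rho> a)"
    and "\<And>a x z. poly (fpoly x0) a = 0 \<Longrightarrow> x \<in> T \<Longrightarrow>
        z \<in> ball a \<epsilon> \<and> poly (fpoly x) z = 0 \<longleftrightarrow> z = \<rho> a x"
    and "\<And>x z. x \<in> T \<Longrightarrow> poly (fpoly x) z = 0 \<Longrightarrow>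
        \<exists>a. poly (fpoly x0) a = 0 \<and> z \<in> ball a \<epsilon>"
    and "\<And>a b. poly (fpoly x0) a = 0 \<Longrightarrow> poly (fpoly x0) b = 0 \<Longrightarrow>
        a \<noteq> b \<Longrightarrow> ball a \<epsilon> \<inter> ball b \<epsilon> = {}"
proof -
  define R where "R x = {z. poly (fpoly x) z = 0}" for x
  have fin: "finite (R x)" "card (R x) = n" if "x \<in> U" for x
    using finite_roots card_roots that by (auto simp: R_def)
  have "\<exists>d>0. \<forall>b\<in>R x0. b \<noteq> a \<longrightarrow> d \<le> dist a b" for a
    by (rule finite_set_avoid) (rule fin[OF x0])
  then obtain d where d: "\<And>a. d a > 0" "\<And>a b. b \<in> R x0 \<Longrightarrow>
      b \<noteq> a \<Longrightarrow> d a \<le> dist a b" by metis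
  have ne: "R x0 \<noteq> {}" using fin[OF x0] n_pos by auto
  define \<epsilon> where "\<epsilon> = Min (d ` R x0) / 2"
  have "\<epsilon> > 0" using fin[OF x0] ne d(1) by (simp add: \<epsilon>_def)
  have sep: "2 * \<epsilon> \<le> dist a b" if "a \<in> R x0" "b \<in> R x0" "a \<noteq> b" for a b
  proof -
    have "2 * \<epsilon> \<le> d a" using fin(1)[OF x0] that(1) by (simp add: \<epsilon>_def)
    then show ?thesis using d(2)[of b a] that by auto
  qed
  have disj: "ball a \<epsilon> \<inter> ball b \<epsilon> = {}"
      if "a \<in> R x0" "b \<in> R x0" "a \<noteq> b" for a b
    using sep[OF that] dist_triangle_half_l[of a _ "2 * \<epsilon>" b] by (force simp: dist_commute)
  have "\<forall>\<^sub>F x in nhds x0. x \<in> U \<and>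
      (\<forall>a\<in>R x0. \<exists>z\<in>ball a \<epsilon>. poly (fpoly x) z = 0)"
    using root_nearby[OF x0 _ \<open>\<epsilon> > 0\<close>] fin(1)[OF x0] x0 open_U
    by (intro eventually_conj eventually_nhds_in_open eventually_ball_finite) (auto simp: R_def)
  then obtain T where T: "open T" "x0 \<in> T"
      "\<And>x. x \<in> T \<Longrightarrow> x \<in> U \<and>
          (\<forall>a\<in>R x0. \<exists>z\<in>ball a \<epsilon>. poly (fpoly x) z = 0)"
    unfolding eventually_nhds by blast
  have "\<forall>a x. \<exists>z. a \<in> R x0 \<and> x \<in> T \<longrightarrow> z \<in> ball a \<epsilon> \<and>
      z \<in> R x"
    using T(3) unfolding R_def by blast
  then obtain \<rho> where \<rho>: "\<And>a x. a \<in> R x0 \<Longrightarrow> x \<in> T \<Longrightarrow>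
      \<rho> a x \<in> ball a \<epsilon> \<and> \<rho> a x \<in> R x" by metis
  have all: "R x = (\<lambda>a. \<rho> a x) ` R x0" if x: "x \<in> T" for x
  proof (rule card_subset_eq[symmetric])
    have "inj_on (\<lambda>a. \<rho> a x) (R x0)"
      using disj \<rho> x by (intro inj_onI) (metis disjoint_iff)
    then show "card ((\<lambda>a. \<rho> a x) ` R x0) = card (R x)"
      using fin T(3)[OF x] x0 by (simp add: card_image)
  qed (use fin T(3)[OF x] \<rho> x in auto)
  have uniq: "z \<in> ball a \<epsilon> \<and> z \<in> R x \<longleftrightarrow> z = \<rho> a x" if a:
      "a \<in> R x0" and x: "x \<in> T" for a x z
  proof
    assume z: "z \<in> ball a \<epsilon> \<and> z \<in> R x"
    then obtain b where "b \<in> R x0" "z = \<rho> b x" using all[OF x] by auto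
    then show "z = \<rho> a x" using z \<rho>[of b x] disj[OF a, of b] x by (cases "a = b") auto
  qed (use \<rho>[OF a x] in auto)
  have cont: "continuous_on T (\<rho> a)" if a: "a \<in> R x0" for a
    unfolding continuous_on_def
  proof
    fix x1 assume x1: "x1 \<in> T"
    have "(\<rho> a \<longlongrightarrow> \<rho> a x1) (nhds x1)"
    proof (rule tendstoI)
      fix \<eta> :: real assume "\<eta> > 0"
      obtain \<eta>' where \<eta>': "\<eta>' > 0" "ball (\<rho> a x1) \<eta>' \<subseteq> ball a \<epsilon>"
        using \<rho>[OF a x1] openE[of "ball a \<epsilon>" "\<rho> a x1"] open_ball by blast
      have "\<forall>\<^sub>F x in nhds x1. \<exists>z\<in>ball (\<rho> a x1) (min \<eta> \<eta>'). poly
          (fpoly x) z = 0"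
        using T(3)[OF x1] \<rho>[OF a x1] \<open>\<eta> > 0\<close> \<eta>'(1)
            by (intro root_nearby) (auto simp: R_def)
      moreover have "\<forall>\<^sub>F x in nhds x1. x \<in> T" using T(1) x1 by (rule eventually_nhds_in_open)
      ultimately show "\<forall>\<^sub>F x in nhds x1. dist (\<rho> a x) (\<rho> a x1) < \<eta>"
      proof eventually_elim
        case (elim x)
        then obtain z where z: "z \<in> ball (\<rho> a x1) (min \<eta> \<eta>')" "z \<in> R x" by (auto simp: R_def)
        then have "z = \<rho> a x" using uniq[OF a elim(2), of z] \<eta>'(2) by auto
        then show ?case using z by (simp add: dist_commute)
      qed
    qed
    then show "(\<rho> a \<longlongrightarrow> \<rho> a x1) (at x1 within T)"
      by (rule tendsto_mono[OF at_within_le_nhds])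
  qed
  show ?thesis
  proof (rule that[of T \<epsilon> \<rho>])
    show "\<exists>a. poly (fpoly x0) a = 0 \<and> z \<in> ball a \<epsilon>" if z: "x \<in> T" "poly (fpoly x) z
        = 0" for x z
    proof -
      obtain a where "a \<in> R x0" "z = \<rho> a x"
        using all[OF z(1)] z(2) unfolding R_def by blast
      then show ?thesis using \<rho>[of a x] z(1) unfolding R_def by blast
    qed
  qed (use T \<open>\<epsilon> > 0\<close> cont uniq disj in \<open>auto simp: R_def\<close>)
qed

text \<open>
  The graphs of the branches in \<open>isolated_root_branches\<close> are the sheets.
\<close>

lemma covering_space_roots: "covering_space {(x, z). x \<in> U \<and> poly (fpoly x) z = 0} fst U"
proof
  let ?C = "{(x, z). x \<in> U \<and> poly (fpoly x) z = 0}"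
  show "continuous_on ?C fst" by (intro continuous_intros)
  have "\<exists>z. poly (fpoly x) z = 0" if "x \<in> U" for x
  proof -
    have "{z. poly (fpoly x) z = 0} \<noteq> {}" using card_roots[OF that] n_pos
        by (metis card.empty not_one_le_zero)
    then show ?thesis by blast
  qed
  then show "fst ` ?C = U" by force
  fix x0 assume x0: "x0 \<in> U"
  obtain T \<epsilon> \<rho> where T: "open T" "x0 \<in> T" "T \<subseteq> U" "\<epsilon> > 0"
    and cont: "\<And>a. poly (fpoly x0) a = 0 \<Longrightarrow> continuous_on T (\<rho> a)"
    and uniq: "\<And>a x z. poly (fpoly x0) a = 0 \<Longrightarrow> x \<in> T \<Longrightarrow>
        z \<in> ball a \<epsilon> \<and> poly (fpoly x) z = 0 \<longleftrightarrow> z = \<rho> a x"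
    and all: "\<And>x z. x \<in> T \<Longrightarrow> poly (fpoly x) z = 0 \<Longrightarrow>
        \<exists>a. poly (fpoly x0) a = 0 \<and> z \<in> ball a \<epsilon>"
    and disj: "\<And>a b. poly (fpoly x0) a = 0 \<Longrightarrow> poly (fpoly x0) b = 0 \<Longrightarrow>
        a \<noteq> b \<Longrightarrow> ball a \<epsilon> \<inter> ball b \<epsilon> = {}"
    using isolated_root_branches[OF x0] by blast
  define sheet where "sheet a = ?C \<inter> T \<times> ball a \<epsilon>" for a
  let ?v = "sheet ` {a. poly (fpoly x0) a = 0}"
  have "\<Union>?v = ?C \<inter> fst -` T"
    using all T(3) by (force simp: sheet_def)
  moreover have "\<forall>u\<in>?v. openin (top_of_set ?C) u"
    using T(1) by (auto simp: sheet_def intro!: openin_open_Int open_Times)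
  moreover have "pairwise disjnt ?v"
    using disj unfolding pairwise_def disjnt_def sheet_def by blast
  moreover have "\<exists>q. homeomorphism u T fst q" if "u \<in> ?v" for u
  proof -
    from that obtain a where a: "poly (fpoly x0) a = 0" "u = sheet a" by auto
    have inC: "(x, z) \<in> sheet a \<longleftrightarrow> x \<in> T \<and> z = \<rho> a x" for x z
      using uniq[OF a(1), of x z] T(3) by (auto simp: sheet_def)
    have "homeomorphism u T fst (\<lambda>x. (x, \<rho> a x))"
      unfolding homeomorphism_def
      using inC a cont[OF a(1)] by (auto intro!: continuous_intros simp: image_iff Bex_def)
    then show ?thesis by blast
  qed
  ultimately show "\<exists>T. x0 \<in> T \<and> openin (top_of_set U) T \<and>
      (\<exists>v. \<Union>v = ?C \<inter> fst -` T \<and> (\<forall>u\<in>v. openin (top_of_set ?C) u) \<and>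
       pairwise disjnt v \<and> (\<forall>u\<in>v. \<exists>q. homeomorphism u T fst q))"
    using T by (intro exI[of _ T] conjI exI[of _ ?v]) (auto simp: open_subset)
qed

text \<open>
  Lift the identity of \<open>U\<close> to the covering by pairs of a point and a root, once for each root over a base point. Distinct
  lifts never meet.
\<close>

lemma global_roots:
  assumes "simply_connected U"
  obtains r where "\<And>s. s < n \<Longrightarrow> continuous_on U (r s)"
    "\<And>s x. s < n \<Longrightarrow> x \<in> U \<Longrightarrow> poly (fpoly x) (r s x) = 0"
    "\<And>x. x \<in> U \<Longrightarrow> inj_on (\<lambda>s. r s x) {..<n}"
proof (cases "U = {}")
  case True
  then show ?thesis using that by simp
next
  case False
  then obtain p where p: "p \<in> U" by auto
  let ?C = "{(x, z). x \<in> U \<and> poly (fpoly x) z = 0}"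
  obtain \<zeta> where \<zeta>: "bij_betw \<zeta> {..<n} {z. poly (fpoly p) z = 0}"
    using ex_bij_betw_nat_finite[OF finite_roots[OF p]] card_roots[OF p] by (auto simp: lessThan_atLeast0)
  have "\<exists>g. continuous_on U g \<and> g \<in> U \<rightarrow> ?C \<and> g p
      = (p, \<zeta> s) \<and> (\<forall>y\<in>U. fst (g y) = y)" if "s < n" for s
  proof -
    have "(p, \<zeta> s) \<in> ?C" using \<zeta> that p by (auto simp: bij_betw_def)
    from covering_space_lift_strong[OF covering_space_roots this p assms open_imp_locally_path_connected[OF open_U],
        of "\<lambda>x. x"]
    obtain g where "continuous_on U g" "g \<in> U \<rightarrow> ?C" "g p = (p, \<zeta> s)"
        "\<And>y. y \<in> U \<Longrightarrow> fst (g y) = y"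
      by auto
    then show ?thesis by blast
  qed
  then have "\<forall>s. \<exists>g. s
      < n \<longrightarrow> continuous_on U g \<and> g \<in> U \<rightarrow> ?C \<and> g p
      = (p, \<zeta> s) \<and> (\<forall>y\<in>U. fst (g y) = y)"
    by blast
  from choice[OF this] obtain g where g0: "\<forall>s. s < n \<longrightarrow>
      continuous_on U (g s) \<and> g s \<in> U \<rightarrow> ?C \<and> g s p
          = (p, \<zeta> s) \<and> (\<forall>y\<in>U. fst (g s y) = y)"
    by (elim exE)
  note g' = g0[THEN spec, THEN mp]
  note g = g'[THEN conjunct1] g'[THEN conjunct2, THEN conjunct1]
    g'[THEN conjunct2, THEN conjunct2, THEN conjunct1] g'[THEN conjunct2, THEN conjunct2, THEN conjunct2, THEN
        bspec]
  show ?thesis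
  proof (rule that[of "\<lambda>s x. snd (g s x)"])
    show "continuous_on U (\<lambda>x. snd (g s x))" if "s < n" for s
      using g(1)[OF that] by (intro continuous_intros)
    show "poly (fpoly x) (snd (g s x)) = 0" if "s < n" "x \<in> U" for s x
      using g(2)[OF that(1)] g(4)[OF that] that(2) by (fastforce simp: Pi_iff)
    show "inj_on (\<lambda>s. snd (g s x)) {..<n}" if x: "x \<in> U" for x
    proof (rule inj_onI)
      fix s t assume st: "s \<in> {..<n}" "t \<in> {..<n}" "snd (g s x) = snd (g t x)"
      have "g s x = g t x" using g(4)[of s x] g(4)[of t x] st x by (simp add: prod_eq_iff)
      have "g s p = g t p"
      proof (rule covering_space_lift_unique[where T = U and f = "\<lambda>x. x", OF covering_space_roots])
        show "g s x = g t x" by fact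
      qed (use g(1,2,4) st x p simply_connected_imp_connected[OF assms] in simp_all)
      then have "\<zeta> s = \<zeta> t" using g(3) st by simp
      then show "s = t" using \<zeta> st by (auto simp: bij_betw_def inj_on_def)
    qed
  qed
qed

end

lemma has_derivative_eventually_eq:
  assumes "(f has_derivative D) (at x)" "\<forall>\<^sub>F y in nhds x. f y = g y"
  shows "(g has_derivative D) (at x)"
proof (rule has_derivative_transform_eventually[OF assms(1)])
  show "\<forall>\<^sub>F y in at x. f y = g y" using assms(2) by (simp add: eventually_at_filter eventually_mono)
  show "f x = g x" using assms(2) by (rule eventually_nhds_x_imp_x)
qed simp

text \<open>
  The first factor vanishes at \<open>x0\<close>, so continuity of \<open>g\<close> suffices. The derivative of an implicitly defined
  function is obtained from this, before that function is known to be differentiable.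
\<close>

lemma has_derivative_vanishing_product:
  fixes g :: "complex ^ 'm::finite \<Rightarrow> complex" and x0 :: "complex ^ 'm::finite"
  assumes "isCont g x0"
  shows "((\<lambda>x. (x $ k - x0 $ k) * g x) has_derivative (\<lambda>w. w $ k * g x0)) (at x0)"
  unfolding has_derivative_at
proof
  show "bounded_linear (\<lambda>w. w $ k * g x0)"
    by (intro bounded_linear_mult_const bounded_linear_vec_nth)
  have "((\<lambda>h. g (x0 + h) - g x0) \<longlongrightarrow> 0) (at 0)"
    using assms by (simp add: isCont_iff LIM_zero_iff)
  then have "((\<lambda>h. norm (g (x0 + h) - g x0)) \<longlongrightarrow> 0) (at 0)" by (rule tendsto_norm_zero)
  then show "((\<lambda>h. norm (((x0 + h) $ k - x0 $ k) * g (x0 + h) - (x0 $ k - x0 $ k) * g x0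
      - h $ k * g x0) / norm h) \<longlongrightarrow> 0) (at 0)"
  proof (rule Lim_null_comparison[rotated], intro always_eventually allI)
    fix h :: "complex ^ 'm"
    have "norm (h $ k) / norm h \<le> 1" using Finite_Cartesian_Product.norm_nth_le[of h k]
        by (simp add: divide_le_eq_1)
    then have "norm (h $ k) / norm h * norm (g (x0 + h) - g x0) \<le> 1 * norm (g (x0 + h) - g x0)"
      by (rule mult_right_mono) simp
    moreover have "((x0 + h) $ k - x0 $ k) * g (x0 + h) - (x0 $ k - x0 $ k) * g x0 - h $ k * g x0
        = h $ k * (g (x0 + h) - g x0)"
      by (simp add: algebra_simps)
    ultimately show "norm (norm (((x0 + h) $ k - x0 $ k) * g (x0 + h) - (x0 $ k - x0 $ k) * g x0
        - h $ k * g x0) / norm h)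
        \<le> norm (g (x0 + h) - g x0)" by (simp add: norm_mult)
  qed
qed

context gkz_locus
begin

text \<open>
  Write \<open>f\<^sub>x\<^sub>0(w) = (w - \<rho>(x0)) q(w)\<close>. From \<open>f\<^sub>x(\<rho>(x)) = 0\<close> one gets
  \<open>\<rho>(x) - \<rho>(x0) = - \<Sum>\<^sub>i (x\<^sub>i - x0\<^sub>i) \<rho>(x)\<^sup>i / q(\<rho>(x))\<close> with continuous quotients on the right.
\<close>

lemma root_has_derivative:
  assumes cont: "continuous_on U \<rho>" and root: "\<And>x. x \<in> U \<Longrightarrow>
      poly (fpoly x) (\<rho> x) = 0"
    and x0: "x0 \<in> U" and simple: "poly (pderiv (fpoly x0)) (\<rho> x0) \<noteq> 0"
  shows "(\<rho> has_derivative (\<lambda>w. \<Sum>i\<le>n. w $ e i * (- (\<rho> x0 ^ i / poly (pderiv (fpoly x0))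
      (\<rho> x0))))) (at x0)"
proof -
  let ?r = "\<rho> x0"
  define q where "q = synthetic_div (fpoly x0) ?r"
  have fact: "[:- ?r, 1:] * q = fpoly x0"
    using synthetic_div_correct'[of ?r "fpoly x0"] root[OF x0] by (simp add: q_def)
  have "pderiv (fpoly x0) = [:- ?r, 1:] * pderiv q + q"
    unfolding fact[symmetric] by (simp only: pderiv_mult) (simp add: pderiv_pCons)
  then have qr: "poly q ?r = poly (pderiv (fpoly x0)) ?r" by simp
  define g where "g i x = - (\<rho> x ^ i / poly q (\<rho> x))" for i x
  have \<rho>_cont: "isCont \<rho> x0" using cont x0 open_U continuous_on_eq_continuous_at by blast
  have q_cont: "isCont (\<lambda>x. poly q (\<rho> x)) x0" using \<rho>_cont by (intro continuous_intros)
  have g_cont: "isCont (g i) x0" for i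
    unfolding g_def using \<rho>_cont q_cont qr simple by (intro continuous_intros) auto
  have "((\<lambda>x. \<Sum>i\<le>n. (x $ e i - x0 $ e i) * g i x) has_derivative
      (\<lambda>w. \<Sum>i\<le>n. w $ e i * g i x0)) (at x0)"
    by (intro has_derivative_sum has_derivative_vanishing_product g_cont)
  from has_derivative_add[OF has_derivative_const[of ?r] this]
  have "((\<lambda>x. ?r + (\<Sum>i\<le>n. (x $ e i - x0 $ e i) * g i x)) has_derivative
      (\<lambda>w. \<Sum>i\<le>n. w $ e i * g i x0)) (at x0)"
    by simp
  moreover have "\<forall>\<^sub>F x in nhds x0. ?r + (\<Sum>i\<le>n. (x $ e i - x0 $ e i) * g i x) = \<rho> x"
  proof -
    have "\<forall>\<^sub>F x in nhds x0. poly q (\<rho> x) \<noteq> 0"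
    proof (rule tendsto_imp_eventually_ne)
      show "((\<lambda>x. poly q (\<rho> x)) \<longlongrightarrow> poly q ?r) (nhds x0)"
        using q_cont tendsto_at_iff_tendsto_nhds[of "\<lambda>x. poly q (\<rho> x)" x0] by (simp add: continuous_at)
    qed (use qr simple in simp)
    moreover have "\<forall>\<^sub>F x in nhds x0. x \<in> U" using open_U x0 by (rule eventually_nhds_in_open)
    ultimately show ?thesis
    proof eventually_elim
      case (elim x)
      have "(\<Sum>i\<le>n. (x $ e i - x0 $ e i) * \<rho> x ^ i)
          = poly (fpoly x) (\<rho> x) - poly (fpoly x0) (\<rho> x)"
        by (simp add: poly_fpoly sum_subtractf left_diff_distrib)
      also have "\<dots> = - ((\<rho> x - ?r) * poly q (\<rho> x))"
        using root[OF elim(2)] arg_cong[OF fact, of "\<lambda>p. poly p (\<rho> x)"] by (simp add: algebra_simps)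
      finally have *: "(\<Sum>i\<le>n. (x $ e i - x0 $ e i) * \<rho> x ^ i)
          = - ((\<rho> x - ?r) * poly q (\<rho> x))" .
      have "(\<Sum>i\<le>n. (x $ e i - x0 $ e i) * g i x)
          = - (\<Sum>i\<le>n. (x $ e i - x0 $ e i) * \<rho> x ^ i) / poly q (\<rho> x)"
        by (simp add: g_def sum_divide_distrib sum_negf[symmetric])
      then show ?case using * elim(1) by simp
    qed
  qed
  ultimately have "(\<rho> has_derivative (\<lambda>w. \<Sum>i\<le>n. w $ e i * g i x0)) (at x0)"
    by (rule has_derivative_eventually_eq)
  then show ?thesis by (simp add: g_def qr)
qed

lemma root_holomorphic:
  assumes cont: "continuous_on U \<rho>" and root: "\<And>x. x \<in> U \<Longrightarrow>
      poly (fpoly x) (\<rho> x) = 0"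
    and simple: "\<And>x. x \<in> U \<Longrightarrow> poly (pderiv (fpoly x)) (\<rho> x) \<noteq> 0"
  shows "holomorphic_several_on \<rho> U"
    and "x \<in> U \<Longrightarrow> i \<le> n \<Longrightarrow>
        partial_deriv (e i) \<rho> x = - (\<rho> x ^ i / poly (pderiv (fpoly x)) (\<rho> x))"
proof -
  let ?D = "\<lambda>x w. \<Sum>i\<le>n. w $ e i * (- (\<rho> x ^ i / poly (pderiv (fpoly x)) (\<rho> x)))"
  have D: "(\<rho> has_derivative ?D x) (at x)" if "x \<in> U" for x
    by (rule root_has_derivative[OF cont root that simple[OF that]])
  have lin: "?D x (a *s w) = a * ?D x w" for x a w by (simp add: sum_distrib_left mult_ac)
  show "holomorphic_several_on \<rho> U"
    unfolding holomorphic_several_on_def using D lin by blast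
  assume "x \<in> U" "i \<le> n"
  then have "partial_deriv (e i) \<rho> x = ?D x (axis (e i) 1)"
    using frechet_axis[OF D lin] by metis
  also have "\<dots> = (\<Sum>j\<le>n. if j = i then - (\<rho> x ^ i / poly (pderiv (fpoly x)) (\<rho> x)) else 0)"
    by (rule sum.cong) (use \<open>i \<le> n\<close> in \<open>auto simp: axis_def e_eq_iff\<close>)
  finally show "partial_deriv (e i) \<rho> x = - (\<rho> x ^ i / poly (pderiv (fpoly x)) (\<rho> x))"
    using \<open>i \<le> n\<close> by simp
qed

end

text \<open>
  By continuity \<open>L\<close> differs from \<open>L x0\<close> near \<open>x0\<close> by the principal logarithm of \<open>\<rho> / \<rho>(x0)\<close>.
\<close>

lemma log_holomorphic:
  fixes \<rho> L :: "complex ^ 'm::finite \<Rightarrow> complex"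
  assumes "open U" and \<rho>: "holomorphic_several_on \<rho> U" and L: "continuous_on U L"
      "\<And>x. x \<in> U \<Longrightarrow> \<rho> x = exp (L x)"
  shows "holomorphic_several_on L U"
    and "x \<in> U \<Longrightarrow> partial_deriv k L x = partial_deriv k \<rho> x / \<rho> x"
proof -
  have deriv: "(L has_derivative (\<lambda>w. D w / \<rho> x0)) (at x0)"
    if x0: "x0 \<in> U" and D: "(\<rho> has_derivative D) (at x0)" for x0 D
  proof -
    have "\<rho> x0 \<noteq> 0" using L(2)[OF x0] by simp
    have "((\<lambda>x. \<rho> x / \<rho> x0) has_derivative (\<lambda>w. D w / \<rho> x0)) (at x0)"
      using D by (rule bounded_linear.has_derivative[OF bounded_linear_divide])
    moreover have "(Ln has_derivative (\<lambda>h. h)) (at (\<rho> x0 / \<rho> x0))"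
      using has_field_derivative_Ln[of 1] \<open>\<rho> x0 \<noteq> 0\<close>
          by (simp add: has_field_derivative_def complex_nonpos_Reals_iff mult_1[abs_def])
    ultimately have "((\<lambda>x. Ln (\<rho> x / \<rho> x0)) has_derivative (\<lambda>w. D w / \<rho> x0)) (at x0)"
      by (rule has_derivative_compose)
    from has_derivative_add[OF has_derivative_const[of "L x0"] this]
    have "((\<lambda>x. L x0 + Ln (\<rho> x / \<rho> x0)) has_derivative (\<lambda>w. D w / \<rho> x0))
        (at x0)" by simp
    moreover have "\<forall>\<^sub>F x in nhds x0. L x0 + Ln (\<rho> x / \<rho> x0) = L x"
    proof -
      have "(L \<longlongrightarrow> L x0) (nhds x0)"
        using L(1) x0 \<open>open U\<close>
            by (metis continuous_at continuous_on_eq_continuous_at tendsto_at_iff_tendsto_nhds)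
      then have "\<forall>\<^sub>F x in nhds x0. dist (L x) (L x0) < pi" by (rule tendstoD) simp
      moreover have "\<forall>\<^sub>F x in nhds x0. x \<in> U" using \<open>open U\<close> x0
          by (rule eventually_nhds_in_open)
      ultimately show ?thesis
      proof eventually_elim
        case (elim x)
        have "\<bar>Im (L x - L x0)\<bar> < pi" using elim(1) abs_Im_le_cmod[of "L x - L x0"]
            by (simp add: dist_norm)
        then have "Ln (exp (L x - L x0)) = L x - L x0" by (intro Ln_exp) auto
        then show ?case using L(2)[OF x0] L(2)[OF elim(2)] by (simp add: exp_diff)
      qed
    qed
    ultimately show ?thesis
      by (rule has_derivative_eventually_eq)
  qed
  show "holomorphic_several_on L U"
    unfolding holomorphic_several_on_def
  proof
    fix x assume x: "x \<in> U"
    then obtain D where D: "(\<rho> has_derivative D) (at x)" "\<forall>a w. D (a *s w) = a * D w"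
      using \<rho> unfolding holomorphic_several_on_def by blast
    show "\<exists>D. (L has_derivative D) (at x) \<and> (\<forall>a w. D (a *s w) = a * D w)"
      by (rule exI[of _ "\<lambda>w. D w / \<rho> x"]) (use deriv[OF x D(1)] D(2) in auto)
  qed
  assume x: "x \<in> U"
  then obtain D where D: "(\<rho> has_derivative D) (at x)" "\<And>a w. D (a *s w) = a * D w"
    using \<rho> unfolding holomorphic_several_on_def by blast
  show "partial_deriv k L x = partial_deriv k \<rho> x / \<rho> x"
    using frechet_axis[OF deriv[OF x D(1)], of k] frechet_axis[OF D, of k] D(2) by simp
qed

section \<open>Solutions as functionals on polynomials\<close>

text \<open>
  The functional \<open>\<Phi>\<^sub>l\<close> at \<open>x\<close>, by its values on powers of the variable.
\<close>

definition level :: "(int \<times> int \<Rightarrow> 'x \<Rightarrow> complex) \<Rightarrow> nat \<Rightarrow> 'x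
    \<Rightarrow> nat \<Rightarrow> complex" where
  "level \<Phi> l x k = \<Phi> (int k, int l) x"

context gkz_locus
begin

lemma solution_holomorphic:
  assumes "\<Phi> \<in> bbGKZ_solutions n e U K"
  shows "holomorphic_several_on (\<Phi> c) U"
proof (cases "c \<in> K")
  case True
  then show ?thesis using assms by (simp add: bbGKZ_solutions_def)
next
  case False
  then have "\<Phi> c = (\<lambda>x. 0)" using assms unfolding bbGKZ_solutions_def by blast
  then show ?thesis by (simp add: holomorphic_several_const)
qed

lemma solution_partial:
  assumes "\<Phi> \<in> bbGKZ_solutions n e U K" "c \<in> K" "x \<in> U" "i \<le> n"
  shows "partial_deriv (e i) (\<Phi> c) x = \<Phi> (c + gen i) x"
  using assms by (simp add: bbGKZ_solutions_def)

lemma solution_outside: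
  assumes "\<Phi> \<in> bbGKZ_solutions n e U K" "c \<notin> K"
  shows "\<Phi> c x = 0"
  using assms unfolding bbGKZ_solutions_def by blast

lemma solution_line:
  assumes "\<Phi> \<in> bbGKZ_solutions n e U K" "c \<in> K" "x \<in> U" "i \<le> n"
  shows "((\<lambda>t. \<Phi> c (x + axis (e i) t)) has_field_derivative \<Phi> (c + gen i) x) (at 0)"
  using partial_at[OF solution_holomorphic[OF assms(1)] assms(3), of c "e i"] solution_partial[OF assms] by simp

lemma solution_euler:
  assumes sol: "\<Phi> \<in> bbGKZ_solutions n e U K" and c: "(int k, int l) \<in> K" and x: "x \<in> U"
  shows "(\<Sum>i\<le>n. x $ e i * level \<Phi> (Suc l) x (k + i)) = - of_nat l * level \<Phi> l x k"
    and "(\<Sum>i\<le>n. of_nat i * x $ e i * level \<Phi> (Suc l) x (k + i)) = - of_nat k * level \<Phi> l x k"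
proof -
  have lev: "\<Phi> ((int k, int l) + gen i) x = level \<Phi> (Suc l) x (k + i)" for i
    by (simp add: level_def gen_def add.commute)
  have eq: "(\<Sum>i\<le>n. of_int (\<mu> (gen i)) * x $ e i * level \<Phi> (Suc l) x (k + i)) + of_int (\<mu>
      (int k, int l)) * level \<Phi> l x k = 0"
    if "Modules.additive \<mu>" for \<mu>
  proof -
    have "(\<Sum>i\<le>n. of_int (\<mu> (gen i)) * x $ e i * partial_deriv (e i) (\<Phi> (int k, int l)) x)
        + of_int (\<mu> (int k, int l)) * \<Phi> (int k, int l) x = 0"
      using sol c x that unfolding bbGKZ_solutions_def atLeast0AtMost by blast
    then show ?thesis using solution_partial[OF sol c x] by (simp add: lev level_def)
  qed
  show "(\<Sum>i\<le>n. x $ e i * level \<Phi> (Suc l) x (k + i)) = - of_nat l * level \<Phi> l x k"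
    using eq[of snd] by (simp add: Modules.additive_def gen_def eq_neg_iff_add_eq_0)
  show "(\<Sum>i\<le>n. of_nat i * x $ e i * level \<Phi> (Suc l) x (k + i)) = - of_nat k * level \<Phi> l x k"
    using eq[of fst] by (simp add: Modules.additive_def gen_def eq_neg_iff_add_eq_0)
qed

text \<open>
  The two linear relations of the system, for the coordinates \<open>deg\<close> and \<open>fst\<close>, as rules for multiplication by
  \<open>f\<close> and \<open>\<theta>f\<close>. They are available for \<open>u\<close> supported in the index set.
\<close>

lemma lin_solution_mult:
  assumes sol: "\<Phi> \<in> bbGKZ_solutions n e U K" and x: "x \<in> U"
    and u: "\<And>k. coeff u k \<noteq> 0 \<Longrightarrow> (int k, int l) \<in> K"
  shows "lin (level \<Phi> (Suc l) x) (fpoly x * u) = - of_nat l * lin (level \<Phi> l x) u"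
    and "lin (level \<Phi> (Suc l) x) (theta (fpoly x) * u) = - lin (level \<Phi> l x) (theta u)"
proof -
  have deg: "degree (fpoly x) \<le> n" "degree (theta (fpoly x)) \<le> n"
    using degree_fpoly[OF x] degree_theta[of "fpoly x"] by auto
  have "lin (level \<Phi> (Suc l) x) (fpoly x * u)
      = (\<Sum>k\<le>degree u. coeff u k * (\<Sum>i\<le>n. x $ e i * level \<Phi> (Suc l) x (k + i)))"
    using deg(1) by (simp add: lin_mult_expand[of u "degree u"] lin_mult_monom[of _ n] coeff_fpoly)
  also have "\<dots> = (\<Sum>k\<le>degree u. coeff u k * (- of_nat l * level \<Phi> l x k))"
  proof (intro sum.cong refl)
    fix k show "coeff u k * (\<Sum>i\<le>n. x $ e i * level \<Phi> (Suc l) x (k + i))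
        = coeff u k * (- of_nat l * level \<Phi> l x k)"
      by (cases "coeff u k = 0") (simp_all add: solution_euler(1)[OF sol u x])
  qed
  finally show "lin (level \<Phi> (Suc l) x) (fpoly x * u) = - of_nat l * lin (level \<Phi> l x) u"
    by (simp add: lin_def sum_distrib_left mult_ac)
  have "lin (level \<Phi> (Suc l) x) (theta (fpoly x) * u)
      = (\<Sum>k\<le>degree u. coeff u k * (\<Sum>i\<le>n. of_nat i * x $ e i * level \<Phi> (Suc l) x (k + i)))"
    using deg(2) by (simp add: lin_mult_expand[of u "degree u"] lin_mult_monom[of _ n] coeff_fpoly)
  also have "\<dots> = (\<Sum>k\<le>degree u. coeff u k * (- of_nat k * level \<Phi> l x k))"
  proof (intro sum.cong refl)
    fix k show "coeff u k * (\<Sum>i\<le>n. of_nat i * x $ e i * level \<Phi> (Suc l) x (k + i))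
        = coeff u k * (- of_nat k * level \<Phi> l x k)"
      by (cases "coeff u k = 0") (simp_all add: solution_euler(2)[OF sol u x])
  qed
  also have "\<dots> = - lin (level \<Phi> l x) (theta u)"
    by (simp add: lin_bound[OF degree_theta] sum_negf[symmetric] mult_ac)
  finally show "lin (level \<Phi> (Suc l) x) (theta (fpoly x) * u) = - lin (level \<Phi> l x) (theta u)" .
qed

end

subsection \<open>Derivatives of polynomial-valued curves\<close>

definition poly_derivative :: "(complex \<Rightarrow> complex poly) \<Rightarrow> complex poly \<Rightarrow> bool"
    where
  "poly_derivative p p' \<longleftrightarrow> (\<forall>k. ((\<lambda>t. coeff
      (p t) k) has_field_derivative coeff p' k) (at 0))"

lemma poly_derivative_add: "poly_derivative p p' \<Longrightarrow> poly_derivative q q' \<Longrightarrow>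
    poly_derivative (\<lambda>t. p t + q t) (p' + q')"
  by (simp add: poly_derivative_def DERIV_add)

lemma poly_derivative_diff: "poly_derivative p p' \<Longrightarrow> poly_derivative q q' \<Longrightarrow>
    poly_derivative (\<lambda>t. p t - q t) (p' - q')"
  by (simp add: poly_derivative_def DERIV_diff)

lemma poly_derivative_theta: "poly_derivative p p' \<Longrightarrow>
    poly_derivative (\<lambda>t. theta (p t)) (theta p')"
  by (simp add: poly_derivative_def DERIV_cmult)

lemma poly_derivative_mult:
  assumes "poly_derivative p p'" "poly_derivative q q'"
  shows "poly_derivative (\<lambda>t. p t * q t) (p' * q 0 + p 0 * q')"
  unfolding poly_derivative_def
proof
  fix k
  have "((\<lambda>t. \<Sum>i\<le>k. coeff (p t) i * coeff (q t) (k - i)) has_field_derivative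
      (\<Sum>i\<le>k. coeff p' i * coeff (q 0) (k - i) + coeff q' (k - i) * coeff (p 0) i)) (at 0)"
    using assms unfolding poly_derivative_def by (intro DERIV_sum DERIV_mult) auto
  then show "((\<lambda>t. coeff (p t * q t) k) has_field_derivative coeff (p' * q 0 + p 0 * q') k) (at 0)"
    by (simp add: coeff_mult sum.distrib mult.commute[of "coeff q' _"])
qed

lemma poly_derivative_smult:
  assumes "(c has_field_derivative c') (at 0)" "poly_derivative q q'"
  shows "poly_derivative (\<lambda>t. smult (c t) (q t)) (smult c' (q 0) + smult (c 0) q')"
  unfolding poly_derivative_def
proof
  fix k
  show "((\<lambda>t. coeff (smult (c t) (q t)) k) has_field_derivative coeff (smult c' (q 0) + smult (c 0) q') k)
      (at 0)"
    using DERIV_mult[OF assms(1) assms(2)[unfolded poly_derivative_def, THEN spec, of k]]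
        by (simp add: mult.commute)
qed

lemma poly_derivative_linear_factor:
  assumes "(c has_field_derivative c') (at 0)"
  shows "poly_derivative (\<lambda>t. [:- c t, 1:]) [:- c':]"
  unfolding poly_derivative_def
  using DERIV_minus[OF assms] by (auto simp: coeff_pCons split: nat.split)

lemma poly_derivative_unique:
  assumes "poly_derivative p p'" "poly_derivative q q'" "\<forall>\<^sub>F t in nhds 0. p t = q t"
  shows "p' = q'"
proof (rule poly_eqI)
  fix k
  have "\<forall>\<^sub>F t in nhds 0. coeff (p t) k = coeff (q t) k"
    using assms(3) by (rule eventually_mono) simp
  then show "coeff p' k = coeff q' k"
    using assms(1,2) DERIV_unique DERIV_cong_ev[OF refl _ refl] unfolding poly_derivative_def by metis
qed

lemma poly_derivative_coeff_zero:
  assumes "poly_derivative p p'" "\<forall>\<^sub>F t in nhds 0. coeff (p t) k = 0"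
  shows "coeff p' k = 0"
proof -
  have "((\<lambda>t. coeff (p t) k) has_field_derivative 0) (at 0)"
    using DERIV_cong_ev[OF refl assms(2) refl, of 0] by simp
  then show ?thesis using assms(1) DERIV_unique unfolding poly_derivative_def by blast
qed

lemma poly_derivative_coeff_const:
  assumes "poly_derivative p p'"
  shows "poly_derivative (\<lambda>t. [:coeff (p t) 0:]) [:coeff p' 0:]"
  using assms unfolding poly_derivative_def by (auto simp: coeff_pCons split: nat.split)

context gkz_locus
begin

lemma eventually_U: "x \<in> U \<Longrightarrow> \<forall>\<^sub>F t in nhds 0. x + axis k t \<in> U"
  by (rule eventually_line[OF open_U])

lemma fpoly_line: "i \<le> n \<Longrightarrow> poly_derivative (\<lambda>t. fpoly (x + axis (e i) t)) (monom 1 i)"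
  unfolding poly_derivative_def
proof
  fix k assume "i \<le> n"
  then have "(\<lambda>t. coeff (fpoly (x + axis (e i) t)) k) = (\<lambda>t. coeff (fpoly x) k + (if k
      = i then t else 0))"
    by (auto simp: coeff_fpoly axis_def e_eq_iff fun_eq_iff)
  then show "((\<lambda>t. coeff (fpoly (x + axis (e i) t)) k) has_field_derivative coeff (monom 1 i) k) (at 0)"
    by (auto intro!: derivative_eq_intros)
qed

text \<open>
  The product rule, where \<open>\<partial>\<^sub>i\<close> of the functional is multiplication of its argument by the \<open>i\<close>-th power of the variable.
  Outside the index set nothing is known about derivatives, so the coefficients have to vanish there.
\<close>

lemma lin_solution_line:
  assumes sol: "\<Phi> \<in> bbGKZ_solutions n e U K" and x: "x \<in> U" and i: "i \<le> n"
    and p: "poly_derivative p p'" and deg: "\<And>t. degree (p t) \<le> N"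
    and supp: "\<And>k. (int k, int l) \<notin> K \<Longrightarrow>
        \<forall>\<^sub>F t in nhds 0. coeff (p t) k = 0"
  shows "((\<lambda>t. lin (level \<Phi> l (x + axis (e i) t)) (p t)) has_field_derivative
     lin (level \<Phi> (Suc l) x) (monom 1 i * p 0) + lin (level \<Phi> l x) p') (at 0)"
proof -
  have coeff_deriv: "((\<lambda>t. coeff (p t) k) has_field_derivative coeff p' k) (at 0)" for k
    using p by (simp add: poly_derivative_def)
  have zero: "coeff p' k = 0" if "\<forall>\<^sub>F t in nhds 0. coeff (p t) k = 0" for k
    using DERIV_unique[OF coeff_deriv[of k]] DERIV_cong_ev[OF refl that refl, of "coeff p' k"]
      coeff_deriv[of k] DERIV_const DERIV_unique by metis
  have deg': "degree p' \<le> N"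
  proof (intro degree_le allI impI zero always_eventually)
    show "coeff (p t) k = 0" if "N < k" for k t
      using le_less_trans[OF deg that] by (rule coeff_eq_0)
  qed
  have term_deriv: "((\<lambda>t. coeff (p t) k * level \<Phi> l (x + axis (e i) t) k) has_field_derivative
      coeff (p 0) k * level \<Phi> (Suc l) x (i + k) + coeff p' k * level \<Phi> l x k) (at 0)" for k
  proof (cases "(int k, int l) \<in> K")
    case True
    have "(int k, int l) + gen i = (int (i + k), int (Suc l))" by (simp add: gen_def)
    then show ?thesis
      using DERIV_mult[OF coeff_deriv[of k] solution_line[OF sol True x i]]
          by (simp add: level_def add.commute mult.commute)
  next
    case False
    have ev: "\<forall>\<^sub>F t in nhds 0. coeff (p t) k * level \<Phi> l (x + axis (e i) t) k = 0"
      using supp[OF False] by (rule eventually_mono) simp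
    have "coeff (p 0) k = 0" using eventually_nhds_x_imp_x[OF supp[OF False]] .
    then show ?thesis
      using DERIV_cong_ev[OF refl ev refl] zero[OF supp[OF False]] by simp
  qed
  have "((\<lambda>t. \<Sum>k\<le>N. coeff (p t) k * level \<Phi> l (x + axis (e i) t) k) has_field_derivative
      (\<Sum>k\<le>N. coeff (p 0) k * level \<Phi> (Suc l) x (i + k) + coeff p' k * level \<Phi> l x k)) (at 0)"
    by (intro DERIV_sum term_deriv)
  moreover have "lin (level \<Phi> (Suc l) x) (monom 1 i * p 0)
      = (\<Sum>k\<le>N. coeff (p 0) k * level \<Phi> (Suc l) x (i + k))"
    using lin_mult_monom[OF deg[of 0], of "level \<Phi> (Suc l) x" i] by (simp add: mult.commute)
  ultimately show ?thesis by (simp add: lin_bound[OF deg] lin_bound[OF deg'] sum.distrib)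
qed

end


section \<open>The pairing is constant\<close>

locale gkz_roots = gkz_locus +
  fixes r :: "nat \<Rightarrow> complex ^ 'a \<Rightarrow> complex"
  assumes r_continuous: "s < n \<Longrightarrow> continuous_on U (r s)"
    and r_root: "s < n \<Longrightarrow> x \<in> U \<Longrightarrow> poly (fpoly x) (r s x) = 0"
    and r_inj: "x \<in> U \<Longrightarrow> inj_on (\<lambda>s. r s x) {..<n}"
begin

abbreviation cof :: "complex ^ 'a \<Rightarrow> nat \<Rightarrow> complex poly" where
  "cof x \<equiv> simple_roots.cofactor (fpoly x) (\<lambda>s. r s x)"

abbreviation slp :: "complex ^ 'a \<Rightarrow> nat \<Rightarrow> complex" where
  "slp x \<equiv> simple_roots.slope (fpoly x) (\<lambda>s. r s x)"

lemma simple_roots_at: "x \<in> U \<Longrightarrow> simple_roots n (fpoly x) (\<lambda>s. r s x)"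
  by unfold_locales (use n_pos degree_fpoly coordinates_nonzero r_root r_inj in \<open>auto simp:
      coeff_fpoly\<close>)

lemma cof_def: "cof x s = synthetic_div (fpoly x) (r s x)" if "x \<in> U"
  using simple_roots.cofactor_def[OF simple_roots_at[OF that]] .

lemma slp_def: "slp x s = poly (pderiv (fpoly x)) (r s x)" if "x \<in> U"
  using simple_roots.slope_def[OF simple_roots_at[OF that]] .

lemma r_holomorphic: "s < n \<Longrightarrow> holomorphic_several_on (r s) U"
  and r_partial: "s < n \<Longrightarrow> x \<in> U \<Longrightarrow> i \<le> n \<Longrightarrow>
      partial_deriv (e i) (r s) x = - (r s x ^ i / slp x s)"
proof -
  assume s: "s < n"
  have simple: "poly (pderiv (fpoly x)) (r s x) \<noteq> 0" if "x \<in> U" for x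
    using simple_roots.slope_nonzero[OF simple_roots_at[OF that] s] slp_def[OF that] by simp
  show "holomorphic_several_on (r s) U"
    by (rule root_holomorphic(1)[OF r_continuous[OF s] r_root[OF s] simple])
  show "partial_deriv (e i) (r s) x = - (r s x ^ i / slp x s)" if "x \<in> U" "i \<le> n"
    using root_holomorphic(2)[OF r_continuous[OF s] r_root[OF s] simple that] slp_def[OF that(1)] by simp
qed

lemma r_line: "s < n \<Longrightarrow> x \<in> U \<Longrightarrow> i \<le> n \<Longrightarrow>
    ((\<lambda>t. r s (x + axis (e i) t)) has_field_derivative - (r s x ^ i / slp x s)) (at 0)"
  using partial_at[OF r_holomorphic, of s x "e i"] r_partial[of s x i] by simp

definition cofactor_curve :: "complex ^ 'a \<Rightarrow> nat \<Rightarrow> nat \<Rightarrow> complex \<Rightarrow>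
    complex poly" where
  "cofactor_curve x s i t = synthetic_div (fpoly (x + axis (e i) t)) (r s (x + axis (e i) t))"

lemma degree_cofactor_curve: "degree (cofactor_curve x s i t) \<le> n - 1"
  unfolding cofactor_curve_def degree_synthetic_div
  by (intro diff_le_mono degree_le) (auto simp: coeff_fpoly)

text \<open>
  Synthetic division computes the coefficients of the cofactor recursively from the top, hence they
  are differentiable. The formula for \<open>l'\<close> is the derivative of the identity \<open>(z - r) l = f\<close>.
\<close>

lemma cofactor_line:
  assumes s: "s < n" and x: "x \<in> U" and i: "i \<le> n"
  obtains l' where "poly_derivative (cofactor_curve x s i) l'" "degree l' \<le> n - 1"
    "[:- r s x, 1:] * l' = monom 1 i - smult (r s x ^ i / slp x s) (cof x s)"
proof -
  let ?c = "cofactor_curve x s i" and ?r = "\<lambda>t. r s (x + axis (e i) t)" and ?f =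
      "\<lambda>t. fpoly (x + axis (e i) t)"
  have rec: "coeff (?c t) k = coeff (?f t) (Suc k) + ?r t * coeff (?c t) (Suc k)" for t k
    using arg_cong[OF synthetic_div_correct[of "?f t" "?r t"], of "\<lambda>p. coeff p (Suc k)"]
    by (simp add: cofactor_curve_def)
  have top: "coeff (?c t) k = 0" if "k \<ge> n" for t k
    using that degree_cofactor_curve[of x s i t] n_pos by (intro coeff_eq_0) linarith
  have "\<exists>d. ((\<lambda>t. coeff (?c t) k) has_field_derivative d) (at 0)" for k
  proof (induction "n - k" arbitrary: k)
    case 0
    then show ?case using top by (auto intro: exI[of _ 0])
  next
    case (Suc m)
    then obtain d where "((\<lambda>t. coeff (?c t) (Suc k)) has_field_derivative d) (at 0)"
      using Suc.hyps(1)[of "Suc k"] Suc.hyps(2) by (metis Suc_diff_Suc diff_Suc_1 zero_less_Suc zero_less_diff)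
    from DERIV_add[OF fpoly_line[OF i, of x, unfolded poly_derivative_def, THEN spec, of "Suc k"]
        DERIV_mult[OF r_line[OF s x i] this]]
    show ?case by (subst rec[abs_def]) blast
  qed
  then obtain d where d: "\<And>k. ((\<lambda>t. coeff (?c t) k) has_field_derivative d k) (at 0)" by metis
  have dtop: "d k = 0" if "k \<ge> n" for k
    using d[of k] DERIV_const[of 0] DERIV_unique unfolding top[OF that] by blast
  define l' where "l' = (\<Sum>k<n. monom (d k) k)"
  have coeff_l': "coeff l' k = d k" for k using dtop[of k] by (auto simp: l'_def coeff_sum)
  have der: "poly_derivative ?c l'" by (simp add: poly_derivative_def coeff_l' d)
  moreover have "degree l' \<le> n - 1" by (rule degree_le) (use dtop in \<open>auto simp: coeff_l'\<close>)
  moreover have "[:- r s x, 1:] * l' = monom 1 i - smult (r s x ^ i / slp x s) (cof x s)"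
  proof -
    have "\<forall>\<^sub>F t in nhds 0. [:- ?r t, 1:] * ?c t = ?f t"
      using eventually_U[OF x, of "e i"]
    proof eventually_elim
      case (elim t)
      then show ?case
        using synthetic_div_correct'[of "?r t" "?f t"] r_root[OF s elim] by (simp add: cofactor_curve_def)
    qed
    from poly_derivative_unique[OF poly_derivative_mult[OF poly_derivative_linear_factor[OF r_line[OF s x i]] der]
        fpoly_line[OF i] this]
    have "[:- (- (r s x ^ i / slp x s)):] * ?c 0 + [:- r s x, 1:] * l' = monom 1 i" by simp
    moreover have "?c 0 = cof x s" by (simp add: cofactor_curve_def cof_def[OF x])
    ultimately show ?thesis by (simp add: algebra_simps)
  qed
  ultimately show ?thesis using that by blast
qed

end

lemma smult_const_poly: "smult c p = [:c:] * (p :: complex poly)" by simp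

lemma pCons_0_eq: "pCons 0 p = [:0, 1:] * (p :: complex poly)" by simp

lemma linear_factor_eq: "[:- a, 1:] = [:0, 1:] - [:a :: complex:]" by simp

text \<open>
  With \<open>X\<close> the variable, \<open>R\<close> the root, \<open>(X - R) l = f\<close>, \<open>T = \<theta>l\<close>, \<open>M = z\<^sup>i\<close> and \<open>- C\<close> the derivative of
  the root, this writes \<open>z\<^sup>i r l\<close> as \<open>f u + \<theta>f \<cdot> v\<close> such that \<open>u + \<theta>v\<close> is the derivative of \<open>r l\<close>.
\<close>

lemma residue_identity:
  fixes X :: "'a::idom"
  assumes "(X - R) * l' = M - C * l"
  shows "((X - R) * l) * (R * l' - C * l - C * T) + (X * l + (X - R) * T) * (C * l) = M * (R * l)"
  using assms by algebra

text \<open>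
  Notation as in \<open>residue_identity\<close>, with \<open>A\<close> the constant term of \<open>f\<close> and \<open>D\<close> its derivative. In
  \<open>z\<^sup>i p - f p'\<close> for \<open>p = r l + A\<close> the simple pole cancels and \<open>z l\<^sup>2\<close> remains.
\<close>

lemma double_residue_identity:
  fixes X :: "'a::idom"
  assumes "(X - R) * l' = M - C * l"
  shows "M * (R * l + A) - ((X - R) * l) * (R * l' - C * l + D) = A * M - D * ((X - R) * l) + C * (X * (l * l))"
  using assms by algebra

lemma log_part_identity:
  fixes M :: "'a::comm_ring_1"
  shows "I * M * (T - N * f) + M * (T' - N * T) - M * (T' - N * T) - M * (T' - N * T)
     + ((M * T' + f * (I * (I * M))) - (I * M * T + T * (I * M))) = (N - I) * (T * M - I * (f * M))"
  by (simp add: algebra_simps)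

context gkz_roots
begin

abbreviation "closed_points \<equiv> lattice_points (sigma_cone 0 n)"
abbreviation "interior_points \<equiv> lattice_points (interior (sigma_cone 0 n))"
abbreviation "Sol \<equiv> bbGKZ_solutions n e U closed_points"
abbreviation "Sol_int \<equiv> bbGKZ_solutions n e U interior_points"

lemma closed_iff: "(int k, int l) \<in> closed_points \<longleftrightarrow> k \<le> n * l"
  using cone_point_iff[OF n_pos, of "int k" "int l"] by (metis of_nat_0_le_iff of_nat_le_iff of_nat_mult)

lemma interior_iff: "(int k, int l) \<in> interior_points \<longleftrightarrow> 0 < k \<and> k < n * l"
  using interior_point_iff[OF n_pos, of "int k" "int l"] by (metis of_nat_0_less_iff of_nat_less_iff of_nat_mult)

text \<open>
  A solution of \<open>bbGKZ(C, 0)\<close> has \<open>\<Phi>\<^sub>(\<^sub>0\<^sub>,\<^sub>0\<^sub>) = const + \<Sum>\<^sub>s a\<^sub>s log r\<^sub>s\<close>; this is the coefficient \<open>a\<^sub>s\<close>.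
\<close>

definition weight :: "(int \<times> int \<Rightarrow> complex ^ 'a \<Rightarrow> complex) \<Rightarrow> nat
    \<Rightarrow> complex ^ 'a \<Rightarrow> complex" where
  "weight \<Phi> s x = - r s x * lin (level \<Phi> 1 x) (cof x s)"

text \<open>
  Up to a summand independent of \<open>s\<close> this is \<open>(E / n) log r\<^sub>s\<close> plus a constant depending on \<open>s\<close>. If
  \<open>\<Psi>\<^sub>1(u) = - \<integral> u / f dz/z\<close>, it is a regularised \<open>- \<integral> r\<^sub>s / (z - r\<^sub>s) dz/z\<close>.
\<close>

definition period :: "(int \<times> int \<Rightarrow> complex ^ 'a \<Rightarrow> complex) \<Rightarrow> nat
    \<Rightarrow> complex ^ 'a \<Rightarrow> complex" where
  "period \<Psi> s x = lin (level \<Psi> 1 x) (smult (r s x) (cof x s))"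

text \<open>
  For \<open>\<Psi>\<^sub>2(u) = \<integral> u / f\<^sup>2 dz/z\<close> over a path this is the increment of \<open>\<theta>f / f\<close>, so \<open>n\<close> for a path
  from \<open>0\<close> to \<open>\<infinity>\<close> and \<open>0\<close> for a cycle: it detects the one solution not given by residues.
\<close>

definition log_part :: "(int \<times> int \<Rightarrow> complex ^ 'a \<Rightarrow> complex) \<Rightarrow> complex ^
    'a \<Rightarrow> complex" where
  "log_part \<Psi> x = lin (level \<Psi> 2 x) (fpoly x * theta (theta (fpoly x)) - theta (fpoly x) * theta
      (fpoly x))"

lemma cofactor_curve_eq: "x + axis (e i) t \<in> U \<Longrightarrow>
    cofactor_curve x s i t = cof (x + axis (e i) t) s"
  by (simp add: cofactor_curve_def cof_def)

lemma lin_closed_zero: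
  assumes "\<Phi> \<in> Sol" "x \<in> U"
  shows "lin (level \<Phi> 1 x) (fpoly x) = 0" "lin (level \<Phi> 1 x) (theta (fpoly x)) = 0"
  using lin_solution_mult[OF assms, of 1 0] closed_iff[of 0 0] closed_iff[of _ 0]
  by (simp_all add: theta_def pderiv_1 coeff_1 split: if_splits)

text \<open>
  The derivative is that of \<open>- \<Phi>\<^sub>1(r l)\<close> with respect to both the functional and its argument. By
  \<open>residue_identity\<close> and the two relations, the part \<open>\<Phi>\<^sub>2(z\<^sup>i r l)\<close> equals \<open>- \<Phi>\<^sub>1\<close> of the derivative of
  \<open>r l\<close>, so the two parts cancel.
\<close>

lemma weight_line:
  assumes \<Phi>: "\<Phi> \<in> Sol" and x: "x \<in> U" and i: "i \<le> n" and s: "s < n"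
  shows "((\<lambda>t. weight \<Phi> s (x + axis (e i) t)) has_field_derivative 0) (at 0)"
proof -
  interpret R: simple_roots n "fpoly x" "\<lambda>s. r s x" by (rule simple_roots_at[OF x])
  let ?rt = "\<lambda>t. r s (x + axis (e i) t)"
  define c where "c = r s x ^ i / slp x s"
  define l where "l = cof x s"
  obtain l' where l': "poly_derivative (cofactor_curve x s i) l'" "degree l' \<le> n - 1"
    "[:- r s x, 1:] * l' = monom 1 i - smult c l"
    using cofactor_line[OF s x i] unfolding c_def l_def by metis
  define p where "p t = smult (?rt t) (cofactor_curve x s i t)" for t
  define p' where "p' = smult (- c) l + smult (r s x) l'"
  have c0: "cofactor_curve x s i 0 = l" using cofactor_curve_eq[of x i 0 s] x by (simp add: l_def)
  have p: "poly_derivative p p'"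
    using poly_derivative_smult[OF r_line[OF s x i] l'(1)] by (simp add: p_def[abs_def] p'_def c_def c0)
  have deg: "degree (p t) \<le> n - 1" for t
    unfolding p_def using degree_smult_le degree_cofactor_curve order_trans by blast
  have supp: "\<forall>\<^sub>F t in nhds 0. coeff (p t) k = 0" if "(int k, int 1) \<notin> closed_points" for k
  proof (intro always_eventually allI coeff_eq_0)
    fix t show "degree (p t) < k" using that deg[of t] n_pos by (auto simp: closed_iff[of k 1, simplified])
  qed
  let ?A1 = "level \<Phi> 1 x" and ?A2 = "level \<Phi> (Suc 1) x"
  have main: "((\<lambda>t. lin (level \<Phi> 1 (x + axis (e i) t)) (p t)) has_field_derivative
      lin ?A2 (monom 1 i * p 0) + lin ?A1 p') (at 0)"
    by (rule lin_solution_line[OF \<Phi> x i p deg supp])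
  have p0: "p 0 = smult (r s x) l" by (simp add: p_def c0)
  define u where "u = p' - smult c (theta l)"
  have dl: "degree l \<le> n - 1" using R.degree_cofactor by (simp add: l_def)
  have du: "degree u \<le> n - 1" "degree (smult c l) \<le> n - 1"
    unfolding u_def p'_def using dl l'(2) degree_theta[of l]
    by (auto intro!: degree_diff_le degree_add_le order_trans[OF degree_smult_le])
  have closed: "(int k, int 1) \<in> closed_points" if "coeff g k \<noteq> 0" "degree g \<le> n - 1"
      for g :: "complex poly" and k
    using le_degree[OF that(1)] that(2) n_pos by (subst closed_iff) linarith
  have "monom 1 i * p 0 = fpoly x * u + theta (fpoly x) * smult c l"
  proof -
    have f: "fpoly x = ([:0, 1:] - [:r s x:]) * l"
      using R.cofactor[OF s] unfolding l_def linear_factor_eq by simp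
    have th: "theta (fpoly x) = [:0, 1:] * l + ([:0, 1:] - [:r s x:]) * theta l"
      using R.theta_cofactor[OF s] unfolding l_def[symmetric] linear_factor_eq pCons_0_eq[of l] .
    have "([:0, 1:] - [:r s x:]) * l' = monom 1 i - [:c:] * l"
      using l'(3) unfolding linear_factor_eq smult_const_poly .
    from residue_identity[OF this, of "theta l"] show ?thesis
      unfolding p0 u_def p'_def th unfolding f by (simp add: algebra_simps)
  qed
  moreover have "lin ?A2 (fpoly x * u) = - lin ?A1 u"
    using lin_solution_mult(1)[OF \<Phi> x, of u 1] closed du(1) by simp
  moreover have "lin ?A2 (theta (fpoly x) * smult c l) = - lin ?A1 (theta (smult c l))"
    using closed du(2) by (intro lin_solution_mult(2)[OF \<Phi> x, of _ 1]) auto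
  ultimately have "lin ?A2 (monom 1 i * p 0) + lin ?A1 p' = 0"
    by (simp add: lin_add u_def lin_diff lin_smult theta_smult)
  with main have main0: "((\<lambda>t. lin (level \<Phi> 1 (x + axis (e i) t)) (p t)) has_field_derivative 0)
      (at 0)" by simp
  have "\<forall>\<^sub>F t in nhds 0. weight \<Phi> s (x + axis (e i) t)
      = - lin (level \<Phi> 1 (x + axis (e i) t)) (p t)"
    using eventually_U[OF x, of "e i"]
    by (rule eventually_mono) (simp add: weight_def p_def cofactor_curve_eq lin_smult)
  from DERIV_cong_ev[OF refl this refl, of 0] show ?thesis
    using DERIV_minus[OF main0] by simp
qed

text \<open>
  For \<open>i > 0\<close> the obvious way to write \<open>z\<^sup>i (f \<theta>\<^sup>2f - (\<theta>f)\<^sup>2)\<close> as \<open>f u - \<theta>f \<cdot> v\<close>, with \<open>u = z\<^sup>i \<theta>\<^sup>2f\<close> and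
  \<open>v = z\<^sup>i \<theta>f\<close>, leaves the interior of the cone when \<open>i = n\<close>. Replacing \<open>\<theta>f\<close> by \<open>g = \<theta>f - n f\<close> removes the top
  coefficient; for \<open>i = 0\<close> one keeps \<open>\<theta>f\<close>, which has no constant term.
\<close>

lemma log_part_line:
  assumes \<Psi>: "\<Psi> \<in> Sol_int" and x: "x \<in> U" and i: "i \<le> n"
  shows "((\<lambda>t. log_part \<Psi> (x + axis (e i) t)) has_field_derivative 0) (at 0)"
proof -
  let ?ft = "\<lambda>t. fpoly (x + axis (e i) t)"
  define p where "p t = ?ft t * theta (theta (?ft t)) - theta (?ft t) * theta (?ft t)" for t
  let ?f = "fpoly x" and ?M = "monom 1 i :: complex poly"
  let ?A1 = "level \<Psi> (Suc 0) x" and ?A2 = "level \<Psi> 2 x" and ?A3 = "level \<Psi> (Suc 2) x"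
  define p' where "p' = (?M * theta (theta ?f) + ?f * theta (theta ?M)) - (theta ?M * theta ?f
      + theta ?f * theta ?M)"
  have ft: "poly_derivative ?ft ?M" by (rule fpoly_line[OF i])
  have p: "poly_derivative p p'"
    unfolding p_def[abs_def] p'_def
    using poly_derivative_diff[OF poly_derivative_mult[OF ft poly_derivative_theta[OF poly_derivative_theta[OF ft]]]
        poly_derivative_mult[OF poly_derivative_theta[OF ft] poly_derivative_theta[OF ft]]] by simp
  have degf: "degree (?ft t) \<le> n" for t by (rule degree_le) (auto simp: coeff_fpoly)
  have deg: "degree (p t) \<le> 2 * n" for t
    unfolding p_def using degf[of t] degree_theta[of "?ft t"] degree_theta[of "theta (?ft t)"]
    by (intro degree_diff_le order_trans[OF degree_mult_le]) auto
  have zero: "coeff (p t) k = 0" if "(int k, int 2) \<notin> interior_points" for k t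
    using that theta_square_support[OF degf, of t k] unfolding p_def interior_iff by (auto simp: mult.commute)
  have main: "((\<lambda>t. lin (level \<Psi> 2 (x + axis (e i) t)) (p t)) has_field_derivative
      lin ?A3 (?M * p 0) + lin ?A2 p') (at 0)"
    by (rule lin_solution_line[OF \<Psi> x i p deg]) (simp add: zero)
  have inter: "(int k, int 2) \<in> interior_points" if "0 < k" "k < 2 * n" for k
    using that by (subst interior_iff) auto
  have degx: "degree ?f \<le> n" using degf[of 0] by simp
  have p0: "p 0 = ?f * theta (theta ?f) - theta ?f * theta ?f" by (simp add: p_def)
  have "lin ?A3 (?M * p 0) + lin ?A2 p' = 0"
  proof (cases "i = 0")
    case True
    have supp: "(int k, int 2) \<in> interior_points" if "coeff ?f k \<noteq> 0" "k \<noteq> 0" for k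
      using le_degree[OF that(1)] degx that n_pos by (intro inter) auto
    have 1: "lin ?A3 (?f * theta (theta ?f)) = - 2 * lin ?A2 (theta (theta ?f))"
      using lin_solution_mult(1)[OF \<Psi> x, of "theta (theta ?f)" 2] supp by simp
    have 2: "lin ?A3 (theta ?f * theta ?f) = - lin ?A2 (theta (theta ?f))"
      using lin_solution_mult(2)[OF \<Psi> x, of "theta ?f" 2] supp by simp
    have "theta 1 = 0" "theta 0 = 0" by (rule poly_eqI, auto simp: coeff_1)+
    then have "p' = theta (theta ?f)" using True by (simp add: p'_def)
    then show ?thesis using True 1 2 by (simp add: p0 lin_diff)
  next
    case False
    define g where "g = theta ?f - smult (of_nat n) ?f"
    have g_top: "coeff g k = 0" if "k \<ge> n" for k
      using that degx by (cases "k = n") (auto simp: g_def coeff_eq_0)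
    have supp: "(int k, int 2) \<in> interior_points"
        if "coeff (?M * h) k \<noteq> 0" "\<And>k. k \<ge> n \<Longrightarrow> coeff h k = 0" for h k
    proof -
      have "i \<le> k" "coeff h (k - i) \<noteq> 0" using that(1) by (auto simp: coeff_monom_mult split: if_splits)
      then have "k - i < n" using that(2) by (meson not_le)
      then show ?thesis using \<open>i \<le> k\<close> False i by (intro inter) auto
    qed
    \<comment> \<open>Both functionals below now have arguments with exponents in \<open>i, \<dots>, i + n - 1\<close>.\<close>
    have tg: "theta g = theta (theta ?f) - smult (of_nat n) (theta ?f)" by (simp add: g_def theta_diff theta_smult)
    have tM: "theta ?M = smult (of_nat i) ?M" by (simp add: theta_monom)
    have "?M * p 0 = ?f * (?M * theta g) - theta ?f * (?M * g)"
      unfolding p0 tg unfolding g_def by (simp add: algebra_simps)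
    moreover have "lin ?A3 (?f * (?M * theta g)) = - 2 * lin ?A2 (?M * theta g)"
      using lin_solution_mult(1)[OF \<Psi> x, of "?M * theta g" 2] supp g_top by simp
    moreover have "lin ?A3 (theta ?f * (?M * g)) = - lin ?A2 (theta (?M * g))"
      using lin_solution_mult(2)[OF \<Psi> x, of "?M * g" 2] supp g_top by simp
    ultimately have "lin ?A3 (?M * p 0) + lin ?A2 p' = lin ?A2 (theta (?M * g) - ?M * theta g - ?M * theta g + p')"
      by (simp only: lin_add lin_diff) simp
    also have "theta (?M * g) - ?M * theta g - ?M * theta g + p'
        = smult (of_nat n - of_nat i) (theta ?f * ?M - smult (of_nat i) (?f * ?M))"
    proof -
      let ?N = "[:of_nat n:] :: complex poly" and ?I = "[:of_nat i:] :: complex poly"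
      have 1: "theta ?M = ?I * ?M" "theta (theta ?M) = ?I * (?I * ?M)" by (simp_all add: tM theta_smult)
      have 2: "theta (?M * g) = ?I * ?M * g + ?M * theta g" by (simp add: theta_mult tM)
      have 3: "g = theta ?f - ?N * ?f" "theta g = theta (theta ?f) - ?N * theta ?f"
        by (simp_all add: tg) (simp add: g_def)
      have 4: "smult (of_nat n - of_nat i) q = (?N - ?I) * q" for q by simp
      show ?thesis
        unfolding p'_def 2 3(2) 1(2) 4 smult_const_poly[of "of_nat i"]
        unfolding 1(1) 3(1) by (rule log_part_identity)
    qed
    also have "lin ?A2 \<dots> = 0"
    proof (cases "i = n")
      case False
      then have "(int k, int 1) \<in> interior_points" if "coeff ?M k \<noteq> 0" for k
        using that \<open>i \<noteq> 0\<close> i by (subst interior_iff) (auto split: if_splits)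
      then have "lin ?A2 (?f * ?M) = - lin ?A1 ?M" "lin ?A2 (theta ?f * ?M) = - lin ?A1 (theta ?M)"
        using lin_solution_mult[OF \<Psi> x, of ?M 1] by (simp_all add: numeral_2_eq_2)
      then show ?thesis by (simp add: lin_smult lin_diff tM)
    qed simp
    finally show ?thesis .
  qed
  with main have "((\<lambda>t. lin (level \<Psi> 2 (x + axis (e i) t)) (p t)) has_field_derivative 0)
      (at 0)" by simp
  then show ?thesis by (simp add: log_part_def p_def)
qed

text \<open>
  By the two relations the functional of degree 2 kills exact forms, so \<open>quadratic_residue\<close> applies.
\<close>

lemma log_part_eq:
  assumes \<Psi>: "\<Psi> \<in> Sol_int" and x: "x \<in> U" and s: "s < n"
  shows "of_nat n * r s x * lin (level \<Psi> 2 x) (pCons 0 (cof x s * cof x s)) = - log_part \<Psi> x"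
proof -
  interpret R: simple_roots n "fpoly x" "\<lambda>s. r s x" by (rule simple_roots_at[OF x])
  show ?thesis
    unfolding log_part_def
  proof (rule R.quadratic_residue[OF s])
    fix g :: "complex poly" assume g: "degree g < n" "coeff g 0 = 0"
    have int1: "(int k, int 1) \<in> interior_points" if "coeff g k \<noteq> 0" for k
      using le_degree[OF that] g that by (subst interior_iff) (auto intro: Nat.gr0I)
    then have int2: "(int k, int 1) \<in> interior_points" if "coeff (theta g) k \<noteq> 0" for k
      using that by (auto split: if_splits)
    have "lin (level \<Psi> 2 x) (fpoly x * theta g) = - lin (level \<Psi> 1 x) (theta g)"
      using lin_solution_mult(1)[OF \<Psi> x, of "theta g" 1] int2 by (simp add: numeral_2_eq_2)
    moreover have "lin (level \<Psi> 2 x) (theta (fpoly x) * g) = - lin (level \<Psi> 1 x) (theta g)"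
      using lin_solution_mult(2)[OF \<Psi> x, of g 1] int1 by (simp add: numeral_2_eq_2)
    ultimately show "lin (level \<Psi> 2 x) (fpoly x * theta g - g * theta (fpoly x)) = 0"
      by (simp add: lin_diff mult.commute)
  qed
qed

text \<open>
  The first summand does not depend on \<open>s\<close> and drops out of \<open>\<Sum>\<^sub>s a\<^sub>s B\<^sub>s\<close>. By \<open>log_part_eq\<close> the second is
  \<open>E / n\<close> times the derivative of \<open>log r\<^sub>s\<close>. To stay in the interior of the cone, the constant term \<open>- x\<^sub>0\<close> of \<open>r\<^sub>s l\<^sub>s\<close>
  has to be removed before differentiating.
\<close>

lemma period_line:
  assumes \<Psi>: "\<Psi> \<in> Sol_int" and x: "x \<in> U" and i: "i \<le> n" and s: "s < n"
  shows "((\<lambda>t. period \<Psi> s (x + axis (e i) t)) has_field_derivative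
     lin (level \<Psi> 2 x) (smult (coeff (fpoly x) 0) (monom 1 i) - smult (coeff (monom 1 i) 0) (fpoly x))
     + r s x ^ i / slp x s * lin (level \<Psi> 2 x) (pCons 0 (cof x s * cof x s))) (at 0)"
proof -
  interpret R: simple_roots n "fpoly x" "\<lambda>s. r s x" by (rule simple_roots_at[OF x])
  let ?rt = "\<lambda>t. r s (x + axis (e i) t)" and ?ft = "\<lambda>t. fpoly (x + axis (e i) t)"
  let ?M = "monom 1 i :: complex poly"
  let ?A1 = "level \<Psi> 1 x" and ?A2 = "level \<Psi> (Suc 1) x"
  define c where "c = r s x ^ i / slp x s"
  define l where "l = cof x s"
  obtain l' where l': "poly_derivative (cofactor_curve x s i) l'" "degree l' \<le> n - 1"
    "[:- r s x, 1:] * l' = monom 1 i - smult c l"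
    using cofactor_line[OF s x i] unfolding c_def l_def by metis
  define p where "p t = smult (?rt t) (cofactor_curve x s i t) + [:coeff (?ft t) 0:]" for t
  define p' where "p' = smult (- c) l + smult (r s x) l' + [:coeff ?M 0:]"
  have c0: "cofactor_curve x s i 0 = l" using cofactor_curve_eq[of x i 0 s] x by (simp add: l_def)
  have p: "poly_derivative p p'"
    using poly_derivative_add[OF poly_derivative_smult[OF r_line[OF s x i] l'(1)] poly_derivative_coeff_const[OF
        fpoly_line[OF i, of x]]]
    by (simp add: p_def[abs_def] p'_def c_def c0)
  have deg: "degree (p t) \<le> n - 1" for t
    unfolding p_def using degree_cofactor_curve[of x s i t]
    by (intro degree_add_le order_trans[OF degree_smult_le]) auto
  have supp: "\<forall>\<^sub>F t in nhds 0. coeff (p t) k = 0" if k: "(int k, int 1) \<notin> interior_points"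
      for k
  proof (cases "k = 0")
    case True
    show ?thesis using eventually_U[OF x, of "e i"]
    proof (rule eventually_mono)
      fix t assume t: "x + axis (e i) t \<in> U"
      from simple_roots.coeff_cofactor_0[OF simple_roots_at[OF t] s] simple_roots.root_nonzero[OF
          simple_roots_at[OF t] s]
      show "coeff (p t) k = 0" by (simp add: True p_def cofactor_curve_eq[OF t])
    qed
  next
    case False
    with k have "k \<ge> n" by (subst (asm) interior_iff) auto
    then show ?thesis using deg n_pos
      by (intro always_eventually allI coeff_eq_0)
          (metis Suc_diff_1 Suc_le_eq le_less_trans less_le_trans not_less_eq_eq nat_less_le diff_less
          zero_less_one)
  qed
  have main: "((\<lambda>t. lin (level \<Psi> 1 (x + axis (e i) t)) (p t)) has_field_derivative
      lin ?A2 (?M * p 0) + lin ?A1 p') (at 0)"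
    by (rule lin_solution_line[OF \<Psi> x i p deg supp])
  have p0: "p 0 = smult (r s x) l + [:coeff (fpoly x) 0:]" by (simp add: p_def c0)
  have "(int k, int 1) \<in> interior_points" if "coeff p' k \<noteq> 0" for k
    using poly_derivative_coeff_zero[OF p supp] that by blast
  then have "lin ?A2 (fpoly x * p') = - lin ?A1 p'"
    using lin_solution_mult(1)[OF \<Psi> x, of p' 1] by simp
  then have "lin ?A2 (?M * p 0) + lin ?A1 p' = lin ?A2 (?M * p 0 - fpoly x * p')" by (simp add: lin_diff)
  also have "?M * p 0 - fpoly x * p'
     = smult (coeff (fpoly x) 0) ?M - smult (coeff ?M 0) (fpoly x) + smult c (pCons 0 (l * l))"
  proof -
    have f: "fpoly x = ([:0, 1:] - [:r s x:]) * l"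
      using R.cofactor[OF s] unfolding l_def linear_factor_eq by simp
    have "([:0, 1:] - [:r s x:]) * l' = ?M - [:c:] * l"
      using l'(3) unfolding linear_factor_eq smult_const_poly .
    from double_residue_identity[OF this, of "[:coeff (fpoly x) 0:]" "[:coeff ?M 0:]"]
    have "?M * ([:r s x:] * l + [:coeff (fpoly x) 0:]) - fpoly x * ([:r s x:] * l' - [:c:] * l + [:coeff ?M 0:])
       = [:coeff (fpoly x) 0:] * ?M - [:coeff ?M 0:] * fpoly x + [:c:] * ([:0, 1:] * (l * l))"
      unfolding f[symmetric] .
    then show ?thesis
      unfolding p0 p'_def smult_const_poly pCons_0_eq[of "l * l"] by (simp add: algebra_simps)
  qed
  also have "lin ?A2 \<dots> = lin (level \<Psi> 2 x) (smult (coeff (fpoly x) 0) ?M - smult (coeff ?M 0) (fpoly x))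
     + c * lin (level \<Psi> 2 x) (pCons 0 (l * l))"
    unfolding lin_add lin_smult by (simp add: numeral_2_eq_2)
  finally have val: "lin ?A2 (?M * p 0) + lin ?A1 p' = \<dots>" .
  have outside: "level \<Psi> 1 y 0 = 0" for y
    using solution_outside[OF \<Psi>, of "(int 0, int 1)" y] interior_iff[of 0 1] by (simp add: level_def)
  have "\<forall>\<^sub>F t in nhds 0. period \<Psi> s (x + axis (e i) t)
      = lin (level \<Psi> 1 (x + axis (e i) t)) (p t)"
    using eventually_U[OF x, of "e i"]
  proof (rule eventually_mono)
    fix t assume t: "x + axis (e i) t \<in> U"
    have "lin A [:a:] = a * A 0" for A a by (simp add: lin_def)
    then show "period \<Psi> s (x + axis (e i) t) = lin (level \<Psi> 1 (x + axis (e i) t)) (p t)"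
      by (simp add: period_def p_def cofactor_curve_eq[OF t] lin_add outside[unfolded One_nat_def])
  qed
  from DERIV_cong_ev[OF refl this refl] main val show ?thesis by (simp add: c_def l_def)
qed

text \<open>
  The sum is \<open>- \<Phi>\<^sub>1(\<theta>f)\<close> evaluated at the roots, and \<open>\<Phi>\<^sub>1(\<theta>f) = 0\<close> is a relation at the origin.
\<close>

lemma sum_weights:
  assumes \<Phi>: "\<Phi> \<in> Sol" and x: "x \<in> U"
  shows "(\<Sum>s<n. weight \<Phi> s x) = 0"
proof -
  interpret R: simple_roots n "fpoly x" "\<lambda>s. r s x" by (rule simple_roots_at[OF x])
  have "0 = lin (level \<Phi> 1 x) (theta (fpoly x))" using lin_closed_zero[OF \<Phi> x] by simp
  also have "\<dots> = (\<Sum>s<n. lin (level \<Phi> 1 x) (R.cofactor s) / R.slope s * poly (theta (fpoly x))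
      (r s x))"
    using degree_theta[of "fpoly x"] R.degree_f by (intro R.functional_at_roots lin_closed_zero[OF \<Phi> x]) auto
  also have "\<dots> = (\<Sum>s<n. - weight \<Phi> s x)"
    by (rule sum.cong) (auto simp: weight_def poly_theta R.slope_def[symmetric] R.slope_nonzero)
  finally show ?thesis by (simp add: sum_negf)
qed

text \<open>
  As \<open>- r\<^sub>s\<^sup>i / f'(r\<^sub>s)\<close> is the derivative of \<open>r\<^sub>s\<close>, the right-hand side is the derivative of
  \<open>\<Sum>\<^sub>s a\<^sub>s log r\<^sub>s\<close> for constant \<open>a\<^sub>s\<close>.
\<close>

lemma level_one_weights:
  assumes \<Phi>: "\<Phi> \<in> Sol" and x: "x \<in> U" and i: "i \<le> n"
  shows "level \<Phi> 1 x i = (\<Sum>s<n. - weight \<Phi> s x * (r s x ^ i / (r s x * slp x s)))"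
proof -
  interpret R: simple_roots n "fpoly x" "\<lambda>s. r s x" by (rule simple_roots_at[OF x])
  have "level \<Phi> 1 x i = lin (level \<Phi> 1 x) (monom 1 i)" by (simp add: lin_monom)
  also have "\<dots> = (\<Sum>s<n. lin (level \<Phi> 1 x) (R.cofactor s) / R.slope s * poly (monom 1 i) (r s x))"
    using i by (intro R.functional_at_roots lin_closed_zero[OF \<Phi> x]) (simp add: degree_monom_eq)
  also have "\<dots> = (\<Sum>s<n. - weight \<Phi> s x * (r s x ^ i / (r s x * slp x s)))"
    by (rule sum.cong) (auto simp: weight_def poly_monom R.root_nonzero)
  finally show ?thesis .
qed

theorem pairing_eq:
  assumes \<Phi>: "\<Phi> \<in> Sol" and \<Psi>: "\<Psi> \<in> Sol_int" and x: "x \<in> U"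
  shows "pairing n e \<Phi> \<Psi> x = \<Phi> (0, 0) x * log_part \<Psi> x - of_nat n *
      (\<Sum>s<n. weight \<Phi> s x * period \<Psi> s x)"
proof -
  interpret R: simple_roots n "fpoly x" "\<lambda>s. r s x" by (rule simple_roots_at[OF x])
  let ?A = "level \<Phi> 1 x" and ?B = "level \<Psi> 1 x" and ?I = "{(i, j). i < j \<and> j \<le> n}"
  have deg: "degree (fpoly x) \<le> n" by (simp add: R.degree_f)
  have "(\<Sum>(i, j)\<in>?I. (of_nat (j - i))\<^sup>2 * x $ e i * x $ e j * \<Psi> (gen i + gen j) x)
      = (\<Sum>(i, j)\<in>?I. (of_nat (j - i))\<^sup>2 * coeff (fpoly x) i * coeff (fpoly x) j * level \<Psi> 2 x
          (i + j))"
    by (rule sum.cong) (auto simp: level_def gen_def coeff_fpoly)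
  then have 1: "(\<Sum>(i, j)\<in>?I. (of_nat (j - i))\<^sup>2 * x $ e i * x $ e j * \<Psi> (gen i + gen j) x)
      = log_part \<Psi> x"
    unfolding log_part_def sum_squared_differences[OF deg] .
  have inner: "(\<Sum>(c, d)\<in>splittings n i j. delta i j c * \<Phi> c x * \<Psi> d x)
      = (\<Sum>k=i..j. trapezoid_weight i j k * ?A k * ?B (i + j - k))" if ij: "i < j" "j \<le> n" for i j
  proof -
    let ?S = "{k \<in> {i..j}. 0 < i + j - k \<and> i + j - k < n}"
    have "(\<Sum>(c, d)\<in>splittings n i j. delta i j c * \<Phi> c x * \<Psi> d x)
        = (\<Sum>k\<in>?S. trapezoid_weight i j k * ?A k * ?B (i + j - k))"
      unfolding splittings_eq[OF n_pos ij]
      by (subst sum.reindex) (auto simp: inj_on_def delta_degree_one[OF ij(1)] level_def)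
    also have "\<dots> = (\<Sum>k=i..j. trapezoid_weight i j k * ?A k * ?B (i + j - k))"
    proof (rule sum.mono_neutral_left)
      show "\<forall>k\<in>{i..j} - ?S. trapezoid_weight i j k * ?A k * ?B (i + j - k) = 0"
      proof
        fix k assume "k \<in> {i..j} - ?S"
        then have "(int (i + j - k), int 1) \<notin> interior_points" by (subst interior_iff) auto
        then have "?B (i + j - k) = 0" unfolding level_def by (rule solution_outside[OF \<Psi>])
        then show "trapezoid_weight i j k * ?A k * ?B (i + j - k) = 0" by simp
      qed
    qed auto
    finally show ?thesis .
  qed
  have "(\<Sum>(i, j)\<in>?I. of_nat n * of_nat (j - i) * x $ e i * x $ e j *
          (\<Sum>(c, d)\<in>splittings n i j. delta i j c * \<Phi> c x * \<Psi> d x))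
      = of_nat n * (\<Sum>(i, j)\<in>?I. of_nat (j - i) * coeff (fpoly x) i * coeff (fpoly x) j *
          (\<Sum>k=i..j. trapezoid_weight i j k * ?A k * ?B (i + j - k)))"
    unfolding sum_distrib_left[of "of_nat n"]
  proof (rule sum.cong[OF refl])
    fix p assume "p \<in> ?I"
    then obtain i j where p: "p = (i, j)" and ij: "i < j" "j \<le> n" by blast
    have coeffs: "coeff (fpoly x) i = x $ e i" "coeff (fpoly x) j = x $ e j" using ij by (simp_all add: coeff_fpoly)
    show "(case p of (i, j) \<Rightarrow> of_nat n * of_nat (j - i) * x $ e i * x $ e j *
          (\<Sum>(c, d)\<in>splittings n i j. delta i j c * \<Phi> c x * \<Psi> d x))
      = of_nat n * (case p of (i, j) \<Rightarrow> of_nat (j - i) * coeff (fpoly x) i * coeff (fpoly x) j *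
          (\<Sum>k=i..j. trapezoid_weight i j k * ?A k * ?B (i + j - k)))"
      unfolding p prod.case inner[OF ij] coeffs by (simp only: mult.assoc)
  qed
  also have "\<dots> = of_nat n * (\<Sum>s<n. weight \<Phi> s x * period \<Psi> s x)"
    unfolding R.pairing_sum_at_roots[OF lin_closed_zero[OF \<Phi> x]] weight_def period_def ..
  finally show ?thesis unfolding pairing_def using 1 by simp
qed

text \<open>
  The derivatives of \<open>\<Phi>\<^sub>(\<^sub>0\<^sub>,\<^sub>0\<^sub>) E\<close> and of \<open>n \<Sum>\<^sub>s a\<^sub>s B\<^sub>s\<close> are both \<open>E \<Sum>\<^sub>s a\<^sub>s \<partial>\<^sub>i log r\<^sub>s\<close>.
\<close>

lemma pairing_partial:
  assumes \<Phi>: "\<Phi> \<in> Sol" and \<Psi>: "\<Psi> \<in> Sol_int" and x: "x \<in> U" and i: "i \<le> n"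
  shows "partial_deriv (e i) (pairing n e \<Phi> \<Psi>) x = 0"
proof (rule partial_derivI)
  interpret R: simple_roots n "fpoly x" "\<lambda>s. r s x" by (rule simple_roots_at[OF x])
  let ?E = "log_part \<Psi> x" and ?Q = "\<lambda>s. lin (level \<Psi> 2 x) (pCons 0 (cof x s * cof x s))"
  let ?y = "\<lambda>t. x + axis (e i) t"
  define \<kappa> where "\<kappa> = lin (level \<Psi> 2 x) (smult (coeff (fpoly x) 0) (monom 1 i) - smult (coeff
      (monom 1 i) 0) (fpoly x))"
  have \<Phi>0: "((\<lambda>t. \<Phi> (0, 0) (?y t)) has_field_derivative level \<Phi> 1 x i) (at 0)"
    using solution_line[OF \<Phi> _ x i, of "(0, 0)"] closed_iff[of 0 0] by (simp add: level_def gen_def)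
  have "((\<lambda>t. \<Phi> (0, 0) (?y t) * log_part \<Psi> (?y t) - of_nat n * (\<Sum>s<n. weight \<Phi> s
      (?y t) * period \<Psi> s (?y t)))
     has_field_derivative
     (level \<Phi> 1 x i * log_part \<Psi> (?y 0) + 0 * \<Phi> (0, 0) (?y 0))
       - of_nat n * (\<Sum>s<n. 0 * period \<Psi> s (?y 0) + (\<kappa>
           + r s x ^ i / slp x s * ?Q s) * weight \<Phi> s (?y 0))) (at 0)"
    unfolding \<kappa>_def
    by (intro DERIV_diff DERIV_cmult DERIV_sum DERIV_mult \<Phi>0 log_part_line[OF \<Psi> x i] weight_line[OF
        \<Phi> x i] period_line[OF \<Psi> x i]) auto
  moreover have "of_nat n * (\<Sum>s<n. (\<kappa> + r s x ^ i / slp x s * ?Q s) * weight \<Phi> s x)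
      = level \<Phi> 1 x i * ?E"
  proof -
    have "of_nat n * (\<Sum>s<n. (\<kappa> + r s x ^ i / slp x s * ?Q s) * weight \<Phi> s x)
        = of_nat n * \<kappa> * (\<Sum>s<n. weight \<Phi> s x) + (\<Sum>s<n. weight \<Phi> s x *
            (r s x ^ i / slp x s) * (of_nat n * ?Q s))"
      by (simp add: sum_distrib_left sum.distrib[symmetric] algebra_simps)
    also have "\<dots> = (\<Sum>s<n. - weight \<Phi> s x * (r s x ^ i / (r s x * slp x s)) * ?E)"
    proof -
      have "of_nat n * ?Q s = - ?E / r s x" if "s < n" for s
        using log_part_eq[OF \<Psi> x that] R.root_nonzero[OF that] by (simp add: field_simps)
      then show ?thesis by (simp add: sum_weights[OF \<Phi> x] mult_ac)
    qed
    also have "\<dots> = level \<Phi> 1 x i * ?E"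
      by (simp only: level_one_weights[OF \<Phi> x i] sum_distrib_right)
    finally show ?thesis .
  qed
  ultimately have D0: "((\<lambda>t. \<Phi> (0, 0) (?y t) * log_part \<Psi> (?y t) - of_nat n *
      (\<Sum>s<n. weight \<Phi> s (?y t) * period \<Psi> s (?y t)))
     has_field_derivative 0) (at 0)" by simp
  have ev: "\<forall>\<^sub>F t in nhds 0. pairing n e \<Phi> \<Psi> (?y t)
      = \<Phi> (0, 0) (?y t) * log_part \<Psi> (?y t) - of_nat n * (\<Sum>s<n. weight \<Phi> s
      (?y t) * period \<Psi> s (?y t))"
    using eventually_U[OF x, of "e i"] by (rule eventually_mono) (rule pairing_eq[OF \<Phi> \<Psi>])
  show "((\<lambda>t. pairing n e \<Phi> \<Psi> (?y t)) has_field_derivative 0) (at 0)"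
    using D0 DERIV_cong_ev[OF refl ev refl, of 0] by blast
qed

theorem pairing_constant:
  assumes \<Phi>: "\<Phi> \<in> Sol" and \<Psi>: "\<Psi> \<in> Sol_int" and "connected U"
  shows "pairing n e \<Phi> \<Psi> constant_on U"
proof (rule constant_if_partials_zero[OF open_U \<open>connected U\<close>])
  have minus: "holomorphic_several_on (\<lambda>x. F x - G x) U"
    if "holomorphic_several_on F U" "holomorphic_several_on G U" for F G :: "complex ^ 'a \<Rightarrow> complex"
    using holomorphic_several_add[OF that(1) holomorphic_several_mult[OF holomorphic_several_const[of
        "-1"] that(2)]] by simp
  show "holomorphic_several_on (pairing n e \<Phi> \<Psi>) U"
    unfolding pairing_def[abs_def] case_prod_beta
    by (intro minus holomorphic_several_mult holomorphic_several_sum holomorphic_several_const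
        holomorphic_several_coord
        solution_holomorphic[OF \<Phi>] solution_holomorphic[OF \<Psi>])
  show "partial_deriv k (pairing n e \<Phi> \<Psi>) x = 0" if "x \<in> U" for x k
    using pairing_partial[OF \<Phi> \<Psi> that] e_surj[of k] by metis
qed

end

section \<open>Explicit solutions\<close>

lemma additive_lattice:
  fixes \<mu> :: "int \<times> int \<Rightarrow> int"
  assumes "Modules.additive \<mu>"
  shows "\<mu> (a, b) = a * \<mu> (1, 0) + b * \<mu> (0, 1)"
proof -
  interpret Modules.additive \<mu> by fact
  have 1: "\<mu> (a, 0) = a * \<mu> (1, 0)" for a
  proof (induction a rule: int_induct[of _ 0])
    case base show ?case using zero by (simp add: zero_prod_def)
  next
    case (step1 i) then show ?case using add[of "(i, 0)" "(1, 0)"] by (simp add: algebra_simps)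
  next
    case (step2 i) then show ?case using diff[of "(i, 0)" "(1, 0)"] by (simp add: algebra_simps)
  qed
  have 2: "\<mu> (0, b) = b * \<mu> (0, 1)" for b
  proof (induction b rule: int_induct[of _ 0])
    case base show ?case using zero by (simp add: zero_prod_def)
  next
    case (step1 i) then show ?case using add[of "(0, i)" "(0, 1)"] by (simp add: algebra_simps)
  next
    case (step2 i) then show ?case using diff[of "(0, i)" "(0, 1)"] by (simp add: algebra_simps)
  qed
  show ?thesis using add[of "(a, 0)" "(0, b)"] 1[of a] 2[of b] by simp
qed

context gkz_locus
begin

text \<open>
  Families for which iterating \<open>\<partial>\<^sub>0\<close> solves the system. The condition on \<open>\<partial>\<^sub>i\<close> is modelled on
  \<open>\<integral> z\<^sup>k log f dz/z\<close>; the last one is homogeneity of degree \<open>0\<close>.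
\<close>

definition gkz_family :: "(nat \<Rightarrow> complex ^ 'm \<Rightarrow> complex) \<Rightarrow> bool" where
  "gkz_family H \<longleftrightarrow> (\<forall>k. smooth_on U (H k)) \<and>
     (\<forall>k. \<forall>i\<le>n. \<forall>x\<in>U. partial_deriv (e i) (H k) x
         = partial_deriv (e 0) (H (k + i)) x) \<and>
     (\<forall>k. \<forall>x\<in>U. (\<Sum>i\<le>n. x $ e i * partial_deriv (e i) (H k) x) = 0)"

definition tower :: "(nat \<Rightarrow> complex ^ 'm \<Rightarrow> complex) \<Rightarrow> nat \<Rightarrow> nat
    \<Rightarrow> complex ^ 'm \<Rightarrow> complex" where
  "tower H k l = (partial_deriv (e 0) ^^ l) (H k)"

lemma tower_0 [simp]: "tower H k 0 = H k"
  and tower_Suc: "tower H k (Suc l) = partial_deriv (e 0) (tower H k l)"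
  by (simp_all add: tower_def)

lemma gkz_familyD:
  assumes "gkz_family H"
  shows "smooth_on U (H k)"
    and "i \<le> n \<Longrightarrow> x \<in> U \<Longrightarrow>
        partial_deriv (e i) (H k) x = partial_deriv (e 0) (H (k + i)) x"
    and "x \<in> U \<Longrightarrow> (\<Sum>i\<le>n. x $ e i * partial_deriv (e i) (H k) x) = 0"
  using assms unfolding gkz_family_def by blast+

lemma tower_smooth: "gkz_family H \<Longrightarrow> smooth_on U (tower H k l)"
  by (induction l) (simp_all add: gkz_familyD(1) tower_Suc smooth_partial)

lemma tower_holomorphic: "gkz_family H \<Longrightarrow> holomorphic_several_on (tower H k l) U"
  using tower_smooth smooth_holomorphic by blast

text \<open>
  As \<open>\<partial>\<^sub>i\<close> commutes with \<open>\<partial>\<^sub>0\<close>, the shift of the index passes through the tower.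
\<close>

lemma tower_partial:
  assumes H: "gkz_family H" and i: "i \<le> n" and x: "x \<in> U"
  shows "partial_deriv (e i) (tower H k l) x = tower H (k + i) (Suc l) x"
  using x
proof (induction l arbitrary: x)
  case 0
  then show ?case using gkz_familyD(2)[OF H i] by (simp add: tower_Suc)
next
  case (Suc l)
  have "partial_deriv (e i) (tower H k (Suc l)) x = partial_deriv (e 0) (partial_deriv (e i) (tower H k l)) x"
    unfolding tower_Suc using tower_smooth[OF H]
    by (intro partial_deriv_commute[OF open_U Suc.prems] smooth_holomorphic smooth_partial)
  also have "\<dots> = partial_deriv (e 0) (tower H (k + i) (Suc l)) x"
    by (rule partial_deriv_cong[OF open_U Suc.prems Suc.IH])
  finally show ?case by (simp add: tower_Suc)
qed

lemma partial_deriv_weighted_sum: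
  assumes F: "\<And>i. i \<le> n \<Longrightarrow> holomorphic_several_on (F i) U" and x: "x \<in> U"
    and eq: "\<And>y. y \<in> U \<Longrightarrow> (\<Sum>i\<le>n. c i * y $ e i * F i y) = G y"
  shows "c 0 * F 0 x + (\<Sum>i\<le>n. c i * x $ e i * partial_deriv (e 0) (F i) x) = partial_deriv (e 0) G x"
proof -
  have hol: "holomorphic_several_on (\<lambda>y. c i * y $ e i) U" for i
    by (intro holomorphic_several_mult holomorphic_several_const holomorphic_several_coord)
  have part: "partial_deriv (e 0) (\<lambda>y. c i * y $ e i) x = (if i = 0 then c 0 else 0)" if "i \<le> n" for i
    using partial_deriv_mult[OF holomorphic_several_const holomorphic_several_coord x, of "e 0" "c i" "e i"] that
    by (simp add: partial_deriv_const partial_deriv_coord e_eq_iff)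
  have "partial_deriv (e 0) G x = partial_deriv (e 0) (\<lambda>y. \<Sum>i\<le>n. c i * y $ e i * F i y) x"
    by (rule partial_deriv_cong[OF open_U x]) (simp add: eq)
  also have "\<dots> = (\<Sum>i\<le>n. partial_deriv (e 0) (\<lambda>y. c i * y $ e i * F i y) x)"
    by (intro partial_deriv_sum[OF _ x] holomorphic_several_mult hol F) auto
  also have "\<dots> = (\<Sum>i\<le>n. (if i
      = 0 then c 0 * F 0 x else 0) + c i * x $ e i * partial_deriv (e 0) (F i) x)"
    by (rule sum.cong) (auto simp: partial_deriv_mult[OF hol F x] part)
  finally show ?thesis by (simp add: sum.distrib)
qed

text \<open>
  Each \<open>\<partial>\<^sub>0\<close> lowers the degree of homogeneity by one.
\<close>

lemma tower_euler:
  assumes H: "gkz_family H" and x: "x \<in> U"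
  shows "(\<Sum>i\<le>n. x $ e i * tower H (k + i) (Suc l) x) = - of_nat l * tower H k l x"
  using x
proof (induction l arbitrary: x)
  case 0
  have "tower H (k + i) (Suc 0) x = partial_deriv (e i) (H k) x" if "i \<le> n" for i
    using tower_partial[OF H that 0, of k 0] by simp
  then show ?case using gkz_familyD(3)[OF H 0, of k] by simp
next
  case (Suc l)
  have "1 * tower H (k + 0) (Suc l) x + (\<Sum>i\<le>n. 1 * x $ e i * partial_deriv (e 0) (tower H (k + i)
      (Suc l)) x)
      = partial_deriv (e 0) (\<lambda>y. - of_nat l * tower H k l y) x"
    by (rule partial_deriv_weighted_sum) (simp_all add: tower_holomorphic[OF H] Suc)
  also have "\<dots> = - of_nat l * tower H k (Suc l) x"
    using partial_deriv_mult[OF holomorphic_several_const tower_holomorphic[OF H] Suc.prems, of "e 0"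
        "- of_nat l" k l]
    by (simp add: partial_deriv_const tower_Suc)
  finally show ?case by (simp add: tower_Suc algebra_simps eq_neg_iff_add_eq_0)
qed

text \<open>
  The family \<open>D\<close> measures the failure of quasi-homogeneity; it contributes its own tower.
\<close>

lemma tower_weighted_euler:
  assumes H: "gkz_family H" and D: "gkz_family D" and x: "x \<in> U"
    and eq: "\<And>y. y \<in> U \<Longrightarrow> (\<Sum>i\<le>n. of_nat i * y $ e i * partial_deriv (e i)
        (H k) y) = - of_nat k * H k y - D k y"
  shows "(\<Sum>i\<le>n. of_nat i * x $ e i * tower H (k + i) (Suc l) x)
      = - of_nat k * tower H k l x - tower D k l x"
  using x
proof (induction l arbitrary: x)
  case 0
  have "tower H (k + i) (Suc 0) x = partial_deriv (e i) (H k) x" if "i \<le> n" for i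
    using tower_partial[OF H that 0, of k 0] by simp
  then show ?case using eq[OF 0] by simp
next
  case (Suc l)
  have "of_nat 0 * tower H (k + 0) (Suc l) x + (\<Sum>i\<le>n. of_nat i * x $ e i * partial_deriv (e 0) (tower H
      (k + i) (Suc l)) x)
      = partial_deriv (e 0) (\<lambda>y. - of_nat k * tower H k l y + (-1) * tower D k l y) x"
    by (rule partial_deriv_weighted_sum) (simp_all add: tower_holomorphic[OF H] Suc)
  also have "\<dots> = - of_nat k * tower H k (Suc l) x + (-1) * tower D k (Suc l) x"
    using partial_deriv_mult[OF holomorphic_several_const tower_holomorphic[OF H] Suc.prems, of "e 0"
        "- of_nat k" k l]
      partial_deriv_mult[OF holomorphic_several_const tower_holomorphic[OF D] Suc.prems, of "e 0" "-1" k l]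
      partial_deriv_add[OF holomorphic_several_mult[OF holomorphic_several_const tower_holomorphic[OF H]]
        holomorphic_several_mult[OF holomorphic_several_const tower_holomorphic[OF D]] Suc.prems, of "e 0"
            "- of_nat k" k l "-1" k l]
    by (simp add: partial_deriv_const tower_Suc)
  finally show ?case by (simp add: tower_Suc)
qed

definition tower_solution :: "(nat \<Rightarrow> complex ^ 'm \<Rightarrow> complex) \<Rightarrow>
    (int \<times> int) set \<Rightarrow> int \<times> int \<Rightarrow> complex ^ 'm \<Rightarrow> complex" where
  "tower_solution H K c x = (if c \<in> K \<and> x \<in> U then tower H (nat (fst c)) (nat (snd c)) x else 0)"

lemma level_tower_solution:
  "(int k, int l) \<in> K \<Longrightarrow> x \<in> U \<Longrightarrow>
      level (tower_solution H K) l x k = tower H k l x"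
  by (simp add: level_def tower_solution_def)

lemma tower_solution:
  assumes H: "gkz_family H"
    and nonneg: "\<And>c. c \<in> K \<Longrightarrow> 0 \<le> fst c \<and> 0 \<le> snd c"
    and closed: "\<And>c i. c \<in> K \<Longrightarrow> i \<le> n \<Longrightarrow> c + gen i \<in> K"
    and weighted: "\<And>k l x. (int k, int l) \<in> K \<Longrightarrow> x \<in> U \<Longrightarrow>
      (\<Sum>i\<le>n. of_nat i * x $ e i * tower H (k + i) (Suc l) x) = - of_nat k * tower H k l x"
  shows "tower_solution H K \<in> bbGKZ_solutions n e U K"
proof -
  have partial: "partial_deriv (e i) (tower_solution H K c) x = tower_solution H K (c + gen i) x"
    if c: "c \<in> K" "i \<le> n" "x \<in> U" for c i x
  proof -
    obtain k l where kl: "c = (int k, int l)"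
      using nonneg[OF c(1)] by (metis nonneg_int_cases prod.collapse)
    have next_point: "c + gen i = (int (k + i), int (Suc l))" by (simp add: kl gen_def)
    have "partial_deriv (e i) (tower_solution H K c) x = partial_deriv (e i) (tower H k l) x"
      by (rule partial_deriv_cong[OF open_U c(3)]) (use c(1) in \<open>simp add: tower_solution_def kl\<close>)
    also have "\<dots> = tower H (k + i) (Suc l) x" by (rule tower_partial[OF H c(2,3)])
    also have "\<dots> = tower_solution H K (c + gen i) x"
      using closed[OF c(1,2)] c(3) unfolding next_point tower_solution_def
          by (simp only: fst_conv snd_conv nat_int simp_thms if_True)
    finally show ?thesis .
  qed
  show ?thesis
    unfolding bbGKZ_solutions_def mem_Collect_eq
  proof (intro conjI ballI allI impI)
    show "tower_solution H K c x = 0" if "c \<notin> K \<or> x \<notin> U" for c x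
      using that by (auto simp: tower_solution_def)
    show "holomorphic_several_on (tower_solution H K c) U" if "c \<in> K" for c
      by (rule holomorphic_several_cong[OF open_U _ tower_holomorphic[OF H, of "nat (fst c)" "nat (snd c)"]])
        (simp add: tower_solution_def that)
    show "partial_deriv (e i) (tower_solution H K c) x = tower_solution H K (c + gen i) x"
      if "c \<in> K" "i \<le> n" "x \<in> U" for c i x by (rule partial[OF that])
    fix c x and \<mu> :: "int \<times> int \<Rightarrow> int"
    assume c: "c \<in> K" and \<mu>: "Modules.additive \<mu>" and x: "x \<in> U"
    obtain k l where kl: "c = (int k, int l)"
      using nonneg[OF c] by (metis nonneg_int_cases prod.collapse)
    let ?a = "of_int (\<mu> (1, 0)) :: complex" and ?b = "of_int (\<mu> (0, 1)) :: complex"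
    have \<mu>_eq: "of_int (\<mu> (p, q)) = of_int p * ?a + of_int q * ?b" for p q
      by (subst additive_lattice[OF \<mu>]) simp
    have "(\<Sum>i=0..n. of_int (\<mu> (gen i)) * x $ e i * partial_deriv (e i) (tower_solution H K c) x)
        = (\<Sum>i\<le>n. ?a * (of_nat i * x $ e i * tower H (k + i) (Suc l) x) + ?b * (x $ e i * tower H (k + i)
            (Suc l) x))"
      unfolding atLeast0AtMost
    proof (rule sum.cong[OF refl])
      fix i assume "i \<in> {..n}"
      then have i: "i \<le> n" by simp
      have next_point: "c + gen i = (int (k + i), int (Suc l))" by (simp add: kl gen_def)
      have "partial_deriv (e i) (tower_solution H K c) x = tower H (k + i) (Suc l) x"
        using partial[OF c i x] closed[OF c i] x
        unfolding next_point tower_solution_def by (simp only: fst_conv snd_conv nat_int simp_thms if_True)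
      moreover have "of_int (\<mu> (gen i)) = of_nat i * ?a + ?b"
        using \<mu>_eq[of "int i" 1] by (simp only: gen_def) simp
      ultimately show "of_int (\<mu> (gen i)) * x $ e i * partial_deriv (e i) (tower_solution H K c) x
          = ?a * (of_nat i * x $ e i * tower H (k + i) (Suc l) x) + ?b * (x $ e i * tower H (k + i) (Suc l) x)"
        by (simp only:) (simp add: algebra_simps)
    qed
    also have "\<dots> = ?a * (\<Sum>i\<le>n. of_nat i * x $ e i * tower H (k + i) (Suc l) x)
        + ?b * (\<Sum>i\<le>n. x $ e i * tower H (k + i) (Suc l) x)"
      by (simp only: sum.distrib sum_distrib_left)
    also have "\<dots> = ?a * (- of_nat k * tower H k l x) + ?b * (- of_nat l * tower H k l x)"
      using c unfolding kl by (simp only: weighted[OF _ x] tower_euler[OF H x])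
    also have "\<dots> = - (of_nat k * ?a + of_nat l * ?b) * tower H k l x"
      by (simp add: algebra_simps)
    finally have lhs: "(\<Sum>i=0..n. of_int (\<mu> (gen i)) * x $ e i * partial_deriv (e i)
        (tower_solution H K c) x)
        = - (of_nat k * ?a + of_nat l * ?b) * tower H k l x" .
    show "(\<Sum>i=0..n. of_int (\<mu> (gen i)) * x $ e i * partial_deriv (e i) (tower_solution H K c) x)
        + of_int (\<mu> c) * tower_solution H K c x = 0"
    proof -
      have "tower_solution H K c x = tower H k l x" using c x by (simp add: kl tower_solution_def)
      moreover have "of_int (\<mu> c) = of_nat k * ?a + of_nat l * ?b"
        using \<mu>_eq[of "int k" "int l"] unfolding kl by simp
      ultimately show ?thesis using lhs by (simp only:) (simp add: algebra_simps)
    qed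
  qed
qed

end

subsection \<open>The families\<close>

locale gkz_logs = gkz_roots +
  fixes L :: "nat \<Rightarrow> complex ^ 'a \<Rightarrow> complex"
  assumes L_continuous: "s < n \<Longrightarrow> continuous_on U (L s)"
    and exp_L: "s < n \<Longrightarrow> x \<in> U \<Longrightarrow> r s x = exp (L s x)"
begin

lemma r_nonzero: "s < n \<Longrightarrow> x \<in> U \<Longrightarrow> r s x \<noteq> 0"
  using exp_L by simp

lemma slp_nonzero: "s < n \<Longrightarrow> x \<in> U \<Longrightarrow> slp x s \<noteq> 0"
  using simple_roots.slope_nonzero[OF simple_roots_at] by simp

lemma slp_eq: "x \<in> U \<Longrightarrow> slp x s = (\<Sum>j\<le>n. of_nat j * (x $ e j * r s x ^ (j - 1)))"
proof -
  assume "x \<in> U"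
  then have "slp x s = poly (pderiv (fpoly x)) (r s x)" by (rule slp_def)
  then show ?thesis
    by (simp add: fpoly_def higher_pderiv_sum[of 1, simplified] pderiv_monom poly_sum poly_monom mult.assoc)
qed

lemma smooth_r:
  assumes s: "s < n"
  shows "smooth_on U (r s)"
  unfolding smooth_on_def
proof
  fix m show "smooth_upto m U (r s)"
  proof (induction m)
    case 0 show ?case using r_holomorphic[OF s] by simp
  next
    case (Suc m)
    show ?case
    proof (rule smooth_uptoI[OF open_U r_holomorphic[OF s]])
      fix k
      obtain i where i: "i \<le> n" "k = e i" by (rule e_surj)
      let ?S = "\<lambda>x. \<Sum>j\<le>n. of_nat j * (x $ e j * r s x ^ (j - 1))"
      let ?G = "\<lambda>x. (-1) * (r s x ^ i * inverse (?S x))"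
      have "smooth_upto m U ?G"
        by (intro smooth_upto_mult[OF open_U] smooth_upto_const[OF open_U] smooth_upto_power[OF open_U] Suc
            smooth_upto_inverse[OF open_U] smooth_upto_sum[OF open_U] smooth_upto_coord[OF open_U])
          (use slp_eq slp_nonzero[OF s] in metis)
      moreover have "\<forall>x\<in>U. partial_deriv k (r s) x = ?G x"
        using r_partial[OF s _ i(1)] by (simp add: i(2) slp_eq divide_inverse)
      ultimately show "\<exists>G. smooth_upto m U G \<and> (\<forall>x\<in>U. partial_deriv k (r s) x
          = G x)" by blast
    qed
  qed
qed

lemma L_holomorphic: "s < n \<Longrightarrow> holomorphic_several_on (L s) U"
  using log_holomorphic(1)[OF open_U r_holomorphic L_continuous exp_L] .

lemma L_partial: "s < n \<Longrightarrow> x \<in> U \<Longrightarrow>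
    partial_deriv k (L s) x = partial_deriv k (r s) x / r s x"
  using log_holomorphic(2)[OF open_U r_holomorphic L_continuous exp_L] .

lemma smooth_L:
  assumes s: "s < n"
  shows "smooth_on U (L s)"
  unfolding smooth_on_def
proof
  fix m
  show "smooth_upto m U (L s)"
  proof (cases m)
    case 0 then show ?thesis using L_holomorphic[OF s] by simp
  next
    case (Suc m')
    show ?thesis unfolding Suc
    proof (rule smooth_uptoI[OF open_U L_holomorphic[OF s]])
      fix k
      have "smooth_upto m' U (\<lambda>x. partial_deriv k (r s) x * inverse (r s x))"
        using smooth_r[OF s] smooth_partial[OF smooth_r[OF s]] r_nonzero[OF s]
        by (intro smooth_upto_mult[OF open_U] smooth_upto_inverse[OF open_U]) (auto simp: smooth_on_def)
      then show "\<exists>G. smooth_upto m' U G \<and> (\<forall>x\<in>U. partial_deriv k (L s) x = G x)"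
        using L_partial[OF s] by (auto simp: divide_inverse)
    qed
  qed
qed

definition root_family :: "nat \<Rightarrow> nat \<Rightarrow> complex ^ 'a \<Rightarrow> complex" where
  "root_family s k = (if k = 0 then L s else (\<lambda>x. inverse (of_nat k) * r s x ^ k))"

lemma smooth_root_family: "s < n \<Longrightarrow> smooth_on U (root_family s k)"
  by (simp add: root_family_def smooth_L smooth_on_mult[OF open_U] smooth_on_const[OF open_U]
      smooth_on_power[OF open_U] smooth_r)

lemma root_family_partial:
  assumes s: "s < n" and x: "x \<in> U" and i: "i \<le> n"
  shows "partial_deriv (e i) (root_family s k) x = - (r s x ^ (k + i) / (r s x * slp x s))"
proof (cases k)
  case 0
  then show ?thesis
    by (simp add: root_family_def L_partial[OF s x] r_partial[OF s x i])
next
  case (Suc j)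
  have "((\<lambda>z. inverse (of_nat k) * z ^ k) has_field_derivative r s x ^ j) (at (r s x))"
    by (rule derivative_eq_intros refl)+ (simp add: Suc del: of_nat_Suc)
  from partial_deriv_compose[OF r_holomorphic[OF s] this x, of "e i"]
  show ?thesis
    using r_nonzero[OF s x] by (simp add: root_family_def Suc r_partial[OF s x i] power_add)
qed

definition combination :: "(nat \<Rightarrow> complex) \<Rightarrow> nat \<Rightarrow> complex ^ 'a \<Rightarrow>
    complex" where
  "combination c k x = (\<Sum>s<n. c s * root_family s k x)"

lemma combination_partial:
  assumes x: "x \<in> U" and i: "i \<le> n"
  shows "partial_deriv (e i) (combination c k) x = (\<Sum>s<n. c s * - (r s x ^ (k + i) / (r s x * slp x s)))"
proof -
  have hol: "holomorphic_several_on (root_family s k) U" if "s < n" for s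
    using smooth_holomorphic[OF smooth_root_family[OF that]] .
  have "partial_deriv (e i) (\<lambda>x. c s * root_family s k x) x
      = c s * - (r s x ^ (k + i) / (r s x * slp x s))" if "s < n" for s
    using partial_deriv_mult[OF holomorphic_several_const hol[OF that] x, of "e i" "c s"]
    by (simp add: partial_deriv_const root_family_partial[OF that x i])
  then show ?thesis
    unfolding combination_def[abs_def]
    by (subst partial_deriv_sum[OF _ x]) (auto intro!: holomorphic_several_mult holomorphic_several_const hol)
qed

lemma euler_root_terms:
  assumes s: "s < n" and x: "x \<in> U"
  shows "(\<Sum>i\<le>n. x $ e i * (r s x ^ (k + i) / (r s x * slp x s))) = 0"
    and "(\<Sum>i\<le>n. of_nat i * x $ e i * (r s x ^ (k + i) / (r s x * slp x s))) = r s x ^ k"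
proof -
  have "(\<Sum>i\<le>n. x $ e i * (r s x ^ (k + i) / (r s x * slp x s)))
      = r s x ^ k / (r s x * slp x s) * poly (fpoly x) (r s x)"
    by (simp add: poly_fpoly sum_distrib_left sum_divide_distrib power_add mult_ac)
  then show "(\<Sum>i\<le>n. x $ e i * (r s x ^ (k + i) / (r s x * slp x s))) = 0" by (simp add: r_root[OF s x])
  have "(\<Sum>i\<le>n. of_nat i * x $ e i * (r s x ^ (k + i) / (r s x * slp x s)))
      = r s x ^ k / (r s x * slp x s) * poly (theta (fpoly x)) (r s x)"
    using degree_theta[of "fpoly x"] degree_fpoly[OF x]
    by (simp add: lin_power[symmetric] lin_bound[of _ n] coeff_fpoly sum_distrib_left sum_divide_distrib power_add
        mult_ac)
  also have "\<dots> = r s x ^ k"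
    using r_nonzero[OF s x] slp_nonzero[OF s x] by (simp add: poly_theta slp_def[OF x])
  finally show "(\<Sum>i\<le>n. of_nat i * x $ e i * (r s x ^ (k + i) / (r s x * slp x s))) = r s x ^ k" .
qed

lemma euler_sums:
  assumes x: "x \<in> U"
    and partial: "\<And>i. i \<le> n \<Longrightarrow> partial_deriv (e i) F x
        = (\<Sum>s<n. w s * - (r s x ^ (k + i) / (r s x * slp x s)))"
  shows "(\<Sum>i\<le>n. x $ e i * partial_deriv (e i) F x) = 0"
    and "(\<Sum>i\<le>n. of_nat i * x $ e i * partial_deriv (e i) F x) = (\<Sum>s<n. - w s * r s x ^ k)"
proof -
  have swap: "(\<Sum>i\<le>n. a i * partial_deriv (e i) F x)
      = (\<Sum>s<n. - w s * (\<Sum>i\<le>n. a i * (r s x ^ (k + i) / (r s x * slp x s))))" for a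
  proof -
    have "(\<Sum>i\<le>n. a i * partial_deriv (e i) F x)
        = (\<Sum>i\<le>n. \<Sum>s<n. - w s * (a i * (r s x ^ (k + i) / (r s x * slp x s))))"
      by (rule sum.cong) (simp_all add: partial sum_distrib_left mult_ac)
    then show ?thesis by (subst (asm) sum.swap) (simp add: sum_distrib_left)
  qed
  show "(\<Sum>i\<le>n. x $ e i * partial_deriv (e i) F x) = 0"
    unfolding swap using euler_root_terms(1)[OF _ x] by simp
  show "(\<Sum>i\<le>n. of_nat i * x $ e i * partial_deriv (e i) F x) = (\<Sum>s<n. - w s * r s x ^ k)"
    unfolding swap using euler_root_terms(2)[OF _ x] by simp
qed

lemma combination_gkz_family: "gkz_family (combination c)"
  unfolding gkz_family_def
proof (intro conjI allI ballI impI)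
  show "smooth_on U (combination c k)" for k
    unfolding combination_def[abs_def]
    by (intro smooth_on_sum[OF open_U] smooth_on_mult[OF open_U] smooth_on_const[OF open_U] smooth_root_family) simp
  show "partial_deriv (e i) (combination c k) x = partial_deriv (e 0) (combination c (k + i)) x"
    if "i \<le> n" "x \<in> U" for k i x using that by (simp add: combination_partial)
  show "(\<Sum>i\<le>n. x $ e i * partial_deriv (e i) (combination c k) x) = 0" if "x \<in> U" for k x
    by (rule euler_sums(1)[OF that combination_partial[OF that]])
qed

definition constant_family :: "complex \<Rightarrow> nat \<Rightarrow> complex ^ 'a \<Rightarrow> complex" where
  "constant_family a k x = (if k = 0 then a else 0)"

lemma constant_family_partial: "partial_deriv j (constant_family a k) = (\<lambda>x. 0)"
  unfolding constant_family_def[abs_def] by (rule partial_deriv_const)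

lemma constant_gkz_family: "gkz_family (constant_family a)"
  unfolding gkz_family_def constant_family_partial
  using smooth_on_const[OF open_U] by (simp add: constant_family_def[abs_def])

lemma tower_constant_family: "tower (constant_family a) k l x = (if k = 0 \<and> l = 0 then a else 0)"
proof (induction l)
  case (Suc l)
  have "tower (constant_family a) k (Suc l) = (\<lambda>x. 0)" for k
    by (induction l) (simp_all add: tower_Suc constant_family_partial partial_deriv_const)
  then show ?case by simp
qed (simp add: constant_family_def)

text \<open>
  The defect at \<open>k = 0\<close> comes from \<open>log r\<^sub>s\<close>, which is not homogeneous for the grading
  by the exponent. This is why coefficients with sum \<open>0\<close> are needed on the closed cone.
\<close>

lemma combination_weighted_euler:
  assumes x: "x \<in> U"
  shows "(\<Sum>i\<le>n. of_nat i * x $ e i * partial_deriv (e i) (combination c k) x)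
    = - of_nat k * combination c k x - constant_family (\<Sum>s<n. c s) k x"
proof -
  have "(\<Sum>i\<le>n. of_nat i * x $ e i * partial_deriv (e i) (combination c k) x)
      = (\<Sum>s<n. - c s * r s x ^ k)"
    by (rule euler_sums(2)[OF x combination_partial[OF x]])
  also have "\<dots> = - of_nat k * combination c k x - constant_family (\<Sum>s<n. c s) k x"
    unfolding combination_def sum_distrib_left
    by (cases "k = 0") (auto simp: constant_family_def root_family_def sum_negf intro!: sum.cong)
  finally show ?thesis .
qed

lemma combination_tower_weighted_euler:
  assumes x: "x \<in> U" and "k > 0 \<or> l > 0 \<or> (\<Sum>s<n. c s) = 0"
  shows "(\<Sum>i\<le>n. of_nat i * x $ e i * tower (combination c) (k + i) (Suc l) x)
      = - of_nat k * tower (combination c) k l x"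
  using tower_weighted_euler[OF combination_gkz_family constant_gkz_family x combination_weighted_euler, of c k l]
      assms(2)
  by (auto simp: tower_constant_family)

lemma tower_combination_one:
  "x \<in> U \<Longrightarrow> tower (combination c) k (Suc 0) x
      = - (\<Sum>s<n. c s / (r s x * slp x s) * r s x ^ k)"
  by (simp add: tower_Suc combination_partial sum_negf mult.commute)

lemma tower_all_roots_one:
  assumes x: "x \<in> U"
  shows "tower (combination (\<lambda>s. 1)) 0 (Suc 0) x = 1 / x $ e 0"
    and "0 < k \<Longrightarrow> k < n \<Longrightarrow> tower (combination (\<lambda>s. 1)) k (Suc 0) x = 0"
    and "tower (combination (\<lambda>s. 1)) n (Suc 0) x = - 1 / x $ e n"
proof -
  interpret R: simple_roots n "fpoly x" "\<lambda>s. r s x" by (rule simple_roots_at[OF x])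
  have *: "tower (combination (\<lambda>s. 1)) k (Suc 0) x = - (\<Sum>s<n. r s x ^ (k - 1) / slp x s)"
      if "k > 0" for k
    unfolding tower_combination_one[OF x]
    by (intro arg_cong[of _ _ uminus] sum.cong refl)
        (use that in \<open>auto simp: r_nonzero[OF _ x] power_eq_if\<close>)
  show "tower (combination (\<lambda>s. 1)) 0 (Suc 0) x = 1 / x $ e 0"
    unfolding tower_combination_one[OF x] using R.inverse_sum_over_slopes by (simp add: coeff_fpoly)
  show "tower (combination (\<lambda>s. 1)) k (Suc 0) x = 0" if "0 < k" "k < n"
    using R.power_sum_over_slopes[of "k - 1"] that by (simp add: *)
  show "tower (combination (\<lambda>s. 1)) n (Suc 0) x = - 1 / x $ e n"
    using R.power_sum_over_slopes[of "n - 1"] n_pos by (simp add: * coeff_fpoly)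
qed

text \<open>
  The power sums \<open>\<Sum>\<^sub>s r\<^sub>s\<^sup>k\<close> are polynomials in \<open>x\<^sub>0\<close> of degree at most \<open>k / n\<close>
  (with coefficients depending on the other \<open>x\<^sub>i\<close>). Here this is obtained from
  \<open>l = 1\<close> and \<open>l = 2\<close>, where the sums at the boundary points \<open>(0, 1)\<close> and \<open>(n, 1)\<close> are \<open>1 / x\<^sub>0\<close> and
  \<open>- 1 / x\<^sub>n\<close>.
\<close>

lemma tower_all_roots_vanishes:
  assumes "x \<in> U" "0 < k" "k < n * l"
  shows "tower (combination (\<lambda>s. 1)) k l x = 0"
  using assms
proof (induction l arbitrary: k x)
  case (Suc l)
  let ?T = "tower (combination (\<lambda>s. 1))"
  have step: "?T (k' + i) (Suc l') x = 0"
    if "i \<le> n" "\<And>y. y \<in> U \<Longrightarrow> ?T k' l' y = G y" "partial_deriv (e i) G x = 0"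
        for i k' l' G
    using tower_partial[OF combination_gkz_family that(1) Suc.prems(1), of "\<lambda>s. 1" k' l']
      partial_deriv_cong[OF open_U Suc.prems(1) that(2)] that(3) by simp
  have inv: "partial_deriv (e i) (\<lambda>y. a * inverse (y $ e j)) x = 0"
      if "i \<le> n" "j \<le> n" "i \<noteq> j" "x $ e j \<noteq> 0" for i j a
  proof (rule partial_derivI)
    have "(\<lambda>t. a * inverse ((x + axis (e i) t) $ e j)) = (\<lambda>t. a * inverse (x $ e j))"
      using that by (auto simp: axis_def e_eq_iff)
    then show "((\<lambda>t. a * inverse ((x + axis (e i) t) $ e j)) has_field_derivative 0) (at 0)" by simp
  qed
  consider "l = 0" | "l = 1" "k \<le> n" | "l = 1" "k > n" | "l > 1" by linarith
  then show ?case
  proof cases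
    case 1
    then show ?thesis using Suc.prems tower_all_roots_one(2) by simp
  next
    case 2
    have "?T (0 + k) (Suc l) x = 0"
    proof (rule step[where G = "\<lambda>y. 1 * inverse (y $ e 0)"])
      show "partial_deriv (e k) (\<lambda>y. 1 * inverse (y $ e 0)) x = 0"
        using 2 Suc.prems coordinates_nonzero by (intro inv) auto
    qed (use 2 tower_all_roots_one(1) in \<open>auto simp: divide_inverse\<close>)
    then show ?thesis by simp
  next
    case 3
    have "?T (n + (k - n)) (Suc l) x = 0"
    proof (rule step[where G = "\<lambda>y. (-1) * inverse (y $ e n)"])
      show "partial_deriv (e (k - n)) (\<lambda>y. (-1) * inverse (y $ e n)) x = 0"
        using 3 Suc.prems coordinates_nonzero by (intro inv) auto
    qed (use 3 Suc.prems tower_all_roots_one(3) in \<open>auto simp: divide_inverse\<close>)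
    then show ?thesis using 3 by simp
  next
    case 4
    show ?thesis
    proof (cases "k < n * l")
      case True
      have "?T (k + 0) (Suc l) x = 0"
        by (rule step[where G = "\<lambda>y. 0"]) (use Suc True in \<open>auto simp: partial_deriv_const\<close>)
      then show ?thesis by simp
    next
      case False
      have "n * 2 \<le> n * l" using 4 by (intro mult_le_mono2) simp
      then have "n < k" using False n_pos by linarith
      have "?T ((k - n) + n) (Suc l) x = 0"
        by (rule step[where G = "\<lambda>y. 0"]) (use Suc \<open>n
            < k\<close> in \<open>auto simp: partial_deriv_const\<close>)
      then show ?thesis using \<open>n < k\<close> by simp
    qed
  qed
qed simp

text \<open>
  Integrating \<open>log r\<^sub>s\<close> against the derivatives of \<open>root_family\<close>. In the interior of the cone this yields,
  up to constant factors and residues at the roots, the integrals \<open>\<integral> z\<^sup>k / f\<^sup>l dz/z\<close> from \<open>0\<close> to \<open>\<infinity>\<close>.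
\<close>

definition log_family :: "nat \<Rightarrow> complex ^ 'a \<Rightarrow> complex" where
  "log_family k x = (\<Sum>s<n. if k = 0 then 1 / 2 * (L s x * L s x)
     else L s x * root_family s k x + - inverse (of_nat k) * root_family s k x)"

lemma log_family_term:
  fixes k s
  defines "G \<equiv> (\<lambda>x. if k = 0 then 1 / 2 * (L s x * L s x)
     else L s x * root_family s k x + - inverse (of_nat k) * root_family s k x)"
  assumes s: "s < n"
  shows "smooth_on U G"
    and "x \<in> U \<Longrightarrow> i \<le> n \<Longrightarrow>
        partial_deriv (e i) G x = L s x * - (r s x ^ (k + i) / (r s x * slp x s))"
proof -
  note hol = smooth_holomorphic[OF smooth_root_family[OF s]] L_holomorphic[OF s] holomorphic_several_const
  have G: "G = (if k = 0 then (\<lambda>x. 1 / 2 * (L s x * L s x))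
     else (\<lambda>x. L s x * root_family s k x + - inverse (of_nat k) * root_family s k x))"
    by (auto simp: G_def)
  show "smooth_on U G"
  proof (cases "k = 0")
    case True
    show ?thesis unfolding G if_P[OF True]
      by (intro smooth_on_mult[OF open_U] smooth_on_const[OF open_U] smooth_L[OF s])
  next
    case False
    show ?thesis unfolding G if_not_P[OF False]
      by (intro smooth_on_add[OF open_U] smooth_on_mult[OF open_U] smooth_on_const[OF open_U] smooth_L[OF s]
          smooth_root_family[OF s])
  qed
  assume x: "x \<in> U" and i: "i \<le> n"
  have L': "partial_deriv (e i) (L s) x = - (r s x ^ i / (r s x * slp x s))"
    using root_family_partial[OF s x i, of 0] by (simp add: root_family_def)
  show "partial_deriv (e i) G x = L s x * - (r s x ^ (k + i) / (r s x * slp x s))"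
  proof (cases "k = 0")
    case True
    then show ?thesis
      unfolding G using partial_deriv_mult[OF hol(3) holomorphic_several_mult[OF hol(2,2)] x, of "e i" "1/2"]
      by (simp add: partial_deriv_mult[OF hol(2,2) x] partial_deriv_const L' mult.commute)
  next
    case False
    then have "partial_deriv (e i) G x = partial_deriv (e i) (L s) x * root_family s k x + L s x * partial_deriv
        (e i) (root_family s k) x
        + - inverse (of_nat k) * partial_deriv (e i) (root_family s k) x"
      unfolding G using partial_deriv_add[OF holomorphic_several_mult[OF hol(2,1)] holomorphic_several_mult[OF
          hol(3,1)] x, of "e i" k "- inverse (of_nat k)" k]
        partial_deriv_mult[OF hol(3,1) x, of "e i" "- inverse (of_nat k)" k]
      by (simp add: partial_deriv_mult[OF hol(2,1) x] partial_deriv_const)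
    then show ?thesis using False
      by (simp add: L' root_family_partial[OF s x i]) (simp add: root_family_def power_add)
  qed
qed

lemma log_family_partial:
  assumes x: "x \<in> U" and i: "i \<le> n"
  shows "partial_deriv (e i) (log_family k) x = (\<Sum>s<n. L s x * - (r s x ^ (k + i) / (r s x * slp x s)))"
  unfolding log_family_def[abs_def]
  using smooth_holomorphic[OF log_family_term(1)] log_family_term(2)[OF _ x i]
  by (subst partial_deriv_sum[OF _ x]) auto

lemma log_gkz_family: "gkz_family log_family"
  unfolding gkz_family_def
proof (intro conjI allI ballI impI)
  show "smooth_on U (log_family k)" for k
    unfolding log_family_def[abs_def] by (intro smooth_on_sum[OF open_U] log_family_term(1)) simp
  show "partial_deriv (e i) (log_family k) x = partial_deriv (e 0) (log_family (k + i)) x"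
    if "i \<le> n" "x \<in> U" for k i x using that by (simp add: log_family_partial)
  show "(\<Sum>i\<le>n. x $ e i * partial_deriv (e i) (log_family k) x) = 0" if "x \<in> U" for k x
    by (rule euler_sums(1)[OF that log_family_partial[OF that]])
qed

lemma log_family_weighted_euler:
  assumes x: "x \<in> U" and k: "k > 0"
  shows "(\<Sum>i\<le>n. of_nat i * x $ e i * partial_deriv (e i) (log_family k) x)
    = - of_nat k * log_family k x - combination (\<lambda>s. 1) k x"
proof -
  have "(\<Sum>i\<le>n. of_nat i * x $ e i * partial_deriv (e i) (log_family k) x)
      = (\<Sum>s<n. - L s x * r s x ^ k)"
    by (rule euler_sums(2)[OF x log_family_partial[OF x]])
  also have "\<dots> = - of_nat k * log_family k x - combination (\<lambda>s. 1) k x"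
    unfolding log_family_def combination_def sum_distrib_left sum_subtractf[symmetric]
    by (rule sum.cong) (use k in \<open>auto simp: root_family_def field_simps\<close>)
  finally show ?thesis .
qed

lemma log_tower_weighted_euler:
  assumes x: "x \<in> U" and k: "k > 0"
  shows "(\<Sum>i\<le>n. of_nat i * x $ e i * tower log_family (k + i) (Suc l) x)
    = - of_nat k * tower log_family k l x - tower (combination (\<lambda>s. 1)) k l x"
  by (rule tower_weighted_euler[OF log_gkz_family combination_gkz_family x log_family_weighted_euler[OF _ k]])

end

section \<open>Non-degeneracy\<close>

context gkz_locus
begin

lemma solution_step_zero:
  assumes sol: "\<Phi> \<in> bbGKZ_solutions n e U K" and c: "c \<in> K" "i \<le> n" and zero:
      "\<And>x. x \<in> U \<Longrightarrow> \<Phi> c x = 0"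
    and x: "x \<in> U"
  shows "\<Phi> (c + gen i) x = 0"
proof -
  have "partial_deriv (e i) (\<Phi> c) x = partial_deriv (e i) (\<lambda>_. 0) x"
    by (rule partial_deriv_cong[OF open_U x zero])
  then show ?thesis using solution_partial[OF sol c(1) x c(2)] by (simp add: partial_deriv_const)
qed

lemma solution_zeroI:
  assumes sol: "\<Phi> \<in> bbGKZ_solutions n e U K"
    and nonneg: "\<And>c. c \<in> K \<Longrightarrow> 0 \<le> fst c \<and> 0 \<le> snd c"
    and zero: "\<And>k l x. (int k, int l) \<in> K \<Longrightarrow> x \<in> U \<Longrightarrow>
        level \<Phi> l x k = 0"
  shows "\<Phi> = 0"
proof (intro ext)
  fix c x
  show "\<Phi> c x = 0 c x"
  proof (cases "c \<in> K \<and> x \<in> U")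
    case True
    moreover from this obtain k l where "c = (int k, int l)"
      using nonneg by (metis nonneg_int_cases prod.collapse)
    ultimately show ?thesis using zero[of k l x] by (simp add: level_def)
  next
    case False
    then have "\<Phi> c x = 0" using sol unfolding bbGKZ_solutions_def by blast
    then show ?thesis by simp
  qed
qed

end

context gkz_logs
begin

lemma closed_nonneg: "c \<in> closed_points \<Longrightarrow> 0 \<le> fst c \<and> 0 \<le> snd c"
proof -
  assume "c \<in> closed_points"
  then have c: "0 \<le> fst c" "fst c \<le> int n * snd c"
    using cone_point_iff[OF n_pos, of "fst c" "snd c"] by simp_all
  then have "0 \<le> int n * snd c" by linarith
  then show ?thesis using c n_pos by (simp add: zero_le_mult_iff)
qed

lemma interior_nonneg: "c \<in> interior_points \<Longrightarrow> 0 \<le> fst c \<and> 0 \<le> snd c"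
proof -
  assume "c \<in> interior_points"
  then have c: "0 < fst c" "fst c < int n * snd c"
    using interior_point_iff[OF n_pos, of "fst c" "snd c"] by simp_all
  then have "0 \<le> int n * snd c" by linarith
  then show ?thesis using c n_pos by (simp add: zero_le_mult_iff)
qed

lemma closed_step: "c \<in> closed_points \<Longrightarrow> i \<le> n \<Longrightarrow>
    c + gen i \<in> closed_points"
  using cone_point_iff[OF n_pos, of "fst c" "snd c"] cone_point_iff[OF n_pos, of "fst c + int i" "snd c + 1"]
  by (cases c) (auto simp: gen_def distrib_left)

lemma interior_step: "c \<in> interior_points \<Longrightarrow> i \<le> n \<Longrightarrow>
    c + gen i \<in> interior_points"
  using interior_point_iff[OF n_pos, of "fst c" "snd c"] interior_point_iff[OF n_pos, of "fst c + int i"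
      "snd c + 1"]
  by (cases c) (auto simp: gen_def distrib_left)

lemma constant_solution: "tower_solution (constant_family 1) closed_points \<in> Sol"
  by (rule tower_solution[OF constant_gkz_family closed_nonneg closed_step]) (auto simp: tower_constant_family)

lemma combination_solution:
  assumes "(\<Sum>s<n. c s) = 0"
  shows "tower_solution (combination c) closed_points \<in> Sol"
  by (rule tower_solution[OF combination_gkz_family closed_nonneg closed_step])
    (use assms in \<open>auto simp: combination_tower_weighted_euler\<close>)

lemma combination_interior_solution: "tower_solution (combination c) interior_points \<in> Sol_int"
  by (rule tower_solution[OF combination_gkz_family interior_nonneg interior_step])
    (auto simp: combination_tower_weighted_euler interior_iff)

lemma log_interior_solution: "tower_solution log_family interior_points \<in> Sol_int"
  by (rule tower_solution[OF log_gkz_family interior_nonneg interior_step])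
    (auto simp: log_tower_weighted_euler interior_iff tower_all_roots_vanishes)

lemma lin_tower_combination:
  assumes x: "x \<in> U"
  shows "lin (\<lambda>k. tower (combination c) k (Suc 0) x) g
      = - (\<Sum>s<n. c s / (r s x * slp x s) * poly g (r s x))"
proof -
  have "lin (\<lambda>k. tower (combination c) k (Suc 0) x) g
      = lin (\<lambda>k. \<Sum>s<n. - (c s / (r s x * slp x s)) * r s x ^ k) g"
    by (simp add: tower_combination_one[OF x] sum_negf)
  then show ?thesis unfolding lin_sum_left lin_power by (simp add: sum_negf)
qed

lemma poly_cof_root:
  assumes x: "x \<in> U" and "s < n" "t < n"
  shows "poly (cof x s) (r t x) = (if t = s then slp x s else 0)"
  using simple_roots.poly_cofactor_self[OF simple_roots_at[OF x]] simple_roots.poly_cofactor_other[OF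
      simple_roots_at[OF x]] assms(2,3)
  by auto

lemma weight_combination:
  assumes c: "(\<Sum>s<n. c s) = 0" and x: "x \<in> U" and s: "s < n"
  shows "weight (tower_solution (combination c) closed_points) s x = c s"
proof -
  interpret R: simple_roots n "fpoly x" "\<lambda>s. r s x" by (rule simple_roots_at[OF x])
  have "lin (level (tower_solution (combination c) closed_points) (Suc 0) x) (cof x s)
      = lin (\<lambda>k. tower (combination c) k (Suc 0) x) (cof x s)"
  proof (rule lin_cong)
    fix k assume "coeff (cof x s) k \<noteq> 0"
    then have "k \<le> n * 1" using le_degree R.degree_cofactor[of s] by fastforce
    then show "level (tower_solution (combination c) closed_points) (Suc 0) x k = tower (combination c) k (Suc 0) x"
      using x by (intro level_tower_solution) (subst closed_iff, simp)
  qed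
  also have "\<dots> = - (\<Sum>t<n. if t = s then c s / r s x else 0)"
    unfolding lin_tower_combination[OF x]
    by (intro arg_cong[of _ _ uminus] sum.cong refl)
        (use s x in \<open>auto simp: poly_cof_root slp_nonzero\<close>)
  finally show ?thesis using s r_nonzero[OF s x] by (simp add: weight_def)
qed

lemma weight_constant:
  assumes x: "x \<in> U" and s: "s < n"
  shows "weight (tower_solution (constant_family a) closed_points) s x = 0"
proof -
  have "level (tower_solution (constant_family a) closed_points) 1 x k = 0" for k
    by (simp add: level_def tower_solution_def tower_constant_family)
  then have "lin (level (tower_solution (constant_family a) closed_points) 1 x) g = 0" for g
    by (simp only: lin_def mult_zero_right sum.neutral_const)
  then show ?thesis by (simp add: weight_def)
qed

text \<open>
  The tower of a combination of roots satisfies the relations on all points with \<open>k \<ge> 0\<close> and \<open>l \<ge> 1\<close>, not only in the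
  interior. So \<open>\<Psi>\<^sub>2\<close> may be applied to \<open>f \<theta>\<^sup>2f\<close> and \<open>(\<theta>f)\<^sup>2\<close> separately, with the same result \<open>- \<Psi>\<^sub>1(\<theta>\<^sup>2f)\<close>.
\<close>

lemma log_part_combination:
  assumes x: "x \<in> U"
  shows "log_part (tower_solution (combination c) interior_points) x = 0"
proof -
  let ?K = "{p :: int \<times> int. 0 \<le> fst p \<and> 1 \<le> snd p}" and ?f = "fpoly x"
  let ?\<Psi> = "tower_solution (combination c) ?K"
  have sol: "?\<Psi> \<in> bbGKZ_solutions n e U ?K"
    by (rule tower_solution[OF combination_gkz_family]) (auto simp: combination_tower_weighted_euler gen_def)
  have "log_part (tower_solution (combination c) interior_points) x
      = lin (level ?\<Psi> 2 x) (?f * theta (theta ?f) - theta ?f * theta ?f)"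
    unfolding log_part_def
  proof (rule lin_cong)
    fix k assume "coeff (?f * theta (theta ?f) - theta ?f * theta ?f) k \<noteq> 0"
    from theta_square_support[OF eq_refl[OF degree_fpoly[OF x]] this] have "0 < k" "k < n * 2"
      by simp_all
    then have "(int k, int 2) \<in> interior_points" by (subst interior_iff) simp
    moreover have "(int k, int 2) \<in> ?K" by simp
    ultimately show "level (tower_solution (combination c) interior_points) 2 x k = level ?\<Psi> 2 x k"
      using level_tower_solution x by metis
  qed
  also have "\<dots> = 0"
    using lin_solution_mult[OF sol x, of _ 1] by (simp add: lin_diff numeral_2_eq_2)
  finally show ?thesis .
qed

text \<open>
  Only the difference between the roots matters: the second summand is independent of \<open>s\<close>. It comes from the
  constant term of \<open>r\<^sub>s l\<^sub>s\<close>, on which interior solutions vanish by convention.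
\<close>

lemma period_combination:
  assumes x: "x \<in> U" and s: "s < n"
  shows "period (tower_solution (combination c) interior_points) s x
    = - c s - x $ e 0 * (\<Sum>t<n. c t / (r t x * slp x t))"
proof -
  interpret R: simple_roots n "fpoly x" "\<lambda>s. r s x" by (rule simple_roots_at[OF x])
  let ?\<Psi> = "tower_solution (combination c) interior_points" and ?l = "smult (r s x) (cof x s)"
  define g where "g = ?l - monom (coeff ?l 0) 0"
  have l0: "coeff ?l 0 = - x $ e 0"
    using R.coeff_cofactor_0[OF s] r_nonzero[OF s x] by (simp add: coeff_fpoly)
  have "level ?\<Psi> 1 x 0 = 0"
    using interior_iff[of 0 1] by (simp add: level_def tower_solution_def)
  then have "period ?\<Psi> s x = lin (level ?\<Psi> (Suc 0) x) g"
    by (simp add: period_def g_def lin_diff lin_monom)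
  also have "\<dots> = lin (\<lambda>k. tower (combination c) k (Suc 0) x) g"
  proof (rule lin_cong)
    fix k assume k: "coeff g k \<noteq> 0"
    then have "k \<noteq> 0" by (cases "k = 0") (simp_all add: g_def)
    moreover from this k have "coeff (cof x s) k \<noteq> 0" by (auto simp: g_def)
    then have "k \<le> n - 1" using le_degree R.degree_cofactor[of s] by fastforce
    ultimately have "(int k, int 1) \<in> interior_points" using n_pos by (subst interior_iff) auto
    then show "level ?\<Psi> (Suc 0) x k = tower (combination c) k (Suc 0) x"
      using level_tower_solution[of k 1] x by simp
  qed
  also have "\<dots> = - (\<Sum>t<n. (if t = s then c s else 0) + x $ e 0 * (c t / (r t x * slp x t)))"
    unfolding lin_tower_combination[OF x] g_def l0
    by (intro arg_cong[of _ _ uminus] sum.cong refl)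
      (use s x in \<open>auto simp: poly_cof_root poly_monom slp_nonzero r_nonzero field_simps\<close>)
  finally show ?thesis using s by (simp add: sum.distrib sum_distrib_left)
qed

text \<open>
  Here \<open>f \<theta>\<^sup>2f\<close> and \<open>(\<theta>f)\<^sup>2\<close> are treated separately as for \<open>log_part_combination\<close>, but their boundary
  terms no longer agree: the defect of the log family at the point \<open>(n, 1)\<close> remains and gives \<open>- n\<close>.
\<close>

lemma log_part_log_solution:
  assumes x: "x \<in> U"
  shows "log_part (tower_solution log_family interior_points) x = - of_nat n"
proof -
  let ?f = "fpoly x"
  let ?A = "\<lambda>l k. tower log_family k l x"
  have deg: "degree ?f \<le> n" "degree (theta ?f) \<le> n" using degree_fpoly[OF x] degree_theta[of ?f] by auto
  have "log_part (tower_solution log_family interior_points) x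
      = lin (?A 2) (?f * theta (theta ?f) - theta ?f * theta ?f)"
    unfolding log_part_def
  proof (rule lin_cong)
    fix k assume "coeff (?f * theta (theta ?f) - theta ?f * theta ?f) k \<noteq> 0"
    from theta_square_support[OF deg(1) this] have "(int k, int 2) \<in> interior_points"
      by (subst interior_iff) simp
    then show "level (tower_solution log_family interior_points) 2 x k = ?A 2 k"
      using level_tower_solution x by metis
  qed
  moreover have "lin (?A 2) (?f * theta (theta ?f)) = - lin (?A 1) (theta (theta ?f))"
  proof -
    have d: "degree (theta (theta ?f)) \<le> n" using deg degree_theta[of "theta ?f"] by simp
    have "lin (?A 2) (?f * theta (theta ?f))
        = (\<Sum>k\<le>n. coeff (theta (theta ?f)) k * (\<Sum>i\<le>n. x $ e i * tower log_family (k + i)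
            (Suc 1) x))"
      by (simp add: lin_mult_expand[OF d] lin_mult_monom[OF deg(1)] coeff_fpoly numeral_2_eq_2)
    also have "\<dots> = - lin (?A 1) (theta (theta ?f))"
      by (simp only: tower_euler[OF log_gkz_family x] lin_bound[OF d]) (simp add: sum_negf)
    finally show ?thesis .
  qed
  moreover have "lin (?A 2) (theta ?f * theta ?f) = - lin (?A 1) (theta (theta ?f)) + of_nat n"
  proof -
    let ?D = "\<lambda>k. tower (combination (\<lambda>s. 1)) k 1 x"
    have "lin (?A 2) (theta ?f * theta ?f)
        = (\<Sum>k\<le>n. coeff (theta ?f) k * (\<Sum>i\<le>n. of_nat i * x $ e i * tower log_family (k + i)
            (Suc 1) x))"
      by (simp add: lin_mult_expand[OF deg(2)] lin_mult_monom[OF deg(2)] coeff_fpoly numeral_2_eq_2)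
    also have "\<dots> = (\<Sum>k\<le>n. - (coeff (theta (theta ?f)) k * ?A 1 k) - (if k
        = n then coeff (theta ?f) n * ?D n else 0))"
    proof (rule sum.cong[OF refl])
      fix k assume "k \<in> {..n}"
      show "coeff (theta ?f) k * (\<Sum>i\<le>n. of_nat i * x $ e i * tower log_family (k + i) (Suc 1) x)
         = - (coeff (theta (theta ?f)) k * ?A 1 k) - (if k = n then coeff (theta ?f) n * ?D n else 0)"
      proof (cases "k = 0")
        case True
        then show ?thesis using n_pos by simp
      next
        case False
        then have "?D k = 0" if "k \<noteq> n"
            using tower_all_roots_one(2)[OF x, of k] that \<open>k \<in> {..n}\<close> by simp
        moreover have "(\<Sum>i\<le>n. of_nat i * x $ e i * tower log_family (k + i) (Suc 1) x)
            = - of_nat k * ?A 1 k - ?D k"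
          using False by (intro log_tower_weighted_euler[OF x]) simp
        ultimately show ?thesis by (simp only:) (simp add: algebra_simps)
      qed
    qed
    also have "\<dots> = - lin (?A 1) (theta (theta ?f)) - coeff (theta ?f) n * ?D n"
      using order_trans[OF degree_theta deg(2)] by (simp add: lin_bound sum_subtractf sum_negf)
    also have "coeff (theta ?f) n * ?D n = - of_nat n"
      using tower_all_roots_one(3)[OF x] coordinates_nonzero(2)[OF x] by (simp add: coeff_fpoly)
    finally show ?thesis by simp
  qed
  ultimately show ?thesis by (simp add: lin_diff)
qed

text \<open>
  Residues at \<open>r\<^sub>t\<close> isolate \<open>a\<^sub>t\<close>; then the log solution isolates \<open>\<Phi>\<^sub>(\<^sub>0\<^sub>,\<^sub>0\<^sub>)\<close>, of which all \<open>\<Phi>\<^sub>c\<close> are derivatives.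
\<close>

lemma left_kernel_trivial:
  assumes \<Phi>: "\<Phi> \<in> Sol" and zero: "\<And>\<Psi> x. \<Psi> \<in> Sol_int \<Longrightarrow>
      x \<in> U \<Longrightarrow> pairing n e \<Phi> \<Psi> x = 0"
  shows "\<Phi> = 0"
proof -
  have weight0: "weight \<Phi> t x = 0" if x: "x \<in> U" and t: "t < n" for x t
  proof -
    let ?c = "\<lambda>s. if s = t then 1 else 0 :: complex"
    define \<kappa> where "\<kappa> = x $ e 0 * (\<Sum>s<n. ?c s / (r s x * slp x s))"
    have "0 = pairing n e \<Phi> (tower_solution (combination ?c) interior_points) x"
      using zero[OF combination_interior_solution x] by simp
    also have "\<dots> = - of_nat n * (\<Sum>s<n. weight \<Phi> s x * (- ?c s - \<kappa>))"
      unfolding pairing_eq[OF \<Phi> combination_interior_solution x] log_part_combination[OF x] \<kappa>_def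
      by (simp add: period_combination[OF x])
    also have "(\<Sum>s<n. weight \<Phi> s x * (- ?c s - \<kappa>)) = - (\<Sum>s<n. if s
        = t then weight \<Phi> t x else 0) - \<kappa> * (\<Sum>s<n. weight \<Phi> s x)"
      unfolding sum_distrib_left sum_subtractf[symmetric] sum_negf[symmetric]
      by (rule sum.cong) (auto simp: algebra_simps)
    finally show ?thesis using t n_pos by (simp add: sum_weights[OF \<Phi> x])
  qed
  have origin: "\<Phi> (0, 0) x = 0" if x: "x \<in> U" for x
    using zero[OF log_interior_solution x] n_pos
    by (simp add: pairing_eq[OF \<Phi> log_interior_solution x] log_part_log_solution[OF x] weight0[OF x])
  have "level \<Phi> l x k = 0" if "k \<le> n * l" "x \<in> U" for k l x
    using that
  proof (induction l arbitrary: k x)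
    case 0
    then show ?case using origin by (simp add: level_def)
  next
    case (Suc l)
    \<comment> \<open>Truncated subtraction: \<open>v\<^sub>0\<close> is split off whenever \<open>(k, l)\<close> is still in the cone.\<close>
    define i where "i = k - n * l"
    define k' where "k' = k - i"
    have ki: "k' \<le> n * l" "i \<le> n" "k = k' + i" using Suc.prems by (auto simp: i_def k'_def)
    have "\<Phi> ((int k', int l) + gen i) x = 0"
      using Suc.IH[OF ki(1)] ki(1)
      by (intro solution_step_zero[OF \<Phi> _ ki(2) _ Suc.prems(2)]) (auto simp: closed_iff level_def)
    then show ?case by (simp add: level_def gen_def ki(3) add.commute)
  qed
  then show ?thesis
    by (intro solution_zeroI[OF \<Phi> closed_nonneg]) (auto simp: closed_iff)
qed

text \<open>
  The constant solution isolates \<open>E\<close> and the solutions starting with \<open>log r\<^sub>s - log r\<^sub>t\<close> isolate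
  \<open>B\<^sub>s - B\<^sub>t\<close>. Interpolation at the roots then gives \<open>\<Psi>\<^sub>1 = 0\<close>. In degree 2 the \<open>z l\<^sub>s\<^sup>2\<close> and the multiples of
  \<open>z f\<close> span all \<open>z\<^sup>k\<close> with \<open>0 < k < 2 n\<close>; \<open>\<Psi>\<^sub>2\<close> kills the former because \<open>E = 0\<close>, the latter because \<open>\<Psi>\<^sub>1 = 0\<close>.
  Degree 2 has to be treated separately: for \<open>n = 1\<close> it contains an interior point although degree 1 has none.
\<close>

lemma right_kernel_trivial:
  assumes \<Psi>: "\<Psi> \<in> Sol_int" and zero: "\<And>\<Phi> x. \<Phi> \<in> Sol \<Longrightarrow>
      x \<in> U \<Longrightarrow> pairing n e \<Phi> \<Psi> x = 0"
  shows "\<Psi> = 0"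
proof -
  have log0: "log_part \<Psi> x = 0" if x: "x \<in> U" for x
  proof -
    have "tower_solution (constant_family 1) closed_points (0, 0) x = 1"
      using x closed_iff[of 0 0] by (simp add: tower_solution_def constant_family_def)
    then show ?thesis
      using zero[OF constant_solution x]
      by (simp add: pairing_eq[OF constant_solution \<Psi> x] weight_constant[OF x])
  qed
  have periods: "period \<Psi> s x = period \<Psi> t x" if x: "x \<in> U" and st: "s < n" "t < n" for s t x
  proof (cases "s = t")
    case False
    define c where "c u = (if u = s then 1 else 0) - (if u = t then 1 else 0 :: complex)" for u
    have c: "(\<Sum>u<n. c u) = 0" using st by (simp add: c_def sum_subtractf)
    have "(\<Sum>u<n. c u * period \<Psi> u x) = 0"
      using zero[OF combination_solution[OF c] x] n_pos
      by (simp add: pairing_eq[OF combination_solution[OF c] \<Psi> x] weight_combination[OF c x] log0[OF x])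
    also have "(\<Sum>u<n. c u * period \<Psi> u x) = (\<Sum>u<n. (if u
        = s then period \<Psi> s x else 0) - (if u = t then period \<Psi> t x else 0))"
      by (rule sum.cong) (auto simp: c_def)
    finally show ?thesis using st by (simp add: sum_subtractf)
  qed simp
  have one: "level \<Psi> 1 x k = 0" if x: "x \<in> U" and k: "0 < k" "k < n" for k x
  proof -
    interpret R: simple_roots n "fpoly x" "\<lambda>s. r s x" by (rule simple_roots_at[OF x])
    have "monom 1 k = (\<Sum>s<n. smult (poly (monom 1 k) (r s x) / slp x s) (cof x s))"
      using k by (intro R.interpolation) (simp add: degree_monom_eq)
    then have "lin (level \<Psi> 1 x) (monom 1 k)
        = (\<Sum>s<n. r s x ^ k / slp x s * lin (level \<Psi> 1 x) (cof x s))"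
      by (simp add: lin_sum lin_smult poly_monom)
    also have "\<dots> = (\<Sum>s<n. r s x ^ (k - 1) / slp x s * period \<Psi> 0 x)"
    proof (rule sum.cong[OF refl])
      fix s assume s: "s \<in> {..<n}"
      then have "period \<Psi> 0 x = r s x * lin (level \<Psi> 1 x) (cof x s)"
        using periods[OF x, of 0 s] by (simp add: period_def lin_smult)
      then show "r s x ^ k / slp x s * lin (level \<Psi> 1 x) (cof x s)
          = r s x ^ (k - 1) / slp x s * period \<Psi> 0 x"
        using k(1) by (cases k) simp_all
    qed
    also have "\<dots> = (\<Sum>s<n. r s x ^ (k - 1) / slp x s) * period \<Psi> 0 x"
        by (simp add: sum_distrib_right)
    also have "\<dots> = 0" using R.power_sum_over_slopes[of "k - 1"] k by simp
    finally show ?thesis by (simp add: lin_monom)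
  qed
  have two: "lin (level \<Psi> 2 x) (pCons 0 g) = 0" if x: "x \<in> U" and g: "degree g \<le> 2 * n - 2" for g x
  proof -
    interpret R: simple_roots n "fpoly x" "\<lambda>s. r s x" by (rule simple_roots_at[OF x])
    let ?A = "level \<Psi> 2 x"
    \<comment> \<open>The combination of squares of cofactors that agrees with \<open>g\<close> at the roots.\<close>
    define q where "q = (\<Sum>s<n. smult (poly g (r s x) / (slp x s)\<^sup>2) (cof x s * cof x s))"
    have sq: "degree (cof x s * cof x s) \<le> 2 * n - 2" for s
      using degree_mult_le[of "cof x s" "cof x s"] R.degree_cofactor[of s] by simp
    have "degree q \<le> 2 * n - 2"
      unfolding q_def by (intro degree_sum_le order_trans[OF degree_smult_le] sq) auto
    with g have deg: "degree (g - q) \<le> 2 * n - 2" by (rule degree_diff_le)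
    have at_roots: "poly (g - q) (r t x) = 0" if t: "t < n" for t
    proof -
      have "poly q (r t x) = (\<Sum>s<n. if s = t then poly g (r t x) else 0)"
        unfolding q_def poly_sum
        by (rule sum.cong) (use t x in \<open>auto simp: poly_cof_root slp_nonzero power2_eq_square\<close>)
      then show ?thesis using t by simp
    qed
    define u where "u = (g - q) div fpoly x"
    have "(g - q) mod fpoly x = 0"
    proof (rule R.eq_if_agree_on_roots)
      have f0: "fpoly x \<noteq> 0" by (rule fpoly_nonzero[OF x])
      show "degree ((g - q) mod fpoly x) < n"
        using degree_mod_less[OF f0, of "g - q"] R.degree_f n_pos by auto
      show "poly ((g - q) mod fpoly x) (r s x) = poly 0 (r s x)" if "s < n" for s
      proof -
        have "poly (g - q) (r s x)
            = poly ((g - q) div fpoly x) (r s x) * poly (fpoly x) (r s x) + poly ((g - q) mod fpoly x) (r s x)"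
          by (metis div_mult_mod_eq poly_add poly_mult)
        then show ?thesis using at_roots[OF that] R.root[OF that] by (simp del: poly_diff)
      qed
    qed (use n_pos in simp)
    then have fu: "g - q = fpoly x * u" unfolding u_def by (metis div_mult_mod_eq add.right_neutral mult.commute)
    have u_supp: "Suc k < n" if "coeff u k \<noteq> 0" for k
    proof -
      have "u \<noteq> 0" using that by auto
      then have "degree (g - q) = n + degree u"
        unfolding fu using fpoly_nonzero[OF x] R.degree_f by (simp add: degree_mult_eq)
      then show ?thesis using deg le_degree[OF that] n_pos by linarith
    qed
    have "lin ?A (pCons 0 q) = 0"
    proof -
      have "pCons 0 q = (\<Sum>s<n. smult (poly g (r s x) / (slp x s)\<^sup>2) (pCons 0 (cof x s * cof x s)))"
        unfolding q_def by (rule poly_eqI) (simp add: coeff_sum coeff_pCons split: nat.split)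
      moreover have "lin ?A (pCons 0 (cof x s * cof x s)) = 0" if "s < n" for s
        using log_part_eq[OF \<Psi> x that] log0[OF x] n_pos r_nonzero[OF that x] by simp
      ultimately show ?thesis by (simp add: lin_sum lin_smult del: smult_pCons)
    qed
    moreover have "lin ?A (pCons 0 (fpoly x * u)) = 0"
    proof -
      have "(int k, int 1) \<in> interior_points" if "coeff (pCons 0 u) k \<noteq> 0" for k
      proof -
        from that obtain m where "k = Suc m" "coeff u m \<noteq> 0" by (cases k) auto
        then show ?thesis using u_supp[of m] by (subst interior_iff) simp
      qed
      then have "lin ?A (fpoly x * pCons 0 u) = - lin (level \<Psi> 1 x) (pCons 0 u)"
        using lin_solution_mult(1)[OF \<Psi> x, of "pCons 0 u" 1] by (simp add: numeral_2_eq_2)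
      also have "lin (level \<Psi> 1 x) (pCons 0 u) = lin (\<lambda>k. 0) (pCons 0 u)"
      proof (rule lin_cong)
        fix k assume "coeff (pCons 0 u) k \<noteq> 0"
        then show "level \<Psi> 1 x k = 0" using u_supp one[OF x] by (cases k) auto
      qed
      finally show ?thesis by (simp add: lin_def)
    qed
    moreover have "pCons 0 g = pCons 0 q + pCons 0 (fpoly x * u)" using fu by (simp add: algebra_simps)
    ultimately show ?thesis by (simp only: lin_add) simp
  qed
  have "level \<Psi> l x k = 0" if "0 < k" "k < n * l" "x \<in> U" for k l x
    using that
  proof (induction l arbitrary: k x)
    case (Suc l)
    consider "l = 0" | "l = 1" | "l > 1" by linarith
    then show ?case
    proof cases
      case 1
      then show ?thesis using one Suc.prems by simp
    next
      case 2
      have "lin (level \<Psi> 2 x) (pCons 0 (monom 1 (k - 1))) = 0"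
        using Suc.prems 2 by (intro two) (auto simp: degree_monom_eq)
      moreover have "pCons 0 (monom 1 (k - 1)) = (monom 1 k :: complex poly)"
        using Suc.prems(1) by (cases k) (simp_all add: monom_Suc)
      ultimately show ?thesis using 2 by (simp add: lin_monom numeral_2_eq_2)
    next
      case 3
      \<comment> \<open>Some \<open>v\<^sub>i\<close> can be split off inside the open cone; \<open>v\<^sub>0\<close> or \<open>v\<^sub>n\<close> always works.\<close>
      define i where "i = (if k < n * l then 0 else n)"
      define k' where "k' = k - i"
      have "n < n * l" using 3 n_pos by simp
      then have "n < k" if "\<not> k < n * l" using that by linarith
      then have ki: "0 < k'" "k' < n * l" "i \<le> n" "k = k' + i"
        using Suc.prems n_pos by (cases "k < n * l", auto simp: i_def k'_def)
      have "\<Psi> ((int k', int l) + gen i) x = 0"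
        using Suc.IH[OF ki(1,2)] ki(1,2)
        by (intro solution_step_zero[OF \<Psi> _ ki(3) _ Suc.prems(3)]) (auto simp: interior_iff level_def)
      then show ?thesis by (simp add: level_def gen_def ki(4) add.commute)
    qed
  qed simp
  then show ?thesis
    by (intro solution_zeroI[OF \<Psi> interior_nonneg]) (auto simp: interior_iff)
qed

text \<open>
  Constancy spreads the vanishing of the pairing from \<open>p\<close> to \<open>U\<close>, as the kernel lemmas require.
\<close>

theorem pairing_nondegenerate:
  assumes "connected U" and p: "p \<in> U"
  shows "nondegenerate_pairing Sol Sol_int (\<lambda>\<Phi> \<Psi>. pairing n e \<Phi> \<Psi> p)"
proof -
  have const: "pairing n e \<Phi> \<Psi> x = pairing n e \<Phi> \<Psi> p"
      if "\<Phi> \<in> Sol" "\<Psi> \<in> Sol_int" "x \<in> U" for \<Phi> \<Psi> x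
    using pairing_constant[OF that(1,2) assms(1)] that(3) p unfolding constant_on_def by metis
  show ?thesis
    unfolding nondegenerate_pairing_def
  proof (intro conjI ballI impI)
    show "\<Phi> = 0" if "\<Phi> \<in> Sol" "\<forall>\<Psi>\<in>Sol_int. pairing n e \<Phi> \<Psi> p = 0"
        for \<Phi>
      by (rule left_kernel_trivial[OF that(1)]) (use const that in auto)
    show "\<Psi> = 0" if "\<Psi> \<in> Sol_int" "\<forall>\<Phi>\<in>Sol. pairing n e \<Phi> \<Psi> p = 0"
        for \<Psi>
      by (rule right_kernel_trivial[OF that(1)]) (use const that in auto)
  qed
qed

end

lemma (in gkz_locus) root_and_log_functions:
  assumes "simply_connected U"
  obtains r L where "gkz_logs n e U r L"
proof -
  obtain r where r: "\<And>s. s < n \<Longrightarrow> continuous_on U (r s)"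
    "\<And>s x. s < n \<Longrightarrow> x \<in> U \<Longrightarrow> poly (fpoly x) (r s x) = 0"
    "\<And>x. x \<in> U \<Longrightarrow> inj_on (\<lambda>s. r s x) {..<n}"
    using global_roots[OF assms] by blast
  interpret R: gkz_roots n e U r by unfold_locales (use r in auto)
  have "\<exists>L. continuous_on U L \<and> (\<forall>x\<in>U. r s x = exp (L x))" if s: "s < n" for s
  proof (rule continuous_logarithm_on_simply_connected[OF r(1)[OF s] assms open_imp_locally_path_connected[OF
      open_U]])
    show "r s x \<noteq> 0" if "x \<in> U" for x
      using simple_roots.root_nonzero[OF R.simple_roots_at[OF that] s] .
  qed blast
  then obtain L where L: "\<And>s. s < n \<Longrightarrow>
      continuous_on U (L s) \<and> (\<forall>x\<in>U. r s x = exp (L s x))" by metis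
  have "gkz_logs n e U r L" by unfold_locales (use L in auto)
  then show ?thesis by (rule that)
qed

theorem corollary3p3:
  fixes n :: nat
    and e :: "nat \<Rightarrow> 'm::finite"
    and U :: "(complex ^ 'm) set"
  assumes "n \<ge> 1"
    and "bij_betw e {0..n} UNIV"
    and "open U" and "simply_connected U"
    and "U \<subseteq> nondegenerate_locus n e"
  defines "Sol \<equiv> bbGKZ_solutions n e U (lattice_points (sigma_cone 0 n))"
    and "Sol_int \<equiv> bbGKZ_solutions n e U (lattice_points (interior (sigma_cone 0 n)))"
  shows "(\<forall>\<Phi>\<in>Sol. \<forall>\<Psi>\<in>Sol_int. pairing n e \<Phi> \<Psi> constant_on U) \<and>
         (\<forall>p\<in>U. nondegenerate_pairing Sol Sol_int (\<lambda>\<Phi> \<Psi>. pairing n e \<Phi> \<Psi> p))"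
proof -
  interpret gkz_locus n e U by unfold_locales (use assms in auto)
  obtain r L where "gkz_logs n e U r L" using root_and_log_functions[OF \<open>simply_connected U\<close>] .
  then interpret gkz_logs n e U r L .
  have "connected U" using \<open>simply_connected U\<close> by (rule simply_connected_imp_connected)
  then show ?thesis
    unfolding Sol_def Sol_int_def using pairing_constant pairing_nondegenerate by blast
qed

end
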